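(* Let $W$ be a Weyl group of type $Y_{a,b,c}$ ($a,b,c\ge1$) and let $V$ be the reflection representation of $W$ over a field $F$ of characteristic zero. If $Y_{a,b,c}$ is not of affine type, then the module $S^2(V)$ decomposes as a direct sum of irreducible modules: the one-dimensional module $F\omega$, and the modules $F(\mathcal{B}\cap X_i)$ corresponding to the $W$-orbits $X_i$ of real 2-roots.
   Context: $Y_{a,b,c}$ ($a,b,c\ge1$) is the tree with $n=a+b+c+1$ vertices consisting of three paths with $a$, $b$ and $c$ vertices, each joined by one of its endpoints to a common trivalent branch vertex. It is of affine type exactly when it is affine $E_6$, $E_7$ or $E_8$, i.e. $\{a,b,c\}=\{2,2,2\}$, $\{1,3,3\}$ or $\{1,2,5\}$ as multisets. Its Cartan matrix $A$ has $A_{ii}=2$, $A_{ij}=-1$ if $i,j$ are adjacent, and $A_{ij}=0$ otherwise. $W$ is the group generated by $s_1,\dots,s_n$ subject to $s_i^2=1$, $s_is_j=s_js_i$ if $A_{ij}=0$, and $s_is_js_i=s_js_is_j$ if $A_{ij}=-1$. $V$ is the $F$-vector space with basis the simple roots $\Pi=\{\alpha_1,\dots,\alpha_n\}$, with symmetric bilinear form $B(\alpha_i,\alpha_j)=A_{ij}$, on which $W$ acts by $s_i(v)=v-B(\alpha_i,v)\alpha_i$. A real root is a vector $w(\alpha_i)$ with $w\in W$. For $\alpha,\beta\in V$, $\alpha\vee\beta=\alpha\otimes\beta+\beta\otimes\alpha$; $S^2(V)\subseteq V\otimes V$ is the span of these elements, with the diagonal $W$-action. A real 2-root is $\alpha\vee\beta$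 with $\alpha,\beta$ real roots such that $B(\alpha,\beta)=0$; $W$ permutes the real 2-roots. In the non-affine case $B$ is nondegenerate; let $\alpha_i^*\in V$ be defined by $B(\alpha_i^*,\alpha_j)=\delta_{ij}$. The Virasoro element is $\omega=\sum_{i=1}^n\alpha_i^*\otimes\alpha_i$, which lies in $S^2(V)$. Canonical basis. The highest root of a type $D_m$ ($m\ge4$) root system is the sum of the simple roots with coefficient $1$ at the endpoints of the diagram and $2$ at all other vertices. For a simple root $\alpha_i$, a positive root $\beta$ is elementary with respect to $\alpha_i$ if: (1) $\beta=\alpha_j$ is simple with $A_{ij}=0$; (2) $\beta=\alpha_h+\alpha_i+\alpha_j$ for a path $h$--$i$--$j$ in $Y_{a,b,c}$; or (3) $i$ is not the branch vertex and $\beta=\theta_i$ is the highest root of the standard parabolic subsystem of type $D_m$ ($m\ge 4$) whose simple roots are those on the path from $i$ to the branch vertex together with all neighbours of the branch vertex. $\mathcal{B}$ is the set of all $\alpha_i\vee\beta$ with $\alpha_i\in\Pi$ and $\beta$ elementary with respect to $\alpha_i$; its elements are linearly independent real 2-roots. $F(\mathcal{B}\cap X_i)$ denotes the $F$-span of $\mathcal{B}\cap X_i$. *)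

theory Defs
  imports
    Complex_Main
    "HOL-Algebra.Group_Action"
    "HOL-Library.Function_Algebras"
    "HOL-Library.Multiset"
begin

section \<open>The diagram and its Cartan matrix\<close>

text \<open>\<open>Leg l d\<close> is the vertex of leg \<open>l\<close> at distance \<open>d + 1\<close> from the branch vertex.\<close>

datatype leg = LegA | LegB | LegC

datatype vertex = Branch | Leg leg nat

fun leg_length :: "nat \<Rightarrow> nat \<Rightarrow> nat \<Rightarrow> leg \<Rightarrow> nat" where
  "leg_length a b c LegA = a"
| "leg_length a b c LegB = b"
| "leg_length a b c LegC = c"

definition verts :: "nat \<Rightarrow> nat \<Rightarrow> nat \<Rightarrow> vertex set" where
  "verts a b c = insert Branch {Leg l d | l d. d < leg_length a b c l}"

definition adj :: "vertex \<Rightarrow> vertex \<Rightarrow> bool" where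
  "adj u v \<longleftrightarrow> (\<exists>l. {u, v} = {Branch, Leg l 0}) \<or> (\<exists>l d. {u, v} = {Leg l d, Leg l (Suc d)})"

definition cartan :: "vertex \<Rightarrow> vertex \<Rightarrow> int" where
  "cartan u v = (if u = v then 2 else if adj u v then - 1 else 0)"

definition affine_type :: "nat \<Rightarrow> nat \<Rightarrow> nat \<Rightarrow> bool" where
  "affine_type a b c \<longleftrightarrow> {#a, b, c#} \<in> {{#2, 2, 2#}, {#1, 3, 3#}, {#1, 2, 5#}}"


section \<open>The Weyl group\<close>

text \<open>
  The group is defined by its presentation, as words in the generators modulo the least
  congruence containing the relations. The relations \<open>s\<^sub>i\<^sup>2 = 1\<close> make each generator its own
  inverse, so words without formal inverses suffice and the quotient monoid is a group
  (lemma \<open>weyl_group_is_group\<close>).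
\<close>

inductive word_eq :: "nat \<Rightarrow> nat \<Rightarrow> nat \<Rightarrow> vertex list \<Rightarrow> vertex list \<Rightarrow> bool" for a b c where
  square: "i \<in> verts a b c \<Longrightarrow> word_eq a b c [i, i] []"
| commute: "\<lbrakk>i \<in> verts a b c; j \<in> verts a b c; cartan i j = 0\<rbrakk> \<Longrightarrow> word_eq a b c [i, j] [j, i]"
| braid: "\<lbrakk>i \<in> verts a b c; j \<in> verts a b c; cartan i j = - 1\<rbrakk>
    \<Longrightarrow> word_eq a b c [i, j, i] [j, i, j]"
| refl: "u \<in> lists (verts a b c) \<Longrightarrow> word_eq a b c u u"
| sym: "word_eq a b c u v \<Longrightarrow> word_eq a b c v u"
| trans: "\<lbrakk>word_eq a b c u v; word_eq a b c v w\<rbrakk> \<Longrightarrow> word_eq a b c u w"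
| append: "\<lbrakk>word_eq a b c u u'; word_eq a b c v v'\<rbrakk> \<Longrightarrow> word_eq a b c (u @ v) (u' @ v')"

definition word_rel :: "nat \<Rightarrow> nat \<Rightarrow> nat \<Rightarrow> (vertex list \<times> vertex list) set" where
  "word_rel a b c = {(u, v). word_eq a b c u v}"

definition weyl_group :: "nat \<Rightarrow> nat \<Rightarrow> nat \<Rightarrow> vertex list set monoid" where
  "weyl_group a b c =
    \<lparr> carrier = lists (verts a b c) // word_rel a b c,
      monoid.mult = (\<lambda>X Y. \<Union>u\<in>X. \<Union>v\<in>Y. word_rel a b c `` {u @ v}),
      one = word_rel a b c `` {[]} \<rparr>"

lemma word_eq_lists:
  "word_eq a b c u v \<Longrightarrow> u \<in> lists (verts a b c) \<and> v \<in> lists (verts a b c)"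
  by (induction rule: word_eq.induct) auto

lemma word_rel_equiv: "equiv (lists (verts a b c)) (word_rel a b c)"
  by (rule equivI)
    (auto simp: refl_on_def sym_def trans_def word_rel_def
      intro: word_eq.refl word_eq.sym word_eq.trans dest: word_eq_lists)

lemma weyl_carrierE:
  assumes "X \<in> carrier (weyl_group a b c)"
  obtains u where "u \<in> lists (verts a b c)" "X = word_rel a b c `` {u}"
  using assms by (auto simp: weyl_group_def quotient_def)

lemma weyl_carrierI: "u \<in> lists (verts a b c) \<Longrightarrow> word_rel a b c `` {u} \<in> carrier (weyl_group a b c)"
  by (auto simp: weyl_group_def quotient_def)

lemma weyl_mult:
  assumes "u \<in> lists (verts a b c)" "v \<in> lists (verts a b c)"
  shows "word_rel a b c `` {u} \<otimes>\<^bsub>weyl_group a b c\<^esub> word_rel a b c `` {v} = word_rel a b c `` {u @ v}"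
proof -
  have cong: "word_rel a b c `` {u' @ v'} = word_rel a b c `` {u @ v}"
    if "u' \<in> word_rel a b c `` {u}" "v' \<in> word_rel a b c `` {v}" for u' v'
    using word_eq.append[of a b c u u' v v'] that
      equiv_class_eq[OF word_rel_equiv, of "u @ v" "u' @ v'" a b c]
    by (simp add: word_rel_def)
  have ne: "word_rel a b c `` {u} \<noteq> {}" "word_rel a b c `` {v} \<noteq> {}"
    using assms by (auto simp: word_rel_def intro: word_eq.refl)
  have "(\<Union>u'\<in>word_rel a b c `` {u}. \<Union>v'\<in>word_rel a b c `` {v}. word_rel a b c `` {u' @ v'})
      = (\<Union>u'\<in>word_rel a b c `` {u}. \<Union>v'\<in>word_rel a b c `` {v}. word_rel a b c `` {u @ v})"
    by (intro SUP_cong HOL.refl cong)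
  also have "\<dots> = word_rel a b c `` {u @ v}"
    unfolding UN_constant using ne by (simp only: if_False)
  finally show ?thesis by (simp add: weyl_group_def)
qed

lemma word_eq_rev: "u \<in> lists (verts a b c) \<Longrightarrow> word_eq a b c (rev u @ u) []"
proof (induction u)
  case Nil
  then show ?case by (auto intro: word_eq.refl)
next
  case (Cons i u)
  then have i: "i \<in> verts a b c" and u: "u \<in> lists (verts a b c)" by auto
  have ru: "rev u \<in> lists (verts a b c)" using u by auto
  have "word_eq a b c (rev u @ ([i, i] @ u)) (rev u @ ([] @ u))"
    by (intro word_eq.append word_eq.refl word_eq.square i u ru)
  then show ?case
    using Cons.IH[OF u] word_eq.trans by fastforce
qed

lemma weyl_group_is_group: "Group.group (weyl_group a b c)"
proof (rule groupI)
  show one: "\<one>\<^bsub>weyl_group a b c\<^esub> \<in> carrier (weyl_group a b c)"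
    by (auto simp: weyl_group_def quotient_def)
  have one_eq: "\<one>\<^bsub>weyl_group a b c\<^esub> = word_rel a b c `` {[]}"
    by (simp add: weyl_group_def)
  fix x assume "x \<in> carrier (weyl_group a b c)"
  then obtain u where u: "u \<in> lists (verts a b c)" "x = word_rel a b c `` {u}"
    by (rule weyl_carrierE)
  show "\<one>\<^bsub>weyl_group a b c\<^esub> \<otimes>\<^bsub>weyl_group a b c\<^esub> x = x"
    using u weyl_mult[of "[]" a b c u] by (simp add: one_eq)
  have ru: "rev u \<in> lists (verts a b c)" using u by auto
  have "word_rel a b c `` {rev u @ u} = word_rel a b c `` {[]}"
    using equiv_class_eq[OF word_rel_equiv] word_eq_rev[OF u(1)] by (simp add: word_rel_def)
  then have "word_rel a b c `` {rev u} \<otimes>\<^bsub>weyl_group a b c\<^esub> x = \<one>\<^bsub>weyl_group a b c\<^esub>"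
    using u ru by (simp add: weyl_mult one_eq)
  then show "\<exists>y\<in>carrier (weyl_group a b c). y \<otimes>\<^bsub>weyl_group a b c\<^esub> x = \<one>\<^bsub>weyl_group a b c\<^esub>"
    using weyl_carrierI[OF ru] by blast
  fix y assume "y \<in> carrier (weyl_group a b c)"
  then obtain v where v: "v \<in> lists (verts a b c)" "y = word_rel a b c `` {v}"
    by (rule weyl_carrierE)
  have uv: "u @ v \<in> lists (verts a b c)" using u v by auto
  show "x \<otimes>\<^bsub>weyl_group a b c\<^esub> y \<in> carrier (weyl_group a b c)"
    using u v weyl_carrierI[OF uv] by (simp add: weyl_mult)
  fix z assume "z \<in> carrier (weyl_group a b c)"
  then obtain w where w: "w \<in> lists (verts a b c)" "z = word_rel a b c `` {w}"
    by (rule weyl_carrierE)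
  have vw: "v @ w \<in> lists (verts a b c)" using v w by auto
  show "x \<otimes>\<^bsub>weyl_group a b c\<^esub> y \<otimes>\<^bsub>weyl_group a b c\<^esub> z
      = x \<otimes>\<^bsub>weyl_group a b c\<^esub> (y \<otimes>\<^bsub>weyl_group a b c\<^esub> z)"
    using u v w uv vw by (simp add: weyl_mult del: append_in_lists_conv)
qed


section \<open>Vector spaces of functions and internal direct sums\<close>

definition fscale :: "'F::field \<Rightarrow> ('i \<Rightarrow> 'F) \<Rightarrow> 'i \<Rightarrow> 'F" where
  "fscale k f = (\<lambda>x. k * f x)"

lemma fscale_apply [simp]: "fscale k f x = k * f x"
  by (simp add: fscale_def)

interpretation fs: vector_space "fscale :: 'F::field \<Rightarrow> ('i \<Rightarrow> 'F) \<Rightarrow> 'i \<Rightarrow> 'F"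
  by unfold_locales (auto simp: fscale_def fun_eq_iff algebra_simps)

definition internal_direct_sum :: "('i \<Rightarrow> 'F::field) set \<Rightarrow> 'k set \<Rightarrow> ('k \<Rightarrow> ('i \<Rightarrow> 'F) set) \<Rightarrow> bool"
  where
  "internal_direct_sum U K M \<longleftrightarrow>
    (\<forall>k\<in>K. fs.subspace (M k)) \<and>
    fs.span (\<Union>k\<in>K. M k) = U \<and>
    (\<forall>k\<in>K. M k \<inter> fs.span (\<Union>l\<in>K - {k}. M l) = {0})"


section \<open>The reflection representation and real roots\<close>

text \<open>
  Vectors of \<open>V\<close> are their coordinate functions with respect to the simple roots, vanishing
  off the diagram; \<open>V \<otimes> V\<close> is likewise given by coordinates with respect to the basis of
  the \<open>\<alpha>\<^sub>i \<otimes> \<alpha>\<^sub>j\<close>.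
\<close>

definition refl_space :: "nat \<Rightarrow> nat \<Rightarrow> nat \<Rightarrow> (vertex \<Rightarrow> 'F::field) set" where
  "refl_space a b c = {v. \<forall>i. i \<notin> verts a b c \<longrightarrow> v i = 0}"

definition simple_root :: "vertex \<Rightarrow> vertex \<Rightarrow> 'F::field" where
  "simple_root i = (\<lambda>j. if j = i then 1 else 0)"

definition bform :: "nat \<Rightarrow> nat \<Rightarrow> nat \<Rightarrow> (vertex \<Rightarrow> 'F::field) \<Rightarrow> (vertex \<Rightarrow> 'F) \<Rightarrow> 'F" where
  "bform a b c u v = (\<Sum>i\<in>verts a b c. \<Sum>j\<in>verts a b c. of_int (cartan i j) * u i * v j)"

definition reflection ::
  "nat \<Rightarrow> nat \<Rightarrow> nat \<Rightarrow> vertex \<Rightarrow> (vertex \<Rightarrow> 'F::field) \<Rightarrow> vertex \<Rightarrow> 'F" where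
  "reflection a b c i v = v - fscale (bform a b c (simple_root i) v) (simple_root i)"

definition word_act ::
  "nat \<Rightarrow> nat \<Rightarrow> nat \<Rightarrow> vertex list \<Rightarrow> (vertex \<Rightarrow> 'F::field) \<Rightarrow> vertex \<Rightarrow> 'F" where
  "word_act a b c u v = foldr (reflection a b c) u v"

text \<open>All words representing \<open>w\<close> act in the same way; see lemma \<open>weyl_act_class\<close>.\<close>

definition weyl_act ::
  "nat \<Rightarrow> nat \<Rightarrow> nat \<Rightarrow> vertex list set \<Rightarrow> (vertex \<Rightarrow> 'F::field) \<Rightarrow> vertex \<Rightarrow> 'F" where
  "weyl_act a b c w v = the_elem ((\<lambda>u. word_act a b c u v) ` w)"

definition real_roots :: "nat \<Rightarrow> nat \<Rightarrow> nat \<Rightarrow> (vertex \<Rightarrow> 'F::field) set" where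
  "real_roots a b c =
    {weyl_act a b c w (simple_root i) | w i. w \<in> carrier (weyl_group a b c) \<and> i \<in> verts a b c}"

definition positive_roots :: "nat \<Rightarrow> nat \<Rightarrow> nat \<Rightarrow> (vertex \<Rightarrow> 'F::field) set" where
  "positive_roots a b c = {\<beta> \<in> real_roots a b c. \<forall>i. \<beta> i \<in> \<nat>}"


section \<open>The symmetric square and real 2-roots\<close>

definition tensor :: "(vertex \<Rightarrow> 'F::field) \<Rightarrow> (vertex \<Rightarrow> 'F) \<Rightarrow> vertex \<times> vertex \<Rightarrow> 'F" where
  "tensor u v = (\<lambda>(i, j). u i * v j)"

definition sym_prod :: "(vertex \<Rightarrow> 'F::field) \<Rightarrow> (vertex \<Rightarrow> 'F) \<Rightarrow> vertex \<times> vertex \<Rightarrow> 'F" where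
  "sym_prod u v = tensor u v + tensor v u"

definition sym_square :: "nat \<Rightarrow> nat \<Rightarrow> nat \<Rightarrow> (vertex \<times> vertex \<Rightarrow> 'F::field) set" where
  "sym_square a b c = fs.span {sym_prod u v | u v. u \<in> refl_space a b c \<and> v \<in> refl_space a b c}"

text \<open>
  The diagonal action is the linear extension of
  \<open>\<alpha>\<^sub>i \<otimes> \<alpha>\<^sub>j \<mapsto> w \<alpha>\<^sub>i \<otimes> w \<alpha>\<^sub>j\<close>; see lemma \<open>diag_act_tensor\<close>.
\<close>

definition diag_act ::
  "nat \<Rightarrow> nat \<Rightarrow> nat \<Rightarrow> vertex list set \<Rightarrow> (vertex \<times> vertex \<Rightarrow> 'F::field) \<Rightarrow> vertex \<times> vertex \<Rightarrow> 'F"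
  where
  "diag_act a b c w T =
    (\<Sum>i\<in>verts a b c. \<Sum>j\<in>verts a b c.
      fscale (T (i, j)) (tensor (weyl_act a b c w (simple_root i)) (weyl_act a b c w (simple_root j))))"

definition real_2roots :: "nat \<Rightarrow> nat \<Rightarrow> nat \<Rightarrow> (vertex \<times> vertex \<Rightarrow> 'F::field) set" where
  "real_2roots a b c =
    {sym_prod \<alpha> \<beta> | \<alpha> \<beta>. \<alpha> \<in> real_roots a b c \<and> \<beta> \<in> real_roots a b c \<and> bform a b c \<alpha> \<beta> = 0}"

definition submodule ::
  "nat \<Rightarrow> nat \<Rightarrow> nat \<Rightarrow> (vertex \<times> vertex \<Rightarrow> 'F::field) set \<Rightarrow> bool" where
  "submodule a b c U \<longleftrightarrow> fs.subspace U \<and> U \<subseteq> sym_square a b c \<and>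
    (\<forall>w\<in>carrier (weyl_group a b c). \<forall>T\<in>U. diag_act a b c w T \<in> U)"

definition irreducible_submodule ::
  "nat \<Rightarrow> nat \<Rightarrow> nat \<Rightarrow> (vertex \<times> vertex \<Rightarrow> 'F::field) set \<Rightarrow> bool" where
  "irreducible_submodule a b c U \<longleftrightarrow> submodule a b c U \<and> U \<noteq> {0} \<and>
    (\<forall>U'. submodule a b c U' \<and> U' \<subseteq> U \<longrightarrow> U' = {0} \<or> U' = U)"


section \<open>The Virasoro element\<close>

text \<open>Meaningful when the form is nondegenerate on \<open>V\<close>, i.e. in non-affine type.\<close>

definition dual_root :: "nat \<Rightarrow> nat \<Rightarrow> nat \<Rightarrow> vertex \<Rightarrow> vertex \<Rightarrow> 'F::field" where
  "dual_root a b c i = (THE v. v \<in> refl_space a b c \<and>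
    (\<forall>j\<in>verts a b c. bform a b c v (simple_root j) = (if i = j then 1 else 0)))"

definition virasoro :: "nat \<Rightarrow> nat \<Rightarrow> nat \<Rightarrow> vertex \<times> vertex \<Rightarrow> 'F::field" where
  "virasoro a b c = (\<Sum>i\<in>verts a b c. tensor (dual_root a b c i) (simple_root i))"


section \<open>The canonical basis\<close>

fun path_to_branch :: "vertex \<Rightarrow> vertex set" where
  "path_to_branch Branch = {Branch}"
| "path_to_branch (Leg l d) = insert Branch {Leg l e | e. e \<le> d}"

definition D_vertices :: "nat \<Rightarrow> nat \<Rightarrow> nat \<Rightarrow> vertex \<Rightarrow> vertex set" where
  "D_vertices a b c i = path_to_branch i \<union> {j \<in> verts a b c. adj Branch j}"

text \<open>For \<open>i\<close> other than the branch vertex the subdiagram is of type \<open>D\<^sub>m\<close> with \<open>m \<ge> 4\<close>;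
  its endpoints are its vertices of degree one.\<close>

definition D_highest_root :: "nat \<Rightarrow> nat \<Rightarrow> nat \<Rightarrow> vertex \<Rightarrow> vertex \<Rightarrow> 'F::field" where
  "D_highest_root a b c i =
    (\<lambda>j. if j \<notin> D_vertices a b c i then 0
         else if card {k \<in> D_vertices a b c i. adj j k} = 1 then 1 else 2)"

definition elementary :: "nat \<Rightarrow> nat \<Rightarrow> nat \<Rightarrow> vertex \<Rightarrow> (vertex \<Rightarrow> 'F::field) \<Rightarrow> bool" where
  "elementary a b c i \<beta> \<longleftrightarrow> \<beta> \<in> positive_roots a b c \<and>
    ((\<exists>j\<in>verts a b c. \<beta> = simple_root j \<and> cartan i j = 0) \<or>
     (\<exists>h\<in>verts a b c. \<exists>j\<in>verts a b c. h \<noteq> j \<and> adj h i \<and> adj i j \<and>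
        \<beta> = simple_root h + simple_root i + simple_root j) \<or>
     (i \<noteq> Branch \<and> \<beta> = D_highest_root a b c i))"

definition canonical_basis :: "nat \<Rightarrow> nat \<Rightarrow> nat \<Rightarrow> (vertex \<times> vertex \<Rightarrow> 'F::field) set" where
  "canonical_basis a b c =
    {sym_prod (simple_root i) \<beta> | i \<beta>. i \<in> verts a b c \<and> elementary a b c i \<beta>}"


section \<open>Well-definedness of the actions\<close>

lemma finite_verts [simp]: "finite (verts a b c)"
proof -
  have "l \<in> {LegA, LegB, LegC}" for l
    by (cases l) simp_all
  then have "finite (UNIV :: leg set)"
    by (intro finite_subset[of UNIV "{LegA, LegB, LegC}"]) blast+
  moreover have "{Leg l d | l d. d < leg_length a b c l} = (\<Union>l. Leg l ` {..<leg_length a b c l})"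
    by blast
  ultimately show ?thesis by (simp add: verts_def)
qed

lemma cartan_sym: "cartan i j = cartan j i"
  by (auto simp: cartan_def adj_def insert_commute)

lemma bform_simple_left:
  assumes "i \<in> verts a b c"
  shows "bform a b c (simple_root i) v = (\<Sum>j\<in>verts a b c. of_int (cartan i j) * v j)"
proof -
  have "bform a b c (simple_root i) v
      = (\<Sum>k\<in>verts a b c. if k = i then \<Sum>j\<in>verts a b c. of_int (cartan k j) * v j else 0)"
    unfolding bform_def by (intro sum.cong) (auto simp: simple_root_def)
  then show ?thesis using assms by simp
qed

lemma bform_simple:
  assumes "i \<in> verts a b c" "j \<in> verts a b c"
  shows "bform a b c (simple_root i) (simple_root j) = of_int (cartan i j)"
proof -
  have "of_int (cartan i k) * simple_root j k = (if k = j then of_int (cartan i j) else (0 :: 'a))" for k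
    by (simp add: simple_root_def)
  then show ?thesis using assms by (simp add: bform_simple_left)
qed

lemma bform_diff_right: "bform a b c u (v - v') = bform a b c u v - bform a b c u v'"
  by (simp add: bform_def algebra_simps sum_subtractf)

lemma bform_add_right: "bform a b c u (v + v') = bform a b c u v + bform a b c u v'"
  by (simp add: bform_def algebra_simps sum.distrib)

lemma bform_scale_right: "bform a b c u (fscale k v) = k * bform a b c u v"
  by (simp add: bform_def fscale_def sum_distrib_left algebra_simps)

lemma word_act_cong: "word_eq a b c u u' \<Longrightarrow> word_act a b c u = word_act a b c u'"
proof (induction rule: word_eq.induct)
  case (square i)
  show ?case
  proof (intro ext)
    fix v :: "vertex \<Rightarrow> 'a" and k
    have "bform a b c (simple_root i) (simple_root i) = (2 :: 'a)"
      using square by (simp add: bform_simple cartan_def)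
    then show "word_act a b c [i, i] v k = word_act a b c [] v k"
      by (simp add: word_act_def reflection_def bform_diff_right bform_scale_right)
  qed
next
  case (commute i j)
  show ?case
  proof (intro ext)
    fix v :: "vertex \<Rightarrow> 'a" and k
    have "bform a b c (simple_root i) (simple_root j) = (0 :: 'a)"
      "bform a b c (simple_root j) (simple_root i) = (0 :: 'a)"
      using commute cartan_sym[of j i] by (simp_all add: bform_simple)
    then show "word_act a b c [i, j] v k = word_act a b c [j, i] v k"
      by (simp add: word_act_def reflection_def bform_diff_right bform_scale_right)
  qed
next
  case (braid i j)
  show ?case
  proof (intro ext)
    fix v :: "vertex \<Rightarrow> 'a" and k
    have "bform a b c (simple_root i) (simple_root i) = (2 :: 'a)"
      "bform a b c (simple_root j) (simple_root j) = (2 :: 'a)"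
      using braid by (simp_all add: bform_simple cartan_def)
    moreover have "bform a b c (simple_root i) (simple_root j) = (- 1 :: 'a)"
      "bform a b c (simple_root j) (simple_root i) = (- 1 :: 'a)"
      using braid cartan_sym[of j i] by (simp_all add: bform_simple)
    ultimately show "word_act a b c [i, j, i] v k = word_act a b c [j, i, j] v k"
      by (simp add: word_act_def reflection_def bform_diff_right bform_scale_right
          bform_add_right algebra_simps)
  qed
next
  case (append u u' v v')
  have "word_act a b c (x @ y) = (word_act a b c x :: (vertex \<Rightarrow> 'a) \<Rightarrow> _) \<circ> word_act a b c y" for x y
    by (simp add: fun_eq_iff word_act_def)
  with append.IH show ?case by simp
qed auto

lemma weyl_act_class:
  assumes "u \<in> lists (verts a b c)"
  shows "weyl_act a b c (word_rel a b c `` {u}) v = word_act a b c u v"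
proof -
  have "word_act a b c u' v = word_act a b c u v" if "u' \<in> word_rel a b c `` {u}" for u'
    using fun_cong[OF word_act_cong, of a b c u u' v] that by (simp add: word_rel_def)
  then have "(\<lambda>u. word_act a b c u v) ` (word_rel a b c `` {u})
      = (\<lambda>_. word_act a b c u v) ` (word_rel a b c `` {u})"
    by (rule image_cong[OF HOL.refl])
  also have "u \<in> word_rel a b c `` {u}"
    using assms by (simp add: word_rel_def word_eq.refl)
  then have "(\<lambda>_. word_act a b c u v) ` (word_rel a b c `` {u}) = {word_act a b c u v}"
    by (rule image_constant)
  finally show ?thesis by (simp add: weyl_act_def)
qed

lemma weyl_act_mult:
  assumes "x \<in> carrier (weyl_group a b c)" "y \<in> carrier (weyl_group a b c)"
  shows "weyl_act a b c (x \<otimes>\<^bsub>weyl_group a b c\<^esub> y) v = weyl_act a b c x (weyl_act a b c y v)"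
proof -
  obtain s where s: "s \<in> lists (verts a b c)" "x = word_rel a b c `` {s}"
    using assms(1) by (rule weyl_carrierE)
  obtain t where t: "t \<in> lists (verts a b c)" "y = word_rel a b c `` {t}"
    using assms(2) by (rule weyl_carrierE)
  have st: "s @ t \<in> lists (verts a b c)" using s t by auto
  have "weyl_act a b c (x \<otimes>\<^bsub>weyl_group a b c\<^esub> y) v = word_act a b c (s @ t) v"
    using weyl_act_class[OF st] s t by (simp add: weyl_mult)
  also have "\<dots> = word_act a b c s (word_act a b c t v)"
    by (simp add: word_act_def)
  finally show ?thesis using s t by (simp add: weyl_act_class)
qed

lemma reflection_linear:
  "reflection a b c i (v + v') = reflection a b c i v + reflection a b c i v'"
  "reflection a b c i (fscale k v) = fscale k (reflection a b c i v)"
  by (auto simp: reflection_def bform_add_right bform_scale_right fun_eq_iff algebra_simps)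

lemma word_act_linear:
  "word_act a b c u (v + v') = word_act a b c u v + word_act a b c u v'"
  "word_act a b c u (fscale k v) = fscale k (word_act a b c u v)"
  by (induction u) (simp_all add: word_act_def reflection_linear)

lemma weyl_act_expand:
  assumes "w \<in> carrier (weyl_group a b c)" "v \<in> refl_space a b c"
  shows "weyl_act a b c w v = (\<Sum>i\<in>verts a b c. fscale (v i) (weyl_act a b c w (simple_root i)))"
proof -
  obtain u where u: "u \<in> lists (verts a b c)" "w = word_rel a b c `` {u}"
    using assms(1) by (rule weyl_carrierE)
  have zero: "word_act a b c u 0 = (0 :: vertex \<Rightarrow> 'a)"
    using word_act_linear(2)[of a b c u 0 0] by (simp only: fs.scale_zero_left)
  have sum: "word_act a b c u (\<Sum>i\<in>S. fscale (v i) (simple_root i))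
      = (\<Sum>i\<in>S. fscale (v i) (word_act a b c u (simple_root i)))" if "finite S" for S
    using that by (induction S) (simp_all only: sum.empty sum.insert zero word_act_linear not_False_eq_True)
  have "v = (\<Sum>i\<in>verts a b c. fscale (v i) (simple_root i))"
  proof
    fix j
    have "(\<Sum>i\<in>S. fscale (v i) (simple_root i)) j = (\<Sum>i\<in>S. if i = j then v i else 0)"
      if "finite S" for S
      using that by (induction S) (auto simp: fscale_def simple_root_def)
    then show "v j = (\<Sum>i\<in>verts a b c. fscale (v i) (simple_root i)) j"
      using assms(2) by (auto simp: refl_space_def)
  qed
  then have "word_act a b c u v = word_act a b c u (\<Sum>i\<in>verts a b c. fscale (v i) (simple_root i))"
    by simp
  then show ?thesis using u by (simp add: sum weyl_act_class)
qed

lemma diag_act_tensor: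
  assumes "w \<in> carrier (weyl_group a b c)" "u \<in> refl_space a b c" "v \<in> refl_space a b c"
  shows "diag_act a b c w (tensor u v) = tensor (weyl_act a b c w u) (weyl_act a b c w v)"
proof
  fix p :: "vertex \<times> vertex"
  have sum_apply: "(\<Sum>i\<in>S. f i) x = (\<Sum>i\<in>S. f i x)" if "finite S"
    for S :: "vertex set" and f :: "vertex \<Rightarrow> 'y \<Rightarrow> 'a" and x
    using that by (induction S) auto
  show "diag_act a b c w (tensor u v) p = tensor (weyl_act a b c w u) (weyl_act a b c w v) p"
    unfolding weyl_act_expand[OF assms(1,2)] weyl_act_expand[OF assms(1,3)] diag_act_def
    by (cases p) (simp add: sum_apply tensor_def fscale_def sum_product algebra_simps)
qed

end

theory Submission
  imports Defs
begin

text \<open>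
  Read a symmetric tensor \<open>T\<close> as a self-adjoint endomorphism of \<open>V\<close> by means of \<open>B\<close>. Then the
  Virasoro element is the identity, its trace is \<open>n\<close>, and all real 2-roots have trace zero. The
  form \<open>B\<close> is nondegenerate because a vector in its radical is determined by its value at the
  branch vertex, where the remaining equation reads \<open>1/(a+1) + 1/(b+1) + 1/(c+1) = 1\<close>; this
  happens in affine type only (\<open>B_nondegenerate\<close>).

  The elementary roots with respect to \<open>\<alpha>\<^sub>i\<close> span the orthogonal complement of \<open>\<alpha>\<^sub>i\<close>
  (\<open>elem_span_orthogonal\<close>). This has three consequences. First, modulo the canonical basis the
  symmetric square has dimension at most one, so the canonical basis spans the kernel of the trace
  (\<open>trace_zero_canonical\<close>). Second, a tensor that is orthogonal to all products of a simple root
  with an elementary one maps each \<open>\<alpha>\<^sub>i\<close> to a multiple of itself, hence is a multiple of the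
  Virasoro element (\<open>scalar_tensor\<close>). Third, every submodule that contains a nonzero tensor of
  trace zero contains a real 2-root: \<open>1 - s\<^sub>k\<close> maps the tensor to a product \<open>\<alpha>\<^sub>k \<or> v\<close> with \<open>v\<close>
  orthogonal to \<open>\<alpha>\<^sub>k\<close>, and the reflection in a root \<open>\<gamma>\<close> orthogonal to \<open>\<alpha>\<^sub>k\<close> then produces
  \<open>\<alpha>\<^sub>k \<or> \<gamma>\<close> (\<open>submodule_contains_two_root\<close>).

  It remains to separate the orbits. Every real 2-root is conjugate to a product of two orthogonal
  simple roots, by descent on the sum of the heights of its members
  (\<open>orthogonal_pos_roots_to_simple\<close>). An orthogonal pair of simple roots is a pair of tokens on
  non-adjacent vertices, and moving tokens along edges shows that all pairs are conjugate, except
  for pairs of leaves on two legs of length one (\<open>not_twin_linked\<close>). Such a pair exists only in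
  type \<open>D\<close>, where in the standard coordinates its product is a difference of two squares, so that
  its orbit is orthogonal to the products of the other pairs, which are made of four different
  coordinates (\<open>twin_orthogonal\<close>). So distinct orbits are orthogonal, and by the second
  consequence above their spans are independent (\<open>orbit_spans_independent\<close>). Together with the
  third consequence this makes each span irreducible (\<open>orbit_span_irreducible\<close>), and the
  canonical basis, being a spanning set made of 2-roots, contains a spanning set of each
  (\<open>canonical_span_orbit\<close>).
\<close>

section \<open>The affine types as unit fractions\<close>

lemma unit_fractions_sorted:
  fixes p q r :: nat
  assumes "2 \<le> p" "p \<le> q" "q \<le> r" and eq: "p * q + q * r + p * r = p * q * r"
  shows "(p, q, r) \<in> {(3, 3, 3), (2, 4, 4), (2, 3, 6)}"
proof -
  have pos: "0 < q * r" "0 < r" using assms by auto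
  have "p * q \<le> r * q" "p * r \<le> q * r" using assms by (intro mult_right_mono; simp)+
  moreover have "r * q = q * r" "p * q * r = p * (q * r)" by (simp_all only: ac_simps)
  ultimately have "p * (q * r) \<le> 3 * (q * r)" using eq by linarith
  then have "p \<le> 3" using pos by simp
  then consider "p = 2" | "p = 3" using assms(1) by linarith
  then show ?thesis
  proof cases
    case 1
    then have e: "2 * q + 2 * r = q * r" using eq by (simp add: algebra_simps)
    then have "q * r \<le> 4 * r" using assms by linarith
    then have "q \<le> 4" using pos by simp
    moreover have "q \<noteq> 2" using e pos by auto
    ultimately consider "q = 3" | "q = 4" using assms 1 by linarith
    then show ?thesis using e 1 by cases simp_all
  next
    case 2
    then have e: "3 * q + 3 * r = 2 * (q * r)" using eq by (simp add: algebra_simps)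
    then have "2 * (q * r) \<le> 6 * r" using assms by linarith
    then have "q \<le> 3" using pos by simp
    then have "q = 3" using assms 2 by linarith
    then show ?thesis using e 2 by simp
  qed
qed

lemma unit_fractions_affine:
  fixes a b c :: nat
  assumes pos: "1 \<le> a" "1 \<le> b" "1 \<le> c"
    and eq: "(a + 1) * (b + 1) + (b + 1) * (c + 1) + (a + 1) * (c + 1) = (a + 1) * (b + 1) * (c + 1)"
  shows "affine_type a b c"
proof -
  have sorted: "{#x, y, z#} \<in> {{#2, 2, 2#}, {#1, 3, 3#}, {#1, 2, 5#}}"
    if "1 \<le> x" "x \<le> y" "y \<le> z"
      "(x + 1) * (y + 1) + (y + 1) * (z + 1) + (x + 1) * (z + 1) = (x + 1) * (y + 1) * (z + 1)"
    for x y z :: nat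
  proof -
    have "(x + 1, y + 1, z + 1) \<in> {(3, 3, 3), (2, 4, 4), (2, 3, 6 :: nat)}"
      using that by (intro unit_fractions_sorted) simp_all
    then show ?thesis by auto
  qed
  consider "a \<le> b" "b \<le> c" | "a \<le> c" "c \<le> b" | "b \<le> a" "a \<le> c" | "b \<le> c" "c \<le> a"
    | "c \<le> a" "a \<le> b" | "c \<le> b" "b \<le> a"
    by linarith
  then have "\<exists>x y z. {#a, b, c#} = {#x, y, z#} \<and> 1 \<le> x \<and> x \<le> y \<and> y \<le> z \<and>
      (x + 1) * (y + 1) + (y + 1) * (z + 1) + (x + 1) * (z + 1) = (x + 1) * (y + 1) * (z + 1)"
  proof cases
    case 1
    then show ?thesis using pos eq by (intro exI[of _ a] exI[of _ b] exI[of _ c]) auto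
  next
    case 2
    then show ?thesis using pos eq
      by (intro exI[of _ a] exI[of _ c] exI[of _ b]) (auto simp: algebra_simps)
  next
    case 3
    then show ?thesis using pos eq
      by (intro exI[of _ b] exI[of _ a] exI[of _ c]) (auto simp: algebra_simps)
  next
    case 4
    then show ?thesis using pos eq
      by (intro exI[of _ b] exI[of _ c] exI[of _ a]) (auto simp: algebra_simps)
  next
    case 5
    then show ?thesis using pos eq
      by (intro exI[of _ c] exI[of _ a] exI[of _ b]) (auto simp: algebra_simps)
  next
    case 6
    then show ?thesis using pos eq
      by (intro exI[of _ c] exI[of _ b] exI[of _ a]) (auto simp: algebra_simps)
  qed
  then obtain x y z where "{#a, b, c#} = {#x, y, z#}" "1 \<le> x" "x \<le> y" "y \<le> z"
    "(x + 1) * (y + 1) + (y + 1) * (z + 1) + (x + 1) * (z + 1) = (x + 1) * (y + 1) * (z + 1)"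
    by blast
  then show ?thesis using sorted[of x y z] by (simp only: affine_type_def)
qed

section \<open>Integral roots of the diagram\<close>

lemma adj_simps [simp]:
  "\<not> adj Branch Branch"
  "adj Branch (Leg l d) \<longleftrightarrow> d = 0"
  "adj (Leg l d) Branch \<longleftrightarrow> d = 0"
  "adj (Leg l d) (Leg l' e) \<longleftrightarrow> l = l' \<and> (e = Suc d \<or> d = Suc e)"
  by (auto simp: adj_def doubleton_eq_iff)

lemma adj_commute: "adj u v \<longleftrightarrow> adj v u"
  by (auto simp: adj_def insert_commute)

lemma cartan_self [simp]: "cartan i i = 2"
  by (simp add: cartan_def)

lemma cartan_adj: "adj i j \<Longrightarrow> cartan i j = - 1"
  by (cases i; cases j) (auto simp: cartan_def)

lemma cartan_cases:
  obtains "i = j" "cartan i j = 2" | "adj i j" "i \<noteq> j" "cartan i j = - 1"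
    | "\<not> adj i j" "i \<noteq> j" "cartan i j = 0"
  by (auto simp: cartan_def split: if_splits)

lemma cartan_zero_iff: "cartan i j = 0 \<longleftrightarrow> i \<noteq> j \<and> \<not> adj i j"
  by (auto simp: cartan_def)

lemma fun_sum_apply: "(\<Sum>i\<in>S. f i) x = (\<Sum>i\<in>S. f i x :: 'x::comm_monoid_add)"
  by (induction S rule: infinite_finite_induct) auto

locale y_diagram =
  fixes a b c :: nat
  assumes legs_pos: "a \<ge> 1" "b \<ge> 1" "c \<ge> 1"
begin

abbreviation nodes :: "vertex set" where
  "nodes \<equiv> verts a b c"

abbreviation len :: "leg \<Rightarrow> nat" where
  "len \<equiv> leg_length a b c"

lemma Branch_in_nodes [simp]: "Branch \<in> nodes"
  by (simp add: verts_def)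

lemma Leg_in_nodes [simp]: "Leg l d \<in> nodes \<longleftrightarrow> d < len l"
  by (simp add: verts_def)

lemma len_pos [simp]: "0 < len l"
  using legs_pos by (cases l) auto

lemma leg_lengths_pos [simp]: "0 < a" "0 < b" "0 < c" "0 < leg_length a b c l" "leg_length a b c l \<noteq> 0"
  using legs_pos len_pos[of l] by auto

definition pairing :: "vertex \<Rightarrow> (vertex \<Rightarrow> int) \<Rightarrow> int" where
  "pairing k v = (\<Sum>j\<in>nodes. cartan k j * v j)"

definition form :: "(vertex \<Rightarrow> int) \<Rightarrow> (vertex \<Rightarrow> int) \<Rightarrow> int" where
  "form u v = (\<Sum>i\<in>nodes. u i * pairing i v)"

definition refl_int :: "vertex \<Rightarrow> (vertex \<Rightarrow> int) \<Rightarrow> vertex \<Rightarrow> int" where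
  "refl_int k v = v(k := v k - pairing k v)"

definition word_int :: "vertex list \<Rightarrow> (vertex \<Rightarrow> int) \<Rightarrow> vertex \<Rightarrow> int" where
  "word_int u v = foldr refl_int u v"

definition unit_int :: "vertex \<Rightarrow> vertex \<Rightarrow> int" where
  "unit_int k = (\<lambda>x. if x = k then 1 else 0)"

definition height :: "(vertex \<Rightarrow> int) \<Rightarrow> int" where
  "height v = (\<Sum>i\<in>nodes. v i)"

text \<open>Positive roots, generated from the simple ones by reflections that increase the height.
  That these and their negatives are all the roots is lemma \<open>word_int_root\<close>.\<close>

inductive_set pos_root :: "(vertex \<Rightarrow> int) set" where
  simple: "k \<in> nodes \<Longrightarrow> unit_int k \<in> pos_root"
| raise: "v \<in> pos_root \<Longrightarrow> k \<in> nodes \<Longrightarrow> pairing k v < 0 \<Longrightarrow> refl_int k v \<in> pos_root"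

lemma pairing_add: "pairing k (u + v) = pairing k u + pairing k v"
  by (simp add: pairing_def algebra_simps sum.distrib)

lemma pairing_uminus: "pairing k (- v) = - pairing k v"
  by (simp add: pairing_def sum_negf)

lemma pairing_unit: "j \<in> nodes \<Longrightarrow> pairing k (unit_int j) = cartan k j"
proof -
  assume j: "j \<in> nodes"
  have "pairing k (unit_int j) = (\<Sum>i\<in>nodes. if i = j then cartan k i else 0)"
    unfolding pairing_def unit_int_def by (intro sum.cong) auto
  then show ?thesis using j by simp
qed

lemma sum_fun_upd:
  assumes "j \<in> nodes"
  shows "(\<Sum>i\<in>nodes. f i * (v(j := v j - t)) i) = (\<Sum>i\<in>nodes. f i * v i) - f j * (t::int)"
proof -
  have "(\<Sum>i\<in>nodes. f i * (v(j := v j - t)) i)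
      = (\<Sum>i\<in>nodes. f i * v i - (if i = j then f j * t else 0))"
    by (intro sum.cong) (auto simp: algebra_simps)
  then show ?thesis using assms by (simp add: sum_subtractf)
qed

lemma pairing_refl: "j \<in> nodes \<Longrightarrow> pairing k (refl_int j v) = pairing k v - cartan k j * pairing j v"
  unfolding refl_int_def pairing_def[of k] by (rule sum_fun_upd)

lemma height_refl: "j \<in> nodes \<Longrightarrow> height (refl_int j v) = height v - pairing j v"
  using sum_fun_upd[of j "\<lambda>_. 1" v "pairing j v"] by (simp add: height_def refl_int_def)

lemma height_unit: "j \<in> nodes \<Longrightarrow> height (unit_int j) = 1"
  by (simp add: height_def unit_int_def)

lemma refl_int_refl [simp]: "k \<in> nodes \<Longrightarrow> refl_int k (refl_int k v) = v"
  using pairing_refl[of k k v] by (simp add: refl_int_def)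

lemma refl_int_fixed: "pairing k v = 0 \<Longrightarrow> refl_int k v = v"
  by (simp add: refl_int_def)

lemma refl_int_uminus: "refl_int k (- v) = - refl_int k v"
  by (simp add: refl_int_def pairing_uminus fun_eq_iff)

lemma refl_int_unit: "j \<in> nodes \<Longrightarrow> refl_int k (unit_int j) = (unit_int j)(k := unit_int j k - cartan k j)"
  by (simp add: refl_int_def pairing_unit)

lemma refl_int_commute:
  "\<lbrakk>j \<in> nodes; k \<in> nodes; cartan j k = 0\<rbrakk> \<Longrightarrow> refl_int j (refl_int k v) = refl_int k (refl_int j v)"
  using cartan_sym[of j k] pairing_refl[of k j v] pairing_refl[of j k v]
  by (auto simp: refl_int_def cartan_zero_iff fun_upd_twist)

lemma refl_int_braid:
  assumes "j \<in> nodes" "k \<in> nodes" "cartan j k = - 1"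
  shows "refl_int j (refl_int k (refl_int j v)) = refl_int k (refl_int j (refl_int k v))"
proof -
  have sym: "cartan k j = - 1" and ne: "j \<noteq> k"
    using assms cartan_sym[of j k] by auto
  have val: "refl_int i u x = (if x = i then u i - pairing i u else u x)" for i u x
    by (simp add: refl_int_def)
  show ?thesis
    using assms sym ne by (auto simp: val pairing_refl fun_eq_iff algebra_simps)
qed

lemma form_add_right: "form u (v + w) = form u v + form u w"
  by (simp add: form_def pairing_add algebra_simps sum.distrib)

lemma form_add_left: "form (u + v) w = form u w + form v w"
  by (simp add: form_def algebra_simps sum.distrib)

lemma form_uminus: "form (- u) v = - form u v" "form u (- v) = - form u v"
  by (simp_all add: form_def pairing_uminus sum_negf)

lemma form_sym: "form u v = form v u"
proof -
  have "form u v = (\<Sum>i\<in>nodes. \<Sum>j\<in>nodes. u i * cartan i j * v j)"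
    by (simp add: form_def pairing_def sum_distrib_left mult.assoc)
  also have "\<dots> = (\<Sum>j\<in>nodes. \<Sum>i\<in>nodes. v j * cartan j i * u i)"
    by (subst sum.swap) (intro sum.cong HOL.refl, subst cartan_sym, simp add: mult.commute mult.left_commute)
  also have "\<dots> = form v u"
    by (simp add: form_def pairing_def sum_distrib_left mult.assoc)
  finally show ?thesis .
qed

lemma form_unit: "k \<in> nodes \<Longrightarrow> form (unit_int k) v = pairing k v"
proof -
  assume k: "k \<in> nodes"
  have "form (unit_int k) v = (\<Sum>i\<in>nodes. if i = k then pairing i v else 0)"
    unfolding form_def unit_int_def by (intro sum.cong) auto
  then show ?thesis using k by simp
qed

lemma form_refl:
  assumes "k \<in> nodes"
  shows "form (refl_int k u) (refl_int k v) = form u v"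
proof -
  have left: "form (refl_int k u) w = form u w - pairing k u * pairing k w" for u w
    using sum_fun_upd[OF assms, of "\<lambda>i. pairing i w" u "pairing k u"]
    by (simp add: form_def refl_int_def mult.commute)
  show ?thesis
    using left[of u "refl_int k v"] left[of v u] form_sym[of u "refl_int k v"] form_sym[of u v]
      pairing_refl[OF assms, of k v]
    by (simp add: algebra_simps)
qed

lemma pos_root_form: "v \<in> pos_root \<Longrightarrow> form v v = 2"
  by (induction rule: pos_root.induct) (simp_all add: form_unit pairing_unit form_refl)

lemma pos_root_nonneg: "v \<in> pos_root \<Longrightarrow> 0 \<le> v i"
proof (induction arbitrary: i rule: pos_root.induct)
  case (raise v k)
  have "0 \<le> v i" "0 \<le> v k" by (rule raise.IH)+
  then show ?case using raise.hyps by (auto simp: refl_int_def)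
qed (simp add: unit_int_def)

lemma pos_root_height: "v \<in> pos_root \<Longrightarrow> 0 < height v"
  by (induction rule: pos_root.induct) (auto simp: height_unit height_refl)

text \<open>
  Write \<open>v\<close> as the raise of a shorter positive root along \<open>j\<close> and compare \<open>j\<close> with \<open>k\<close>: if
  the two reflections commute, they can be interchanged; if they satisfy the braid relation, the
  route from \<open>v\<close> to its reflection can be replaced by one whose descending steps all start at
  shorter roots.
\<close>

lemma pos_root_descend:
  assumes "v \<in> pos_root" "k \<in> nodes" "0 < pairing k v" "v \<noteq> unit_int k"
  shows "refl_int k v \<in> pos_root"
  using assms
proof (induction "nat (height v)" arbitrary: v k rule: less_induct)
  case less
  from less.prems(1) show ?case
  proof (cases rule: pos_root.cases)
    case (simple j)
    then have "cartan k j > 0" using less.prems(3) by (simp add: pairing_unit)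
    then have "j = k" by (auto simp: cartan_def split: if_splits)
    then show ?thesis using simple less.prems by simp
  next
    case (raise g j)
    have hg: "nat (height g) < nat (height v)"
      using raise pos_root_height[OF raise(2)] by (simp add: height_refl)
    show ?thesis
    proof (cases k j rule: cartan_cases)
      case 1
      then show ?thesis using raise by simp
    next
      case 3
      have sym: "cartan j k = 0" using 3 cartan_sym[of j k] by simp
      have pg: "pairing k g > 0" using less.prems(3) raise 3 by (simp add: pairing_refl)
      have "g \<noteq> unit_int k" using raise sym less.prems(2) by (auto simp: pairing_unit)
      then have "refl_int k g \<in> pos_root" using less.hyps[OF hg raise(2) less.prems(2) pg] by simp
      then have "refl_int j (refl_int k g) \<in> pos_root"
        using raise sym less.prems(2) by (intro pos_root.raise[of "refl_int k g" j]) (auto simp: pairing_refl)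
      then show ?thesis using refl_int_commute[OF raise(3) less.prems(2) sym] raise by simp
    next
      case 2
      have sym: "cartan j k = - 1" using 2 cartan_sym[of j k] by simp
      define p where "p = pairing j g"
      define q where "q = pairing k g"
      have p: "p < 0" using raise by (simp add: p_def)
      have pq: "p + q > 0" using less.prems(3) raise 2 by (simp add: pairing_refl p_def q_def)
      show ?thesis
      proof (cases "g = unit_int k")
        case True
        have "v x = (refl_int k (unit_int j)) x" for x
          unfolding raise(1) True refl_int_unit[OF less.prems(2)] refl_int_unit[OF raise(3)]
          using 2 sym by (simp add: unit_int_def)
        then have "v = refl_int k (unit_int j)" by blast
        then show ?thesis using raise(3) less.prems(2) pos_root.simple by simp
      next
        case False
        have g1: "refl_int k g \<in> pos_root"
          using less.hyps[OF hg raise(2) less.prems(2) _ False] pq p by (simp add: q_def)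
        have p1: "pairing j (refl_int k g) = p + q"
          using less.prems(2) sym by (simp add: pairing_refl p_def q_def)
        have h1: "nat (height (refl_int k g)) < nat (height v)"
          using hg pq p pos_root_height[OF raise(2)] less.prems(2) by (simp add: height_refl q_def)
        have ne: "refl_int k g \<noteq> unit_int j"
        proof
          assume "refl_int k g = unit_int j"
          then have "g = refl_int k (unit_int j)" using less.prems(2) refl_int_refl by metis
          then have "pairing j g = 1" using raise(3) less.prems(2) 2 sym
            by (simp add: pairing_refl pairing_unit)
          then show False using p by (simp add: p_def)
        qed
        define d where "d = refl_int j (refl_int k g)"
        have d: "d \<in> pos_root"
          unfolding d_def using less.hyps[OF h1 g1 raise(3) _ ne] p1 pq by simp
        have "pairing k d = p"
          using raise(3) less.prems(2) 2 sym p1 unfolding d_def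
          by (simp add: pairing_refl) (simp add: p_def q_def)
        then have "refl_int k d \<in> pos_root" using d less.prems(2) p by (intro pos_root.raise) auto
        moreover have kd: "refl_int k d = refl_int j (refl_int k v)"
          using refl_int_braid[OF raise(3) less.prems(2) sym, of g] raise(1) by (simp add: d_def)
        moreover have "pairing j (refl_int j (refl_int k v)) < 0"
          using raise less.prems(2) 2 sym p pq
          by (simp add: pairing_refl) (simp add: p_def q_def)
        ultimately have "refl_int j (refl_int j (refl_int k v)) \<in> pos_root"
          using raise(3) by (intro pos_root.raise[of "refl_int j (refl_int k v)" j]) auto
        then show ?thesis using raise(3) by simp
      qed
    qed
  qed
qed

lemma refl_int_pos_root:
  assumes "v \<in> pos_root" "k \<in> nodes" "v \<noteq> unit_int k"
  shows "refl_int k v \<in> pos_root"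
  using assms pos_root_descend[of v k] pos_root.raise[of v k] refl_int_fixed[of k v]
  by (cases "pairing k v = 0") (auto simp: not_less_iff_gr_or_eq linorder_neq_iff)

lemma refl_int_own_root: "k \<in> nodes \<Longrightarrow> refl_int k (unit_int k) = - unit_int k"
  unfolding refl_int_unit by (auto simp: unit_int_def fun_eq_iff)

lemma word_int_simps [simp]:
  "word_int [] v = v" "word_int (k # u) v = refl_int k (word_int u v)"
  "word_int (u @ u') v = word_int u (word_int u' v)"
  by (simp_all add: word_int_def)

lemma word_int_uminus: "word_int u (- v) = - word_int u v"
  by (induction u) (simp_all only: word_int_simps refl_int_uminus)

lemma word_int_root:
  assumes "u \<in> lists nodes" "i \<in> nodes"
  shows "word_int u (unit_int i) \<in> pos_root \<or> - word_int u (unit_int i) \<in> pos_root"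
  using assms(1)
proof (induction u)
  case Nil
  then show ?case using assms(2) pos_root.simple by simp
next
  case (Cons k u)
  then have k: "k \<in> nodes"
    and IH: "word_int u (unit_int i) \<in> pos_root \<or> - word_int u (unit_int i) \<in> pos_root" by blast+
  have step: "refl_int k v \<in> pos_root \<or> - refl_int k v \<in> pos_root" if "v \<in> pos_root" for v
    using refl_int_pos_root[OF that k] refl_int_own_root[OF k] pos_root.simple[OF k]
    by (cases "v = unit_int k") auto
  from IH show ?case
    using step[of "word_int u (unit_int i)"] step[of "- word_int u (unit_int i)"]
    unfolding word_int_simps refl_int_uminus minus_minus by blast
qed

lemma form_pos_pairing:
  assumes "\<And>i. 0 \<le> u i" "0 < form u v"
  shows "\<exists>k\<in>nodes. 0 < pairing k v"
proof (rule ccontr)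
  assume "\<not> ?thesis"
  then have "form u v \<le> 0"
    unfolding form_def using assms(1) by (intro sum_nonpos) (auto simp: not_less mult_nonneg_nonpos)
  then show False using assms(2) by simp
qed

lemma refl_int_move:
  assumes "i \<in> nodes" "j \<in> nodes" "adj i j"
  shows "refl_int i (refl_int j (unit_int i)) = unit_int j"
proof
  have c: "cartan i j = - 1" "cartan j i = - 1" "i \<noteq> j"
    using assms cartan_adj[of i j] cartan_adj[of j i] by (auto simp: adj_commute)
  fix x
  have "pairing i (refl_int j (unit_int i)) = 1"
    using assms c by (simp add: pairing_refl pairing_unit)
  then have "refl_int i (refl_int j (unit_int i)) x
      = refl_int j (unit_int i) x - (if x = i then 1 else 0)"
    by (subst refl_int_def) simp
  then show "refl_int i (refl_int j (unit_int i)) x = unit_int j x"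
    unfolding refl_int_unit[OF assms(1)] using c by (simp add: unit_int_def)
qed

text \<open>
  Choose \<open>j\<close> pairing positively with \<open>v\<close>. If \<open>j\<close> is not adjacent to \<open>i\<close>, its reflection fixes the
  simple root at \<open>i\<close> and lowers \<open>v\<close>; otherwise the word \<open>s\<^sub>i s\<^sub>j\<close> maps the simple root at \<open>i\<close> to
  the one at \<open>j\<close>, which has the same height, and lowers \<open>v\<close>.
\<close>

lemma shorten_orthogonal_simple:
  assumes i: "i \<in> nodes" and v: "v \<in> pos_root" and orth: "pairing i v = 0"
    and ns: "\<And>j. j \<in> nodes \<Longrightarrow> v \<noteq> unit_int j"
  shows "\<exists>u\<in>lists nodes. word_int u (unit_int i) \<in> pos_root \<and> word_int u v \<in> pos_root \<and>
    height (word_int u (unit_int i)) + height (word_int u v) < height (unit_int i) + height v"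
proof -
  obtain j where j: "j \<in> nodes" "0 < pairing j v"
    using form_pos_pairing[of v v] pos_root_nonneg[OF v] pos_root_form[OF v] by auto
  have sv: "refl_int j v \<in> pos_root" using refl_int_pos_root v j ns by blast
  have ij: "i \<noteq> j" using orth j by auto
  show ?thesis
  proof (cases i j rule: cartan_cases)
    case 1
    then show ?thesis using ij by simp
  next
    case 3
    then have "refl_int j (unit_int i) = unit_int i"
      using i cartan_sym[of i j] by (intro refl_int_fixed) (simp add: pairing_unit)
    then show ?thesis
      using sv i j pos_root.simple[OF i] by (intro bexI[of _ "[j]"]) (auto simp: height_refl)
  next
    case 2
    have sym: "cartan j i = - 1" using 2 cartan_sym[of i j] by simp
    have "refl_int i (refl_int j (unit_int i)) = unit_int j"
      by (rule refl_int_move[OF i j(1) 2(1)])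
    moreover have "refl_int i (refl_int j v) \<in> pos_root"
    proof (rule refl_int_pos_root[OF sv i])
      show "refl_int j v \<noteq> unit_int i"
      proof
        assume "refl_int j v = unit_int i"
        then have "v = refl_int j (unit_int i)" using j refl_int_refl by metis
        then have "pairing i v = 1" using i j 2 sym by (simp add: pairing_refl pairing_unit)
        then show False using orth by simp
      qed
    qed
    moreover have "height (refl_int i (refl_int j v)) < height v"
      using i j orth 2 by (simp add: height_refl pairing_refl)
    ultimately show ?thesis
      using i j pos_root.simple[OF j(1)] by (intro bexI[of _ "[i, j]"]) (auto simp: height_unit)
  qed
qed

text \<open>If neither root is simple, some simple root pairs positively with their sum, as that sum has
  norm 4, and its reflection lowers the total height.\<close>

lemma shorten_orthogonal:
  assumes v: "v \<in> pos_root" and w: "w \<in> pos_root" and orth: "form v w = 0"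
    and ns: "\<not> ((\<exists>i\<in>nodes. v = unit_int i) \<and> (\<exists>j\<in>nodes. w = unit_int j))"
  shows "\<exists>u\<in>lists nodes. word_int u v \<in> pos_root \<and> word_int u w \<in> pos_root \<and>
    height (word_int u v) + height (word_int u w) < height v + height w"
proof -
  consider (l) i where "i \<in> nodes" "v = unit_int i" | (r) j where "j \<in> nodes" "w = unit_int j"
    | (n) "\<And>i. i \<in> nodes \<Longrightarrow> v \<noteq> unit_int i" "\<And>i. i \<in> nodes \<Longrightarrow> w \<noteq> unit_int i"
    by blast
  then show ?thesis
  proof cases
    case l
    have "pairing i w = 0" using orth l by (simp add: form_unit)
    then show ?thesis using shorten_orthogonal_simple[of i w] l w ns by blast
  next
    case r
    have "pairing j v = 0" using orth r form_sym[of v w] by (simp add: form_unit)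
    then show ?thesis using shorten_orthogonal_simple[of j v] r v ns by (auto simp: add.commute)
  next
    case n
    have "form (v + w) (v + w) = 4"
      using pos_root_form[OF v] pos_root_form[OF w] orth form_sym[of v w]
      by (simp add: form_add_left form_add_right)
    then obtain k where k: "k \<in> nodes" "0 < pairing k (v + w)"
      using form_pos_pairing[of "v + w" "v + w"] pos_root_nonneg[OF v] pos_root_nonneg[OF w]
      by auto
    then show ?thesis
      using refl_int_pos_root[OF v k(1)] refl_int_pos_root[OF w k(1)] n
      by (intro bexI[of _ "[k]"]) (auto simp: height_refl pairing_add)
  qed
qed

lemma form_word: "u \<in> lists nodes \<Longrightarrow> form (word_int u v) (word_int u w) = form v w"
  by (induction u) (auto simp: form_refl)

lemma orthogonal_pos_roots_to_simple:
  assumes "v \<in> pos_root" "w \<in> pos_root" "form v w = 0"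
  shows "\<exists>u\<in>lists nodes. \<exists>i\<in>nodes. \<exists>j\<in>nodes.
    cartan i j = 0 \<and> word_int u v = unit_int i \<and> word_int u w = unit_int j"
  using assms
proof (induction "nat (height v + height w)" arbitrary: v w rule: less_induct)
  case less
  show ?case
  proof (cases "(\<exists>i\<in>nodes. v = unit_int i) \<and> (\<exists>j\<in>nodes. w = unit_int j)")
    case True
    then obtain i j where ij: "i \<in> nodes" "j \<in> nodes" "v = unit_int i" "w = unit_int j" by blast
    then have "cartan i j = 0" using less.prems(3) by (simp add: form_unit pairing_unit)
    then show ?thesis using ij by (intro bexI[of _ "[]"]) auto
  next
    case False
    obtain u where u: "u \<in> lists nodes" "word_int u v \<in> pos_root" "word_int u w \<in> pos_root"
      "height (word_int u v) + height (word_int u w) < height v + height w"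
      using shorten_orthogonal[OF less.prems False] by blast
    have "nat (height (word_int u v) + height (word_int u w)) < nat (height v + height w)"
      using u(4) pos_root_height[OF u(2)] pos_root_height[OF u(3)] by linarith
    then obtain u' i j where *: "u' \<in> lists nodes" "i \<in> nodes" "j \<in> nodes" "cartan i j = 0"
      "word_int u' (word_int u v) = unit_int i" "word_int u' (word_int u w) = unit_int j"
      using less.hyps u(2,3) form_word[OF u(1)] less.prems(3) by metis
    then have "u' @ u \<in> lists nodes" using u by auto
    then show ?thesis using * by (metis word_int_simps(3))
  qed
qed

text \<open>Signs are absorbed by the reflections in the two members, which fix each other.\<close>

lemma orthogonal_roots_to_simple:
  assumes v: "v \<in> pos_root \<or> - v \<in> pos_root" and w: "w \<in> pos_root \<or> - w \<in> pos_root"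
    and orth: "form v w = 0"
  shows "\<exists>u\<in>lists nodes. \<exists>i\<in>nodes. \<exists>j\<in>nodes.
    cartan i j = 0 \<and> word_int u v = unit_int i \<and> word_int u w = unit_int j"
proof -
  obtain v' where v': "v' \<in> pos_root" "v = v' \<or> v = - v'" using v by (metis minus_minus)
  obtain w' where w': "w' \<in> pos_root" "w = w' \<or> w = - w'" using w by (metis minus_minus)
  have "form v' w' = 0" using orth v' w' by (auto simp: form_uminus)
  then obtain u i j where u: "u \<in> lists nodes" "i \<in> nodes" "j \<in> nodes" "cartan i j = 0"
    "word_int u v' = unit_int i" "word_int u w' = unit_int j"
    using orthogonal_pos_roots_to_simple v' w' by blast
  have fixed: "refl_int i (unit_int j) = unit_int j" "refl_int j (unit_int i) = unit_int i"
    using u cartan_sym[of i j] by (auto intro!: refl_int_fixed simp: pairing_unit)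
  have neg: "refl_int i (- unit_int i) = unit_int i" "refl_int j (- unit_int j) = unit_int j"
    using u by (simp_all add: refl_int_uminus refl_int_own_root)
  define x where "x = (if v = v' then [] else [i]) @ (if w = w' then [] else [j])"
  have "word_int (x @ u) v = unit_int i" "word_int (x @ u) w = unit_int j"
    using v'(2) w'(2) u fixed neg by (auto simp: x_def word_int_uminus refl_int_uminus)
  moreover have "x @ u \<in> lists nodes" using u by (auto simp: x_def)
  ultimately show ?thesis using u by blast
qed

section \<open>The reflection representation over a field\<close>

abbreviation B :: "(vertex \<Rightarrow> 'F::field) \<Rightarrow> (vertex \<Rightarrow> 'F) \<Rightarrow> 'F" where
  "B \<equiv> bform a b c"

abbreviation act :: "vertex list \<Rightarrow> (vertex \<Rightarrow> 'F::field) \<Rightarrow> vertex \<Rightarrow> 'F" where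
  "act \<equiv> word_act a b c"

lemma simple_root_in_refl_space [simp]:
  "i \<in> nodes \<Longrightarrow> (simple_root i :: vertex \<Rightarrow> 'F::field) \<in> refl_space a b c"
  by (auto simp: refl_space_def simple_root_def)

lemma subspace_refl_space: "fs.subspace (refl_space a b c :: (vertex \<Rightarrow> 'F::field) set)"
  by (auto simp: fs.subspace_def refl_space_def)

lemma B_expand: "B u v = (\<Sum>i\<in>nodes. u i * B (simple_root i) v)"
  unfolding bform_def[of a b c u]
  by (intro sum.cong) (simp_all add: bform_simple_left sum_distrib_left mult.assoc mult.left_commute)

lemma B_sym: "B u v = B v u"
  unfolding bform_def
  by (subst sum.swap, intro sum.cong HOL.refl, subst cartan_sym) (simp add: mult.commute mult.left_commute)

lemma B_left:
  "B (u + u') v = B u v + B u' v" "B (u - u') v = B u v - B u' v" "B (fscale k u) v = k * B u v"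
  by (simp_all add: B_sym[of _ v] bform_add_right bform_diff_right bform_scale_right)

lemma B_right:
  "B v (u + u') = B v u + B v u'" "B v (u - u') = B v u - B v u'" "B v (fscale k u) = k * B v u"
  by (simp_all add: bform_add_right bform_diff_right bform_scale_right)

lemma B_zero [simp]: "B 0 v = 0" "B v 0 = 0"
  by (simp_all add: bform_def)

lemma B_sum_right: "B u (\<Sum>i\<in>S. f i) = (\<Sum>i\<in>S. B u (f i))"
  by (induction S rule: infinite_finite_induct)
    (simp_all only: sum.infinite sum.empty sum.insert B_zero B_right not_False_eq_True)

lemma refl_space_expand:
  assumes "v \<in> refl_space a b c"
  shows "v = (\<Sum>i\<in>nodes. fscale (v i) (simple_root i))"
proof
  fix j
  have "(\<Sum>i\<in>nodes. fscale (v i) (simple_root i)) j = (\<Sum>i\<in>nodes. if i = j then v i else 0)"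
    unfolding fun_sum_apply by (intro sum.cong) (auto simp: simple_root_def)
  then show "v j = (\<Sum>i\<in>nodes. fscale (v i) (simple_root i)) j"
    using assms by (auto simp: refl_space_def)
qed

lemma refl_space_span: "(refl_space a b c :: (vertex \<Rightarrow> 'F::field) set) = fs.span (simple_root ` nodes)"
proof
  show "refl_space a b c \<subseteq> fs.span (simple_root ` nodes :: (vertex \<Rightarrow> 'F) set)"
  proof
    fix v :: "vertex \<Rightarrow> 'F" assume v: "v \<in> refl_space a b c"
    have "(\<Sum>i\<in>nodes. fscale (v i) (simple_root i)) \<in> fs.span (simple_root ` nodes)"
      by (intro fs.span_sum fs.span_scale fs.span_base) simp
    then show "v \<in> fs.span (simple_root ` nodes)" using refl_space_expand[OF v] by simp
  qed
  show "fs.span (simple_root ` nodes) \<subseteq> (refl_space a b c :: (vertex \<Rightarrow> 'F) set)"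
    by (rule fs.span_minimal[OF _ subspace_refl_space]) auto
qed

lemma reflection_form:
  assumes "k \<in> nodes"
  shows "B (reflection a b c k u) (reflection a b c k v) = B u v"
proof -
  have "B (simple_root k) (simple_root k) = (2 :: 'a)" using assms by (simp add: bform_simple)
  then show ?thesis
    using B_sym[of u "simple_root k"]
    by (simp add: reflection_def B_left B_right algebra_simps)
qed

lemma reflection_reflection:
  assumes "k \<in> nodes"
  shows "reflection a b c k (reflection a b c k v) = v"
proof -
  have "B (simple_root k) (simple_root k) = (2 :: 'a)" using assms by (simp add: bform_simple)
  then show ?thesis by (simp add: reflection_def B_right fun_eq_iff)
qed

lemma act_simps [simp]:
  "act [] v = v" "act (k # u) v = reflection a b c k (act u v)"
  "act (u @ u') v = act u (act u' v)"
  by (simp_all add: word_act_def)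

lemma act_form: "u \<in> lists nodes \<Longrightarrow> B (act u v) (act u w) = B v w"
  by (induction u) (auto simp: reflection_form)

lemma act_in_refl_space:
  assumes "u \<in> lists nodes" "v \<in> refl_space a b c"
  shows "act u v \<in> refl_space a b c"
  using assms by (induction u) (auto simp: reflection_def refl_space_def simple_root_def)

lemma act_rev:
  assumes "u \<in> lists nodes"
  shows "act (rev u) (act u v) = v" "act u (act (rev u) v) = v"
proof -
  have "act (rev u) (act u v) = v" if "u \<in> lists nodes" for u :: "vertex list" and v :: "vertex \<Rightarrow> 'a"
    using that by (induction u) (auto simp: reflection_reflection)
  from this[OF assms, of v] this[of "rev u" v] assms
  show "act (rev u) (act u v) = v" "act u (act (rev u) v) = v" by (simp_all add: in_lists_conv_set)
qed

lemma act_diff: "act u (v - w) = act u v - act u (w :: vertex \<Rightarrow> 'F::field)"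
  using word_act_linear(1)[of a b c u "v - w" w] by (simp add: eq_diff_eq)

text \<open>The field carries no order, so whatever depends on positivity of roots is proved over the
  integers and transported along this embedding.\<close>

definition emb :: "(vertex \<Rightarrow> int) \<Rightarrow> vertex \<Rightarrow> 'F::field_char_0" where
  "emb v = (\<lambda>x. of_int (v x))"

lemma emb_unit: "emb (unit_int i) = simple_root i"
  by (simp add: emb_def unit_int_def simple_root_def fun_eq_iff)

lemma emb_eq_iff [simp]: "emb v = emb w \<longleftrightarrow> v = w"
  by (auto simp: emb_def fun_eq_iff)

lemma B_simple_emb: "k \<in> nodes \<Longrightarrow> B (simple_root k) (emb v) = of_int (pairing k v)"
  by (simp add: bform_simple_left pairing_def emb_def)

lemma B_emb: "B (emb u) (emb v) = of_int (form u v)"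
  by (subst B_expand) (simp add: form_def emb_def B_simple_emb[unfolded emb_def])

lemma reflection_emb: "k \<in> nodes \<Longrightarrow> reflection a b c k (emb v) = emb (refl_int k v)"
  unfolding reflection_def B_simple_emb
  by (auto simp: refl_int_def fun_eq_iff simple_root_def emb_def)

lemma act_emb: "u \<in> lists nodes \<Longrightarrow> act u (emb v) = emb (word_int u v)"
  by (induction u) (auto simp: reflection_emb)

lemma real_rootI: "u \<in> lists nodes \<Longrightarrow> i \<in> nodes \<Longrightarrow> act u (simple_root i) \<in> real_roots a b c"
  unfolding real_roots_def
  by (intro CollectI exI[of _ "word_rel a b c `` {u}"] exI[of _ i] conjI weyl_carrierI
      weyl_act_class[symmetric])

lemma real_rootE:
  assumes "\<beta> \<in> real_roots a b c"
  obtains u i where "u \<in> lists nodes" "i \<in> nodes" "\<beta> = act u (simple_root i)"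
proof -
  obtain w i where w: "w \<in> carrier (weyl_group a b c)" "i \<in> nodes" "\<beta> = weyl_act a b c w (simple_root i)"
    using assms unfolding real_roots_def by blast
  obtain u where "u \<in> lists nodes" "w = word_rel a b c `` {u}" using w(1) by (rule weyl_carrierE)
  then show thesis using that w by (simp only: weyl_act_class)
qed

lemma simple_root_real: "i \<in> nodes \<Longrightarrow> simple_root i \<in> real_roots a b c"
  using real_rootI[of "[]" i] by simp

lemma real_root_act:
  assumes "u \<in> lists nodes" "\<beta> \<in> real_roots a b c"
  shows "act u \<beta> \<in> real_roots a b c"
  using assms(2)
proof (rule real_rootE)
  fix w i assume "w \<in> lists nodes" "i \<in> nodes" "\<beta> = act w (simple_root i)"
  then show ?thesis using real_rootI[of "u @ w" i] assms(1) by auto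
qed

lemma real_root_norm: "\<beta> \<in> real_roots a b c \<Longrightarrow> B \<beta> \<beta> = 2"
  by (erule real_rootE) (simp add: act_form bform_simple)

lemma real_root_in_refl_space: "\<beta> \<in> real_roots a b c \<Longrightarrow> \<beta> \<in> refl_space a b c"
  by (erule real_rootE) (simp add: act_in_refl_space)

text \<open>The reflection in \<open>w \<alpha>\<^sub>i\<close> is \<open>w s\<^sub>i w\<inverse>\<close>.\<close>

lemma real_root_reflection:
  assumes "\<beta> \<in> real_roots a b c"
  shows "\<exists>g\<in>lists nodes. \<forall>v. act g v = v - fscale (B \<beta> v) \<beta>"
proof -
  obtain u i where u: "u \<in> lists nodes" "i \<in> nodes" "\<beta> = act u (simple_root i)"
    using assms by (rule real_rootE)
  have "act (u @ [i] @ rev u) v = v - fscale (B \<beta> v) \<beta>" for v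
  proof -
    have "B (simple_root i) (act (rev u) v) = B \<beta> v"
      using act_form[OF u(1), of "simple_root i" "act (rev u) v"] u by (simp add: act_rev)
    then show ?thesis
      using u by (simp add: reflection_def act_diff act_rev word_act_linear(2))
  qed
  moreover have "u @ [i] @ rev u \<in> lists nodes" using u by auto
  ultimately show ?thesis by blast
qed

lemma orthogonal_real_roots_simple:
  fixes \<gamma> \<delta> :: "vertex \<Rightarrow> 'F::field_char_0"
  assumes "\<gamma> \<in> real_roots a b c" "\<delta> \<in> real_roots a b c" "B \<gamma> \<delta> = 0"
  shows "\<exists>u\<in>lists nodes. \<exists>i\<in>nodes. \<exists>j\<in>nodes.
    cartan i j = 0 \<and> \<gamma> = act u (simple_root i) \<and> \<delta> = act u (simple_root j)"
proof -
  have root: "\<exists>v. (v \<in> pos_root \<or> - v \<in> pos_root) \<and> \<beta> = emb v" if "\<beta> \<in> real_roots a b c"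
    for \<beta> :: "vertex \<Rightarrow> 'F"
    using that
  proof (rule real_rootE)
    fix u i assume "u \<in> lists nodes" "i \<in> nodes" "\<beta> = act u (simple_root i)"
    then show ?thesis using word_int_root[of u i] act_emb[of u "unit_int i"] emb_unit[of i] by metis
  qed
  obtain v where v: "v \<in> pos_root \<or> - v \<in> pos_root" "\<gamma> = emb v" using root assms(1) by blast
  obtain w where w: "w \<in> pos_root \<or> - w \<in> pos_root" "\<delta> = emb w" using root assms(2) by blast
  have "form v w = 0" using assms(3) v w by (simp add: B_emb)
  then obtain u i j where u: "u \<in> lists nodes" "i \<in> nodes" "j \<in> nodes" "cartan i j = 0"
    "word_int u v = unit_int i" "word_int u w = unit_int j"
    using orthogonal_roots_to_simple v(1) w(1) by blast
  have "act u \<gamma> = simple_root i" "act u \<delta> = simple_root j"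
    using u v w by (simp_all add: act_emb emb_unit)
  then have "\<gamma> = act (rev u) (simple_root i)" "\<delta> = act (rev u) (simple_root j)"
    using act_rev(1)[OF u(1)] by metis+
  moreover have "rev u \<in> lists nodes" using u by auto
  ultimately show ?thesis using u by blast
qed

section \<open>Symmetric tensors\<close>

abbreviation tact :: "vertex list \<Rightarrow> (vertex \<times> vertex \<Rightarrow> 'F::field) \<Rightarrow> vertex \<times> vertex \<Rightarrow> 'F" where
  "tact u \<equiv> diag_act a b c (word_rel a b c `` {u})"

abbreviation S2 :: "(vertex \<times> vertex \<Rightarrow> 'F::field) set" where
  "S2 \<equiv> sym_square a b c"

text \<open>\<open>ev T\<close> is \<open>T\<close> as a bilinear form on \<open>V\<close>, where \<open>V \<otimes> V\<close> is paired with itself by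
  \<open>B \<otimes> B\<close>; \<open>contract T\<close> is \<open>T\<close> as an endomorphism of \<open>V\<close>, and \<open>trace\<close> is the trace of that
  endomorphism.\<close>

definition ev :: "(vertex \<times> vertex \<Rightarrow> 'F::field) \<Rightarrow> (vertex \<Rightarrow> 'F) \<Rightarrow> (vertex \<Rightarrow> 'F) \<Rightarrow> 'F" where
  "ev T u v = (\<Sum>i\<in>nodes. \<Sum>j\<in>nodes. T (i, j) * B (simple_root i) u * B (simple_root j) v)"

definition contract :: "(vertex \<times> vertex \<Rightarrow> 'F::field) \<Rightarrow> (vertex \<Rightarrow> 'F) \<Rightarrow> vertex \<Rightarrow> 'F" where
  "contract T u = (\<lambda>i. \<Sum>j\<in>nodes. T (i, j) * B (simple_root j) u)"

definition trace :: "(vertex \<times> vertex \<Rightarrow> 'F::field) \<Rightarrow> 'F" where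
  "trace T = (\<Sum>i\<in>nodes. \<Sum>j\<in>nodes. of_int (cartan i j) * T (i, j))"

lemma tensor_apply: "tensor u v (i, j) = u i * v j"
  by (simp add: tensor_def)

lemma sym_prod_apply: "sym_prod u v (i, j) = u i * v j + v i * u j"
  by (simp add: sym_prod_def tensor_def)

lemma sym_prod_commute: "sym_prod u v = sym_prod v u"
  by (simp add: sym_prod_def add.commute)

lemma sym_prod_right:
  "sym_prod u (v + w) = sym_prod u v + sym_prod u w"
  "sym_prod u (v - w) = sym_prod u v - sym_prod u w"
  "sym_prod u (fscale k v) = fscale k (sym_prod u v)"
  "sym_prod u 0 = 0"
  by (auto simp: fun_eq_iff sym_prod_apply algebra_simps)

lemma ev_linear:
  "ev (S + T) u v = ev S u v + ev T u v" "ev (S - T) u v = ev S u v - ev T u v"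
  "ev (fscale k T) u v = k * ev T u v" "ev 0 u v = 0"
  by (simp_all add: ev_def algebra_simps sum.distrib sum_subtractf sum_distrib_left)

lemma ev_right: "ev T u (v + w) = ev T u v + ev T u w" "ev T u (fscale k v) = k * ev T u v" "ev T u 0 = 0"
  by (simp_all add: ev_def B_right algebra_simps sum.distrib sum_distrib_left)

lemma ev_sum: "ev (\<Sum>k\<in>S. f k) u v = (\<Sum>k\<in>S. ev (f k) u v)"
  by (induction S rule: infinite_finite_induct)
    (simp_all only: sum.infinite sum.empty sum.insert ev_linear not_False_eq_True)

lemma ev_tensor: "ev (tensor p q) u v = B p u * B q v"
  unfolding B_expand[of p u] B_expand[of q v] ev_def sum_product
  by (intro sum.cong) (simp_all add: tensor_apply mult.commute mult.left_commute)

lemma ev_sym_prod: "ev (sym_prod p q) u v = B p u * B q v + B q u * B p v"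
  by (simp add: sym_prod_def ev_linear ev_tensor)

lemma B_contract: "B (contract T u) v = ev T v u"
  unfolding ev_def
  by (subst B_expand, intro sum.cong HOL.refl)
    (simp add: contract_def sum_distrib_left mult.commute mult.left_commute)

lemma contract_linear:
  "contract (S + T) u = contract S u + contract T u"
  "contract (fscale k T) u = fscale k (contract T u)" "contract 0 u = 0"
  by (simp_all add: contract_def fun_eq_iff algebra_simps sum.distrib sum_distrib_left)

lemma contract_sym_prod: "contract (sym_prod p q) u = fscale (B q u) p + fscale (B p u) q"
  unfolding B_expand[of p u] B_expand[of q u] contract_def
  by (simp add: fun_eq_iff sym_prod_apply algebra_simps sum.distrib sum_distrib_left)

lemma trace_linear:
  "trace (S + T) = trace S + trace T" "trace (S - T) = trace S - trace T"
  "trace (fscale k T) = k * trace T" "trace 0 = 0"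
  by (simp_all add: trace_def algebra_simps sum.distrib sum_subtractf sum_distrib_left)

lemma trace_sum: "trace (\<Sum>k\<in>S. f k) = (\<Sum>k\<in>S. trace (f k))"
  by (induction S rule: infinite_finite_induct)
    (simp_all only: sum.infinite sum.empty sum.insert trace_linear not_False_eq_True)

lemma trace_tensor: "trace (tensor p q) = B p q"
  by (simp add: trace_def bform_def tensor_apply mult.assoc)

lemma trace_sym_prod: "trace (sym_prod p q) = 2 * B p q"
  using B_sym[of q p] by (simp add: sym_prod_def trace_linear trace_tensor)

lemma S2_induct [consumes 1, case_names zero step]:
  assumes "T \<in> (S2 :: (vertex \<times> vertex \<Rightarrow> 'F::field) set)" "h 0"
    and "\<And>k u v T. u \<in> refl_space a b c \<Longrightarrow> v \<in> refl_space a b c \<Longrightarrow> h T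
      \<Longrightarrow> h (fscale k (sym_prod u v) + T)"
  shows "h T"
  using assms(1) unfolding sym_square_def
  by (rule fs.span_induct_alt) (use assms(2,3) in blast)+

lemma subspace_S2: "fs.subspace (S2 :: (vertex \<times> vertex \<Rightarrow> 'F::field) set)"
  unfolding sym_square_def by (rule fs.subspace_span)

lemma sym_prod_in_S2:
  "u \<in> refl_space a b c \<Longrightarrow> v \<in> refl_space a b c \<Longrightarrow> sym_prod u v \<in> S2"
  unfolding sym_square_def by (rule fs.span_base) blast

lemma S2_props:
  assumes "T \<in> S2"
  shows "T (i, j) = T (j, i)" "i \<notin> nodes \<or> j \<notin> nodes \<Longrightarrow> T (i, j) = 0"
proof -
  have "(\<forall>i j. T (i, j) = T (j, i)) \<and> (\<forall>i j. i \<notin> nodes \<or> j \<notin> nodes \<longrightarrow> T (i, j) = 0)"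
    using assms by (induction rule: S2_induct) (auto simp: sym_prod_apply refl_space_def)
  then show "T (i, j) = T (j, i)" "i \<notin> nodes \<or> j \<notin> nodes \<Longrightarrow> T (i, j) = 0" by blast+
qed

lemma S2I:
  fixes T :: "vertex \<times> vertex \<Rightarrow> 'F::field_char_0"
  assumes "\<And>i j. T (i, j) = T (j, i)" "\<And>i j. i \<notin> nodes \<or> j \<notin> nodes \<Longrightarrow> T (i, j) = 0"
  shows "T \<in> S2"
proof -
  define e :: "vertex \<Rightarrow> vertex \<Rightarrow> 'F" where "e = simple_root"
  have "T = (\<Sum>i\<in>nodes. \<Sum>j\<in>nodes. fscale (T (i, j) / 2) (sym_prod (e i) (e j)))"
  proof
    fix p :: "vertex \<times> vertex"
    obtain x y where p: "p = (x, y)" by (cases p)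
    have "(\<Sum>i\<in>nodes. \<Sum>j\<in>nodes. fscale (T (i, j) / 2) (sym_prod (e i) (e j))) p
       = (\<Sum>i\<in>nodes. \<Sum>j\<in>nodes. (if i = x then if j = y then T (i, j) / 2 else 0 else 0)
          + (if i = y then if j = x then T (i, j) / 2 else 0 else 0))"
      unfolding fun_sum_apply p
      by (intro sum.cong) (auto simp: sym_prod_apply e_def simple_root_def algebra_simps)
    also have "\<dots> = (\<Sum>i\<in>nodes. (if i = x then (if y \<in> nodes then T (i, y) / 2 else 0) else 0)
          + (if i = y then (if x \<in> nodes then T (i, x) / 2 else 0) else 0))"
      by (intro sum.cong HOL.refl) (auto simp: sum.distrib)
    also have "\<dots> = T (x, y)"
      using assms(1)[of y x] assms(2)[of x y] by (auto simp: sum.distrib)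
    finally show "T p = (\<Sum>i\<in>nodes. \<Sum>j\<in>nodes. fscale (T (i, j) / 2) (sym_prod (e i) (e j))) p"
      by (simp add: p)
  qed
  also have "\<dots> \<in> S2"
    by (intro fs.subspace_sum[OF subspace_S2] fs.subspace_scale[OF subspace_S2] sym_prod_in_S2)
      (auto simp: e_def)
  finally show ?thesis .
qed

lemma tact_linear:
  "diag_act a b c w (S + T) = diag_act a b c w S + diag_act a b c w T"
  "diag_act a b c w (fscale k T) = fscale k (diag_act a b c w T)"
  "diag_act a b c w 0 = 0"
  by (auto simp: diag_act_def fun_eq_iff fun_sum_apply algebra_simps sum.distrib sum_distrib_left)

lemma tact_sym_prod:
  assumes "u \<in> lists nodes" "p \<in> refl_space a b c" "q \<in> refl_space a b c"
  shows "tact u (sym_prod p q) = sym_prod (act u p) (act u q)"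
  using assms weyl_carrierI[OF assms(1)]
  by (simp add: sym_prod_def tact_linear diag_act_tensor weyl_act_class)

lemma tact_in_S2: "T \<in> S2 \<Longrightarrow> u \<in> lists nodes \<Longrightarrow> tact u T \<in> S2"
proof (induction rule: S2_induct)
  case zero
  show ?case unfolding tact_linear by (rule fs.subspace_0[OF subspace_S2])
next
  case (step k p q T)
  have "sym_prod (act u p) (act u q) \<in> S2"
    using step by (intro sym_prod_in_S2 act_in_refl_space)
  then show ?case
    unfolding tact_linear tact_sym_prod[OF step.prems step.hyps]
    using step.IH[OF step.prems] subspace_S2 by (intro fs.subspace_add fs.subspace_scale)
qed

lemma tact_append:
  "T \<in> S2 \<Longrightarrow> u \<in> lists nodes \<Longrightarrow> v \<in> lists nodes \<Longrightarrow> tact u (tact v T) = tact (u @ v) T"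
proof (induction rule: S2_induct)
  case (step k p q T)
  moreover have "u @ v \<in> lists nodes" using step by auto
  ultimately show ?case by (simp only: tact_linear tact_sym_prod act_in_refl_space act_simps)
qed (simp only: tact_linear)

lemma tact_Nil: "T \<in> S2 \<Longrightarrow> tact [] T = T"
  by (induction rule: S2_induct) (simp_all only: tact_linear tact_sym_prod lists.Nil act_simps)

lemma tact_rev:
  assumes "T \<in> S2" "u \<in> lists nodes"
  shows "tact (rev u) (tact u T) = T"
proof -
  have ru: "rev u \<in> lists nodes" using assms by auto
  show ?thesis
    using assms(1)
  proof (induction rule: S2_induct)
    case (step k p q T)
    then show ?case using assms(2) ru
      by (simp only: tact_linear tact_sym_prod act_in_refl_space act_rev)
  qed (simp only: tact_linear)
qed

lemma ev_tact:
  "T \<in> S2 \<Longrightarrow> w \<in> lists nodes \<Longrightarrow> ev (tact w T) (act w u) (act w v) = ev T u v"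
  by (induction rule: S2_induct) (simp_all only: tact_linear tact_sym_prod ev_linear ev_sym_prod act_form)

lemma ev_commute: "T \<in> S2 \<Longrightarrow> ev T u v = ev T v u"
  by (induction rule: S2_induct) (simp_all only: ev_linear ev_sym_prod add.commute mult.commute)

text \<open>
  \<open>1 - s\<^sub>k\<close> maps every symmetric tensor to a product \<open>\<alpha>\<^sub>k \<or> v\<close> with \<open>v\<close> orthogonal to \<open>\<alpha>\<^sub>k\<close>:
  up to a multiple of \<open>\<alpha>\<^sub>k\<close>, the vector \<open>v\<close> is the image of \<open>\<alpha>\<^sub>k\<close> under the endomorphism
  given by the tensor.
\<close>

lemma reflection_difference:
  fixes T :: "vertex \<times> vertex \<Rightarrow> 'F::field_char_0"
  assumes T: "T \<in> S2" and k: "k \<in> nodes"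
  obtains v where "v \<in> refl_space a b c" "B (simple_root k) v = 0"
    "T - tact [k] T = sym_prod (simple_root k) v"
    "\<And>u. B (simple_root k) u = 0 \<Longrightarrow> B v u = ev T (simple_root k) u"
proof
  define e :: "vertex \<Rightarrow> 'F" where "e = simple_root k"
  define v where "v = contract T e - fscale (ev T e e / 2) e"
  have kk: "B e e = 2" and ks: "[k] \<in> lists nodes"
    using k by (simp_all add: e_def bform_simple)
  show "v \<in> refl_space a b c"
    using S2_props(2)[OF T] k by (auto simp: v_def e_def refl_space_def contract_def simple_root_def)
  show "B (simple_root k) v = 0"
    using kk B_sym[of e "contract T e"] by (simp add: v_def B_right B_contract flip: e_def)
  show "B v u = ev T (simple_root k) u" if "B (simple_root k) u = 0" for u
    using that ev_commute[OF T, of u e] by (simp add: v_def B_left B_contract flip: e_def)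
  have "T - tact [k] T = sym_prod e (contract T e - fscale (ev T e e / 2) e)"
    using T
  proof (induction rule: S2_induct)
    case (step l p q T)
    have *: "sym_prod p q - tact [k] (sym_prod p q)
        = sym_prod e (contract (sym_prod p q) e - fscale (ev (sym_prod p q) e e / 2) e)"
      using step(1,2) ks B_sym[of p e] B_sym[of q e]
      by (auto simp: tact_sym_prod reflection_def contract_sym_prod ev_sym_prod fun_eq_iff
          sym_prod_apply field_simps simp flip: e_def)
    have sum: "fscale l (sym_prod p q) + T - tact [k] (fscale l (sym_prod p q) + T)
        = fscale l (sym_prod p q - tact [k] (sym_prod p q)) + (T - tact [k] T)"
      unfolding tact_linear by (auto simp: fun_eq_iff algebra_simps)
    show ?case
      unfolding sum * step.IH contract_linear ev_linear
      by (auto simp: fun_eq_iff sym_prod_apply field_simps)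
  next
    case zero
    show ?case unfolding tact_linear contract_linear ev_linear by (auto simp: fun_eq_iff sym_prod_apply)
  qed
  then show "T - tact [k] T = sym_prod (simple_root k) v" by (simp add: v_def e_def)
qed

section \<open>Conjugacy of orthogonal pairs of simple roots\<close>

lemma word_int_rev: "u \<in> lists nodes \<Longrightarrow> word_int (rev u) (word_int u v) = v"
  by (induction u) auto

definition linked :: "vertex \<Rightarrow> vertex \<Rightarrow> vertex \<Rightarrow> vertex \<Rightarrow> bool" where
  "linked i j k l \<longleftrightarrow> (\<exists>u\<in>lists nodes.
     (word_int u (unit_int i) = unit_int k \<and> word_int u (unit_int j) = unit_int l) \<or>
     (word_int u (unit_int i) = unit_int l \<and> word_int u (unit_int j) = unit_int k))"

lemma linked_refl: "linked i j i j"
  unfolding linked_def by (intro bexI[of _ "[]"]) auto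

lemma linked_swap:
  "linked i j k l \<Longrightarrow> linked j i k l" "linked i j k l \<Longrightarrow> linked i j l k"
  unfolding linked_def by blast+

lemma linked_sym:
  assumes "linked i j k l"
  shows "linked k l i j"
proof -
  obtain u where u: "u \<in> lists nodes"
    "(word_int u (unit_int i) = unit_int k \<and> word_int u (unit_int j) = unit_int l) \<or>
     (word_int u (unit_int i) = unit_int l \<and> word_int u (unit_int j) = unit_int k)"
    using assms unfolding linked_def by blast
  have "rev u \<in> lists nodes" using u by auto
  then show ?thesis
    unfolding linked_def using u(2) word_int_rev[OF u(1)] by (intro bexI[of _ "rev u"]) metis+
qed

lemma linked_trans:
  assumes "linked i j k l" "linked k l m n"
  shows "linked i j m n"
proof -
  obtain u where u: "u \<in> lists nodes"
    "(word_int u (unit_int i) = unit_int k \<and> word_int u (unit_int j) = unit_int l) \<or>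
     (word_int u (unit_int i) = unit_int l \<and> word_int u (unit_int j) = unit_int k)"
    using assms(1) unfolding linked_def by blast
  obtain v where v: "v \<in> lists nodes"
    "(word_int v (unit_int k) = unit_int m \<and> word_int v (unit_int l) = unit_int n) \<or>
     (word_int v (unit_int k) = unit_int n \<and> word_int v (unit_int l) = unit_int m)"
    using assms(2) unfolding linked_def by blast
  have "v @ u \<in> lists nodes" using u v by auto
  then show ?thesis
    unfolding linked_def using u(2) v(2) by (intro bexI[of _ "v @ u"]) (simp only: word_int_simps, metis)
qed

text \<open>An orthogonal pair of simple roots is a pair of tokens on non-adjacent nodes, and a token
  may move along an edge as long as the tokens do not become adjacent.\<close>

lemma linked_move:
  assumes "i \<in> nodes" "j \<in> nodes" "k \<in> nodes" "cartan i j = 0" "cartan i k = 0" "adj j k"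
  shows "linked i j i k"
proof -
  have "cartan j i = 0" "cartan k i = 0" using assms cartan_sym by metis+
  then have "refl_int j (refl_int k (unit_int i)) = unit_int i"
    using assms(1) by (simp add: refl_int_fixed pairing_unit)
  then show ?thesis
    unfolding linked_def using assms refl_int_move[of j k] by (intro bexI[of _ "[j, k]"]) auto
qed

lemma cartan_eval:
  "cartan Branch (Leg l d) = (if d = 0 then - 1 else 0)"
  "cartan (Leg l d) Branch = (if d = 0 then - 1 else 0)"
  "cartan (Leg l d) (Leg l' e) =
    (if l = l' then (if d = e then 2 else if e = Suc d \<or> d = Suc e then - 1 else 0) else 0)"
  by (auto simp: cartan_def)

lemma linked_branch: "Suc d < len l \<Longrightarrow> linked Branch (Leg l (Suc d)) Branch (Leg l 1)"
proof (induction d)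
  case (Suc d)
  have "linked Branch (Leg l (Suc (Suc d))) Branch (Leg l (Suc d))"
    using Suc.prems by (intro linked_move) (simp_all add: cartan_eval)
  moreover have "linked Branch (Leg l (Suc d)) Branch (Leg l 1)" using Suc by simp
  ultimately show ?case by (rule linked_trans)
qed (simp add: linked_refl)

lemma linked_same_leg:
  "Suc d < e \<Longrightarrow> e < len l \<Longrightarrow> linked (Leg l d) (Leg l e) Branch (Leg l 1)"
proof (induction d)
  case 0
  then obtain e' where e': "e = Suc e'" by (cases e) auto
  have "linked (Leg l e) (Leg l 0) (Leg l e) Branch"
    using 0 by (intro linked_move) (simp_all add: cartan_eval)
  then have "linked (Leg l 0) (Leg l e) Branch (Leg l e)"
    by (rule linked_swap(1)[OF linked_swap(2)])
  then have "linked (Leg l 0) (Leg l e) Branch (Leg l (Suc e'))" by (simp only: e')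
  then show ?case by (rule linked_trans) (rule linked_branch, use 0 e' in simp)
next
  case (Suc d)
  have "linked (Leg l e) (Leg l (Suc d)) (Leg l e) (Leg l d)"
    using Suc.prems by (intro linked_move) (simp_all add: cartan_eval)
  then have "linked (Leg l (Suc d)) (Leg l e) (Leg l d) (Leg l e)"
    by (rule linked_swap(1)[OF linked_swap(2)])
  moreover have "linked (Leg l d) (Leg l e) Branch (Leg l 1)" using Suc by simp
  ultimately show ?case by (rule linked_trans)
qed

lemma linked_distinct_legs:
  "l \<noteq> l' \<Longrightarrow> 1 < len l \<Longrightarrow> d < len l \<Longrightarrow> e < len l' \<Longrightarrow> linked (Leg l d) (Leg l' e) Branch (Leg l 1)"
proof (induction e)
  case 0
  have far: "linked (Leg l (Suc d')) (Leg l' 0) Branch (Leg l 1)" if d': "Suc d' < len l" for d'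
  proof -
    have "linked (Leg l (Suc d')) (Leg l' 0) (Leg l (Suc d')) Branch"
      using 0 d' by (intro linked_move) (simp_all add: cartan_eval)
    then have "linked (Leg l (Suc d')) (Leg l' 0) Branch (Leg l (Suc d'))"
      by (rule linked_swap(2))
    then show ?thesis by (rule linked_trans[OF _ linked_branch[OF d']])
  qed
  show ?case
  proof (cases d)
    case 0
    have "linked (Leg l' 0) (Leg l 0) (Leg l' 0) (Leg l (Suc 0))"
      using \<open>1 < len l\<close> \<open>l \<noteq> l'\<close> by (intro linked_move) (simp_all add: cartan_eval)
    then have "linked (Leg l d) (Leg l' 0) (Leg l 1) (Leg l' 0)"
      unfolding 0 One_nat_def by (rule linked_swap(1)[OF linked_swap(2)])
    moreover have "linked (Leg l 1) (Leg l' 0) Branch (Leg l 1)"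
      using far[of 0] \<open>1 < len l\<close> by simp
    ultimately show ?thesis by (rule linked_trans)
  next
    case (Suc d')
    then show ?thesis using far[of d'] \<open>d < len l\<close> by simp
  qed
next
  case (Suc e)
  have "linked (Leg l d) (Leg l' (Suc e)) (Leg l d) (Leg l' e)"
    using Suc.prems by (intro linked_move) (simp_all add: cartan_eval)
  moreover have "linked (Leg l d) (Leg l' e) Branch (Leg l 1)" using Suc by simp
  ultimately show ?case by (rule linked_trans)
qed

text \<open>The only pairs of tokens that cannot move are two leaves on legs of length one. They exist
  only in type \<open>D\<close>.\<close>

definition twin :: "vertex \<Rightarrow> vertex \<Rightarrow> bool" where
  "twin i j \<longleftrightarrow> (\<exists>l l'. l \<noteq> l' \<and> len l = 1 \<and> len l' = 1 \<and> i = Leg l 0 \<and> j = Leg l' 0)"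

lemma not_twin_linked_branch:
  assumes "i \<in> nodes" "j \<in> nodes" "cartan i j = 0" "\<not> twin i j"
  shows "\<exists>l. 1 < len l \<and> linked i j Branch (Leg l 1)"
proof -
  have branch: "1 < len l \<and> linked Branch (Leg l d) Branch (Leg l 1)"
    if "Leg l d \<in> nodes" "cartan Branch (Leg l d) = 0" for l d
    using that linked_branch[of "d - 1" l] by (cases d) (auto simp: cartan_eval)
  have legs: "1 < len l \<and> linked (Leg l d) (Leg l e) Branch (Leg l 1)"
    if "Leg l d \<in> nodes" "Leg l e \<in> nodes" "cartan (Leg l d) (Leg l e) = 0" "d < e" for l d e
    using that linked_same_leg[of d e l] by (auto simp: cartan_eval split: if_splits)
  show ?thesis
  proof (cases i)
    case Branch
    then show ?thesis using assms branch by (cases j) auto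
  next
    case i: (Leg l d)
    show ?thesis
    proof (cases j)
      case Branch
      then have "1 < len l \<and> linked j i Branch (Leg l 1)"
        using assms i branch[of l d] cartan_sym[of i j] by simp
      then show ?thesis using linked_swap(1)[of j i] by blast
    next
      case j: (Leg l' e)
      show ?thesis
      proof (cases "l = l'")
        case True
        then have "d < e \<or> e < d" using assms i j by (auto simp: cartan_eval split: if_splits)
        then have "1 < len l \<and> (linked i j Branch (Leg l 1) \<or> linked j i Branch (Leg l 1))"
          using assms legs[of l d e] legs[of l e d] i j True cartan_sym[of i j] by auto
        then show ?thesis using linked_swap(1)[of j i] by blast
      next
        case False
        have "1 < len l \<or> 1 < len l'"
        proof (rule ccontr)
          assume "\<not> ?thesis"
          then have "len l = 1" "len l' = 1" using len_pos[of l] len_pos[of l'] by linarith+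
          then show False using assms i j False by (auto simp: twin_def)
        qed
        then have "(1 < len l \<and> linked i j Branch (Leg l 1)) \<or> (1 < len l' \<and> linked j i Branch (Leg l' 1))"
          using assms i j False linked_distinct_legs[of l l' d e] linked_distinct_legs[of l' l e d]
          by auto
        then show ?thesis using linked_swap(1)[of j i] by blast
      qed
    qed
  qed
qed

lemma not_twin_linked:
  assumes "i \<in> nodes" "j \<in> nodes" "cartan i j = 0" "\<not> twin i j"
    and "k \<in> nodes" "m \<in> nodes" "cartan k m = 0" "\<not> twin k m"
  shows "linked i j k m"
proof -
  obtain l where l: "1 < len l" "linked i j Branch (Leg l 1)"
    using not_twin_linked_branch assms(1-4) by blast
  obtain l' where l': "1 < len l'" "linked k m Branch (Leg l' 1)"
    using not_twin_linked_branch assms(5-8) by blast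
  have "linked Branch (Leg l 1) Branch (Leg l' 1)"
  proof (cases "l = l'")
    case False
    have one: "linked (Leg l 0) (Leg l' 0) Branch (Leg l 1)"
      using False l l' by (intro linked_distinct_legs) auto
    have "linked (Leg l' 0) (Leg l 0) Branch (Leg l' 1)"
      using False l l' by (intro linked_distinct_legs) auto
    then have "linked (Leg l 0) (Leg l' 0) Branch (Leg l' 1)" by (rule linked_swap(1))
    then show ?thesis by (rule linked_trans[OF linked_sym[OF one]])
  qed (simp add: linked_refl)
  then show ?thesis by (rule linked_trans[OF linked_trans[OF l(2)] linked_sym[OF l'(2)]])
qed

section \<open>Twin leaves\<close>

text \<open>
  When the legs \<open>l1\<close> and \<open>l2\<close> have length one, the diagram has type \<open>D\<^sub>n\<close>, and
  \<open>twin_weight l1 l2 l3 m\<close> lists the pairings with the simple roots of the \<open>m\<close>-th member of the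
  orthonormal basis in which the roots are sums and differences of two distinct members. The two
  leaves are \<open>e\<^sub>1 \<plusminus> e\<^sub>0\<close>, so their product is \<open>e\<^sub>1\<^sup>2 - e\<^sub>0\<^sup>2\<close> up to a factor, while all other
  orthogonal pairs of simple roots involve four different members.
\<close>

fun twin_weight :: "leg \<Rightarrow> leg \<Rightarrow> leg \<Rightarrow> nat \<Rightarrow> vertex \<Rightarrow> int" where
  "twin_weight l1 l2 l3 0 k = (if k = Leg l1 0 then 1 else if k = Leg l2 0 then - 1 else 0)"
| "twin_weight l1 l2 l3 (Suc 0) k =
    (if k = Leg l1 0 \<or> k = Leg l2 0 then 1 else if k = Branch then - 1 else 0)"
| "twin_weight l1 l2 l3 (Suc (Suc 0)) k =
    (if k = Branch then 1 else if k = Leg l3 0 then - 1 else 0)"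
| "twin_weight l1 l2 l3 (Suc (Suc (Suc d))) k =
    (if k = Leg l3 d then 1 else if k = Leg l3 (Suc d) then - 1 else 0)"

lemma twin_weight_reflect:
  assumes l: "l1 \<noteq> l2" "l1 \<noteq> l3" "l2 \<noteq> l3" and len: "len l1 = 1" "len l2 = 1" and j: "j \<in> nodes"
  shows "\<exists>m s. \<forall>k\<in>nodes.
    twin_weight l1 l2 l3 n k - cartan k j * twin_weight l1 l2 l3 n j = s * twin_weight l1 l2 l3 m k"
proof -
  define w where "w = twin_weight l1 l2 l3"
  have all: "x = l1 \<or> x = l2 \<or> x = l3" for x
    using l by (cases x; cases l1; cases l2; cases l3) simp_all
  have *: ?thesis if "\<And>k. k \<in> nodes \<Longrightarrow> w n k - cartan k j * w n j = s * w m k" for m s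
    using that unfolding w_def by blast
  have leaf: "d = 0" if "Leg l1 d \<in> nodes \<or> Leg l2 d \<in> nodes" for d
    using that len by auto
  have cases: Q if k: "k \<in> nodes" and "k = Branch \<Longrightarrow> Q" "k = Leg l1 0 \<Longrightarrow> Q" "k = Leg l2 0 \<Longrightarrow> Q"
    "\<And>d. k = Leg l3 d \<Longrightarrow> Q" for k Q
  proof (cases k)
    case (Leg l d)
    then show Q using that all[of l] leaf[of d] by blast
  qed (rule that(2))
  note ev = w_def cartan_eval l l[symmetric]
  show ?thesis
  proof (cases "w n j = 0")
    case True
    then show ?thesis by (intro *[of 1 n]) simp
  next
    case nz: False
    consider "n = 0" | "n = Suc 0" | "n = Suc (Suc 0)" | d where "n = Suc (Suc (Suc d))"
      using twin_weight.cases by (metis not0_implies_Suc)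
    then show ?thesis
    proof cases
      case 1
      then consider "j = Leg l1 0" | "j = Leg l2 0" using nz by (auto simp: w_def split: if_splits)
      then show ?thesis
      proof cases
        case 1
        show ?thesis
          by (intro *[of "- 1" "Suc 0"], erule cases) (use 1 \<open>n = 0\<close> in \<open>auto simp: ev\<close>)
      next
        case 2
        show ?thesis
          by (intro *[of 1 "Suc 0"], erule cases) (use 2 \<open>n = 0\<close> in \<open>auto simp: ev\<close>)
      qed
    next
      case n: 2
      then consider "j = Leg l1 0" | "j = Leg l2 0" | "j = Branch"
        using nz by (auto simp: w_def split: if_splits)
      then show ?thesis
      proof cases
        case 1
        show ?thesis
          by (intro *[of "- 1" 0], erule cases) (use 1 n in \<open>auto simp: ev\<close>)
      next
        case 2
        show ?thesis
          by (intro *[of 1 0], erule cases) (use 2 n in \<open>auto simp: ev\<close>)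
      next
        case 3
        show ?thesis
          by (intro *[of 1 "Suc (Suc 0)"], erule cases) (use 3 n in \<open>auto simp: ev\<close>)
      qed
    next
      case n: 3
      then consider "j = Branch" | "j = Leg l3 0" using nz by (auto simp: w_def split: if_splits)
      then show ?thesis
      proof cases
        case 1
        show ?thesis
          by (intro *[of 1 "Suc 0"], erule cases) (use 1 n in \<open>auto simp: ev\<close>)
      next
        case 2
        show ?thesis
          by (intro *[of 1 "Suc (Suc (Suc 0))"], erule cases) (use 2 n in \<open>auto simp: ev\<close>)
      qed
    next
      case n: 4
      then consider "j = Leg l3 d" | "j = Leg l3 (Suc d)" using nz by (auto simp: w_def split: if_splits)
      then show ?thesis
      proof cases
        case 1
        show ?thesis
        proof (cases d)
          case 0
          show ?thesis
            by (intro *[of 1 "Suc (Suc 0)"], erule cases) (use 0 1 n in \<open>auto simp: ev\<close>)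
        next
          case (Suc d')
          show ?thesis
            by (intro *[of 1 "Suc (Suc d)"], erule cases) (use Suc 1 n in \<open>auto simp: ev\<close>)
        qed
      next
        case 2
        show ?thesis
          by (intro *[of 1 "Suc n"], erule cases) (use 2 n in \<open>auto simp: ev\<close>)
      qed
    qed
  qed
qed

lemma twin_weight_support:
  assumes "cartan k l = 0" "{k, l} \<noteq> {Leg l1 0, Leg l2 0}"
  shows "twin_weight l1 l2 l3 n k * twin_weight l1 l2 l3 n l = 0"
proof (rule ccontr)
  assume "\<not> ?thesis"
  then have nz: "twin_weight l1 l2 l3 n k \<noteq> 0" "twin_weight l1 l2 l3 n l \<noteq> 0" by auto
  consider "n = 0" | "n = Suc 0" | "n = Suc (Suc 0)" | d where "n = Suc (Suc (Suc d))"
    using twin_weight.cases by (metis not0_implies_Suc)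
  then show False
  proof cases
    case 1
    then have "k \<in> {Leg l1 0, Leg l2 0}" "l \<in> {Leg l1 0, Leg l2 0}" using nz by (auto split: if_splits)
    then show False using assms by (elim insertE emptyE) auto
  next
    case 2
    then have "k \<in> {Leg l1 0, Leg l2 0, Branch}" "l \<in> {Leg l1 0, Leg l2 0, Branch}"
      using nz by (auto split: if_splits)
    then show False using assms by (elim insertE emptyE) (auto simp: cartan_eval)
  next
    case 3
    then have "k \<in> {Branch, Leg l3 0}" "l \<in> {Branch, Leg l3 0}" using nz by (auto split: if_splits)
    then show False using assms by (elim insertE emptyE) (auto simp: cartan_eval)
  next
    case (4 d)
    then have "k \<in> {Leg l3 d, Leg l3 (Suc d)}" "l \<in> {Leg l3 d, Leg l3 (Suc d)}"
      using nz by (auto split: if_splits)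
    then show False using assms by (elim insertE emptyE) (auto simp: cartan_eval)
  qed
qed

lemma twin_orthogonal:
  assumes tw: "twin i j" and kl: "k \<in> nodes" "l \<in> nodes" "cartan k l = 0" "{k, l} \<noteq> {i, j}"
    and u: "u \<in> lists nodes"
  shows "ev (tact u (sym_prod (simple_root i) (simple_root j))) (simple_root k) (simple_root l)
    = (0 :: 'F::field_char_0)"
proof -
  obtain l1 l2 where tw': "l1 \<noteq> l2" "len l1 = 1" "len l2 = 1" "i = Leg l1 0" "j = Leg l2 0"
    using tw unfolding twin_def by blast
  obtain l3 where l3: "l1 \<noteq> l3" "l2 \<noteq> l3"
    using that[of LegA] that[of LegB] that[of LegC] by (cases l1; cases l2) auto
  have ij: "i \<in> nodes" "j \<in> nodes" using tw' by auto
  define w where "w = twin_weight l1 l2 l3"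
  \<comment> \<open>The pairings of \<open>v\<close> are those of a multiple of a basis member; this is stable under reflections.\<close>
  define good where "good v \<longleftrightarrow> (\<exists>t m. \<forall>x\<in>nodes. B (simple_root x) v = t * of_int (w m x))"
    for v :: "vertex \<Rightarrow> 'F"
  have good_refl: "good (reflection a b c y v)" if y: "y \<in> nodes" and v: "good v" for y v
  proof -
    obtain t n where t: "\<And>x. x \<in> nodes \<Longrightarrow> B (simple_root x) v = t * of_int (w n x)"
      using v unfolding good_def by blast
    obtain m s where m: "\<And>x. x \<in> nodes \<Longrightarrow> w n x - cartan x y * w n y = s * w m x"
      using twin_weight_reflect[OF tw'(1) l3 tw'(2,3) y, of n] unfolding w_def by blast
    have "B (simple_root x) (reflection a b c y v) = (t * of_int s) * of_int (w m x)"
      if x: "x \<in> nodes" for x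
    proof -
      have "B (simple_root x) (reflection a b c y v) = t * of_int (w n x - cartan x y * w n y)"
        using x y by (simp add: reflection_def B_right t bform_simple algebra_simps)
      also have "\<dots> = (t * of_int s) * of_int (w m x)" unfolding m[OF x] by simp
      finally show ?thesis .
    qed
    then show ?thesis unfolding good_def by blast
  qed
  have good_act: "good (act u v)" if "good v" for v
    using u that by (induction u) (auto intro: good_refl)
  have prod0: "B v (simple_root k) * B v (simple_root l) = 0" if gv: "good v" for v
  proof -
    obtain t n where t: "\<And>x. x \<in> nodes \<Longrightarrow> B (simple_root x) v = t * of_int (w n x)"
      using gv unfolding good_def by blast
    have "of_int (w n k * w n l) = (0 :: 'F)"
      using twin_weight_support[OF kl(3), of l1 l2 l3 n] kl(4) tw' by (simp add: w_def)
    then have "of_int (w n k) = (0::'F) \<or> of_int (w n l) = (0::'F)" by simp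
    then show ?thesis
      using t[OF kl(1)] t[OF kl(2)] B_sym[of v "simple_root k"] B_sym[of v "simple_root l"] by auto
  qed
  define p q :: "vertex \<Rightarrow> 'F" where "p = simple_root i" and "q = simple_root j"
  have all: "x = l1 \<or> x = l2 \<or> x = l3" for x
    using tw' l3 by (cases x; cases l1; cases l2; cases l3) simp_all
  have "B (simple_root x) (p + q) = 2 * of_int (w (Suc 0) x)"
    "B (simple_root x) (p - q) = 2 * of_int (w 0 x)" if x: "x \<in> nodes" for x
    using x tw' ij unfolding p_def q_def B_right
    by (cases x; auto simp: bform_simple w_def cartan_eval)+
  then have good0: "good (p + q)" "good (p - q)" unfolding good_def by blast+
  define P Q where "P = act u p" and "Q = act u q"
  \<comment> \<open>By polarisation the product of the two leaves is a difference of squares of good vectors.\<close>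
  have zero: "B (P + Q) (simple_root k) * B (P + Q) (simple_root l) = 0"
    "B (P - Q) (simple_root k) * B (P - Q) (simple_root l) = 0"
    using prod0[OF good_act[OF good0(1)]] prod0[OF good_act[OF good0(2)]]
    unfolding P_def Q_def word_act_linear act_diff by blast+
  have "2 * (B P (simple_root k) * B Q (simple_root l) + B Q (simple_root k) * B P (simple_root l))
      = B (P + Q) (simple_root k) * B (P + Q) (simple_root l)
      - B (P - Q) (simple_root k) * B (P - Q) (simple_root l)"
    unfolding B_left by (simp add: algebra_simps)
  then have "2 * (B P (simple_root k) * B Q (simple_root l) + B Q (simple_root k) * B P (simple_root l)) = 0"
    unfolding zero by simp
  then have "B P (simple_root k) * B Q (simple_root l) + B Q (simple_root k) * B P (simple_root l) = 0"
    unfolding mult_eq_0_iff by (elim disjE) simp_all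
  then show ?thesis
    using tact_sym_prod[OF u, of p q] ij by (simp add: P_def Q_def p_def q_def ev_sym_prod)
qed

section \<open>Elementary roots\<close>

lemma real_root_add_simple:
  assumes "\<beta> \<in> real_roots a b c" "k \<in> nodes" "B (simple_root k) \<beta> = - 1"
  shows "\<beta> + simple_root k \<in> real_roots a b c"
proof -
  have "act [k] \<beta> = \<beta> + simple_root k" using assms(3) by (simp add: reflection_def fun_eq_iff)
  then show ?thesis using real_root_act[of "[k]" \<beta>] assms by simp
qed

text \<open>The highest roots of the subsystems of type \<open>D\<close>, built up along the leg.\<close>

fun theta :: "leg \<Rightarrow> nat \<Rightarrow> vertex \<Rightarrow> 'F::field" where
  "theta l 0 = simple_root Branch + simple_root (Leg LegA 0) + simple_root (Leg LegB 0)
     + simple_root (Leg LegC 0) + simple_root Branch"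
| "theta l (Suc d) = theta l d + simple_root (Leg l (Suc d)) + simple_root (Leg l d)"

lemma theta_apply:
  "theta l d j = (case j of Branch \<Rightarrow> 2 | Leg l' e \<Rightarrow>
     if l' = l then (if e < d then 2 else if e = d then 1 else 0) else if e = 0 then 1 else 0)"
proof (induction d)
  case 0
  show ?case
  proof (cases j)
    case (Leg l' e)
    then show ?thesis by (cases l'; cases l) (auto simp: simple_root_def)
  qed (simp add: simple_root_def)
next
  case (Suc d)
  then show ?case by (cases j) (auto simp: simple_root_def)
qed

lemma D_highest_root_theta: "D_highest_root a b c (Leg l d) = theta l d"
proof
  fix j
  define D where "D = D_vertices a b c (Leg l d)"
  have DB: "Branch \<in> D" by (simp add: D_def D_vertices_def)
  have DL: "Leg l' e \<in> D \<longleftrightarrow> l' = l \<and> e \<le> d \<or> e = 0" for l' e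
    using len_pos[of l'] by (auto simp: D_def D_vertices_def)
  have val: "D_highest_root a b c (Leg l d) j
      = (if j \<notin> D then 0 else if card {k \<in> D. adj j k} = 1 then 1 else 2)" for j
    by (simp add: D_highest_root_def D_def)
  have two: "card {x, y} \<noteq> 1" if "x \<noteq> y" for x y :: vertex using that by simp
  have one: "card {x} = 1" for x :: vertex by simp
  show "D_highest_root a b c (Leg l d) j = theta l d j"
  proof (cases j)
    case Branch
    have "{Leg LegA 0, Leg LegB 0} \<subseteq> {k \<in> D. adj Branch k}" using DL by auto
    moreover have "finite {k \<in> D. adj Branch k}"
    proof (rule finite_subset)
      show "{k \<in> D. adj Branch k} \<subseteq> (\<lambda>l. Leg l 0) ` {LegA, LegB, LegC}"
      proof
        fix k assume "k \<in> {k \<in> D. adj Branch k}"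
        then obtain l' where "k = Leg l' 0" by (cases k) auto
        then show "k \<in> (\<lambda>l. Leg l 0) ` {LegA, LegB, LegC}" by (cases l') auto
      qed
    qed simp
    ultimately have "card {Leg LegA 0, Leg LegB 0} \<le> card {k \<in> D. adj Branch k}"
      by (intro card_mono)
    then show ?thesis using Branch DB by (simp add: val theta_apply)
  next
    case j: (Leg l' e)
    consider "l' \<noteq> l" "e \<noteq> 0" | "l' \<noteq> l" "e = 0" | "l' = l" "e > d" | "l' = l" "e = d" | "l' = l" "e < d"
      by linarith
    then show ?thesis
    proof cases
      case 2
      have "{k \<in> D. adj j k} = {Branch}" (is "?L = ?r")
      proof
        show "?L \<subseteq> ?r"
        proof
          fix k assume "k \<in> ?L" then show "k \<in> ?r" using 2 j DL by (cases k) auto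
        qed
      qed (use 2 j DB in auto)
      then show ?thesis using 2 j DL by (simp add: val theta_apply)
    next
      case 4
      have "{k \<in> D. adj j k} = {if d = 0 then Branch else Leg l (d - 1)}" (is "?L = {?h}")
      proof
        show "?L \<subseteq> {?h}"
        proof
          fix k assume "k \<in> ?L" then show "k \<in> {?h}" using 4 j DL by (cases k) auto
        qed
      qed (use 4 j DB DL in auto)
      then show ?thesis using 4 j DL by (simp add: val theta_apply)
    next
      case 5
      have "{k \<in> D. adj j k} = {Leg l (Suc e), if e = 0 then Branch else Leg l (e - 1)}" (is "?L = ?r")
      proof
        show "?L \<subseteq> ?r"
        proof
          fix k assume "k \<in> ?L" then show "k \<in> ?r" using 5 j DL by (cases k) auto
        qed
      qed (use 5 j DB DL in auto)
      then have "card {k \<in> D. adj j k} \<noteq> 1" using two by auto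
      then show ?thesis using 5 j DL by (simp add: val theta_apply)
    qed (use j DL in \<open>auto simp: val theta_apply\<close>)
  qed
qed

lemma theta_pairing:
  assumes "d < len l" "e < len l" "d \<le> e"
  shows "B (simple_root (Leg l e)) (theta l d) = (if e = Suc d then - 1 else 0 :: 'F::field_char_0)"
  using assms
proof (induction d arbitrary: e)
  case 0
  then show ?case
    unfolding theta.simps B_right by (cases l) (simp_all add: bform_simple cartan_eval)
next
  case (Suc d)
  then show ?case
    using Suc.IH[of e] unfolding theta.simps B_right by (simp add: bform_simple cartan_eval)
qed

lemma theta_real_root: "d < len l \<Longrightarrow> (theta l d :: vertex \<Rightarrow> 'F::field_char_0) \<in> real_roots a b c"
proof (induction d)
  case 0
  show ?case
    unfolding theta.simps
    by (intro real_root_add_simple simple_root_real) (simp_all add: B_right bform_simple cartan_eval)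
next
  case (Suc d)
  have "theta l d + simple_root (Leg l (Suc d)) \<in> (real_roots a b c :: (vertex \<Rightarrow> 'F) set)"
    using Suc theta_pairing[of d l "Suc d"] by (intro real_root_add_simple) auto
  then show ?case
    unfolding theta.simps
    using Suc.prems theta_pairing[of d l d, where 'F = 'F]
    by (intro real_root_add_simple[of "theta l d + simple_root (Leg l (Suc d))"])
      (auto simp: B_right bform_simple cartan_eval)
qed

lemma elementary_orthogonal:
  fixes \<beta> :: "vertex \<Rightarrow> 'F::field_char_0"
  assumes i: "i \<in> nodes" and "elementary a b c i \<beta>"
  shows "\<beta> \<in> real_roots a b c" "B (simple_root i) \<beta> = 0"
proof -
  show "\<beta> \<in> real_roots a b c"
    using assms by (simp add: elementary_def positive_roots_def)
  consider (c1) j where "j \<in> nodes" "\<beta> = simple_root j" "cartan i j = 0"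
    | (c2) h j where "h \<in> nodes" "j \<in> nodes" "h \<noteq> j" "adj h i" "adj i j"
      "\<beta> = simple_root h + simple_root i + simple_root j"
    | (c3) "i \<noteq> Branch" "\<beta> = D_highest_root a b c i"
    using assms(2) unfolding elementary_def by blast
  then show "B (simple_root i) \<beta> = 0"
  proof cases
    case c1
    then show ?thesis using i by (simp add: bform_simple)
  next
    case c2
    have "cartan i h = - 1" "cartan i j = - 1" using c2 cartan_adj adj_commute by blast+
    then show ?thesis using c2 i by (simp add: B_right bform_simple)
  next
    case c3
    then obtain l d where "i = Leg l d" by (cases i) auto
    then show ?thesis using c3 i theta_pairing[of d l d] by (simp add: D_highest_root_theta)
  qed
qed

lemma elementary_simple:
  "j \<in> nodes \<Longrightarrow> cartan i j = 0 \<Longrightarrow> elementary a b c i (simple_root j :: vertex \<Rightarrow> 'F::field_char_0)"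
  using simple_root_real[of j] by (auto simp: elementary_def positive_roots_def simple_root_def)

lemma elementary_path:
  assumes "h \<in> nodes" "i \<in> nodes" "j \<in> nodes" "h \<noteq> j" "adj h i" "adj i j"
  shows "elementary a b c i (simple_root h + simple_root i + simple_root j :: vertex \<Rightarrow> 'F::field_char_0)"
proof -
  have "cartan i h = - 1" "cartan j i = - 1" using assms cartan_adj adj_commute by blast+
  moreover have "cartan j h = 0"
    using assms by (cases h; cases i; cases j) (auto simp: cartan_eval)
  ultimately have "simple_root h + simple_root i + simple_root j \<in> (real_roots a b c :: (vertex \<Rightarrow> 'F) set)"
    using assms by (intro real_root_add_simple simple_root_real) (auto simp: B_right bform_simple)
  then show ?thesis
    using assms by (auto simp: elementary_def positive_roots_def simple_root_def)
qed

lemma elementary_theta: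
  assumes "d < len l"
  shows "elementary a b c (Leg l d) (theta l d :: vertex \<Rightarrow> 'F::field_char_0)"
proof -
  have "(theta l d :: vertex \<Rightarrow> 'F) i \<in> \<nat>" for i
    by (auto simp: theta_apply split: vertex.split)
  then show ?thesis
    using theta_real_root[OF assms]
    by (auto simp: elementary_def positive_roots_def D_highest_root_theta)
qed

abbreviation elem_span :: "vertex \<Rightarrow> (vertex \<Rightarrow> 'F::field_char_0) set" where
  "elem_span i \<equiv> fs.span {\<beta>. elementary a b c i \<beta>}"

lemma elem_span_far:
  fixes v :: "vertex \<Rightarrow> 'F::field_char_0"
  assumes "v \<in> refl_space a b c" "\<And>k. k \<in> nodes \<Longrightarrow> cartan i k \<noteq> 0 \<Longrightarrow> v k = 0"
  shows "v \<in> elem_span i"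
proof -
  have "(\<Sum>k\<in>nodes. fscale (v k) (simple_root k)) \<in> elem_span i"
  proof (rule fs.span_sum)
    fix k assume k: "k \<in> nodes"
    show "fscale (v k) (simple_root k) \<in> elem_span i"
    proof (cases "cartan i k = 0")
      case True
      then show ?thesis using elementary_simple[OF k] by (intro fs.span_scale fs.span_base) simp
    next
      case False
      then have "v k = 0" using assms(2) k by blast
      then show ?thesis by (simp only: fs.scale_zero_left fs.span_zero)
    qed
  qed
  then show ?thesis using refl_space_expand[OF assms(1)] by simp
qed

text \<open>
  Modulo the span of the elementary roots each neighbour of \<open>\<alpha>\<^sub>i\<close> is \<open>- \<alpha>\<^sub>i / 2\<close>. At the branch
  vertex this follows from the three paths through it. On a leg, the highest root of type \<open>D\<close>
  deals with the inner neighbour, having coefficient 2 there, and then the path through \<open>i\<close> deals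
  with the outer one.
\<close>

lemma elem_span_neighbour:
  fixes i j :: vertex
  assumes i: "i \<in> nodes" and j: "j \<in> nodes" and ij: "adj i j"
  shows "simple_root j + fscale (1 / 2) (simple_root i) \<in> (elem_span i :: (vertex \<Rightarrow> 'F::field_char_0) set)"
proof -
  let ?e = "simple_root :: vertex \<Rightarrow> vertex \<Rightarrow> 'F"
  have path: "?e h + ?e i + ?e k \<in> elem_span i" if "h \<in> nodes" "k \<in> nodes" "h \<noteq> k" "adj h i" "adj i k" for h k
    using elementary_path[of h i k] that i by (intro fs.span_base) simp
  show ?thesis
  proof (cases i)
    case Branch
    then obtain l where l: "j = Leg l 0" using ij by (cases j) auto
    obtain l' l'' where l': "l' \<noteq> l" "l'' \<noteq> l" "l' \<noteq> l''"
      by (cases l) auto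
    have "fscale (1 / 2) ((?e j + ?e i + ?e (Leg l' 0)) + (?e j + ?e i + ?e (Leg l'' 0))
        - (?e (Leg l' 0) + ?e i + ?e (Leg l'' 0))) \<in> elem_span i"
      using l l' j Branch by (intro fs.span_scale fs.span_diff fs.span_add path) auto
    also have "fscale (1 / 2) ((?e j + ?e i + ?e (Leg l' 0)) + (?e j + ?e i + ?e (Leg l'' 0))
        - (?e (Leg l' 0) + ?e i + ?e (Leg l'' 0))) = ?e j + fscale (1 / 2) (?e i)"
      by (simp add: fun_eq_iff field_simps)
    finally show ?thesis .
  next
    case il: (Leg l d)
    define h where "h = (if d = 0 then Branch else Leg l (d - 1))"
    have d: "d < len l" using il i by simp
    have h: "h \<in> nodes" "adj h i" using d il by (auto simp: h_def)
    have inner: "?e h + fscale (1 / 2) (?e i) \<in> elem_span i"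
    proof -
      define r where "r = theta l d - ?e i - fscale 2 (?e h)"
      have "r \<in> elem_span i"
      proof (rule elem_span_far)
        have "theta l d \<in> (refl_space a b c :: (vertex \<Rightarrow> 'F) set)"
          using theta_real_root[OF d] real_root_in_refl_space by blast
        then show "r \<in> refl_space a b c"
          using i h(1) by (auto simp: r_def refl_space_def simple_root_def)
        fix k assume "k \<in> nodes" "cartan i k \<noteq> 0"
        then show "r k = 0"
          using il by (cases k) (auto simp: r_def h_def theta_apply simple_root_def cartan_eval split: if_splits)
      qed
      moreover have "theta l d \<in> elem_span i"
        using elementary_theta[OF d] il by (intro fs.span_base) simp
      ultimately have "fscale (1 / 2) (theta l d - r) \<in> elem_span i"
        by (intro fs.span_scale fs.span_diff)
      also have "fscale (1 / 2) (theta l d - r) = ?e h + fscale (1 / 2) (?e i)"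
        by (simp add: r_def fun_eq_iff field_simps)
      finally show ?thesis .
    qed
    show ?thesis
    proof (cases "j = h")
      case False
      have "(?e h + ?e i + ?e j) - (?e h + fscale (1 / 2) (?e i)) \<in> elem_span i"
        using inner False h j ij by (intro fs.span_diff path) auto
      also have "(?e h + ?e i + ?e j) - (?e h + fscale (1 / 2) (?e i)) = ?e j + fscale (1 / 2) (?e i)"
        by (simp add: fun_eq_iff field_simps)
      finally show ?thesis .
    qed (use inner in simp)
  qed
qed

text \<open>So each \<open>v\<close> is \<open>B(\<alpha>\<^sub>i, v) \<alpha>\<^sub>i / 2\<close> modulo that span, and a vector orthogonal to \<open>\<alpha>\<^sub>i\<close> lies
  in it.\<close>

lemma elem_span_orthogonal:
  fixes v :: "vertex \<Rightarrow> 'F::field_char_0"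
  assumes i: "i \<in> nodes" and v: "v \<in> refl_space a b c" "B (simple_root i) v = 0"
  shows "v \<in> elem_span i"
proof -
  let ?e = "simple_root :: vertex \<Rightarrow> vertex \<Rightarrow> 'F"
  define f where "f j = ?e j - fscale (of_int (cartan i j) / 2) (?e i)" for j
  have f: "f j \<in> elem_span i" if j: "j \<in> nodes" for j
  proof (cases i j rule: cartan_cases)
    case 1
    then have "f j = 0" by (simp add: f_def fun_eq_iff)
    then show ?thesis by (simp only: fs.span_zero)
  next
    case 2
    then have "f j = ?e j + fscale (1 / 2) (?e i)" by (simp add: f_def fun_eq_iff)
    then show ?thesis using elem_span_neighbour[OF i j 2(1)] by simp
  next
    case 3
    then have "f j = ?e j" by (simp add: f_def fun_eq_iff)
    then show ?thesis
      using elementary_simple[OF j 3(3), where 'F = 'F] by (auto intro!: fs.span_base)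
  qed
  have "(\<Sum>j\<in>nodes. fscale (v j) (f j)) \<in> elem_span i"
    using f by (intro fs.span_sum fs.span_scale)
  moreover have "(\<Sum>j\<in>nodes. fscale (v j) (f j)) = v"
  proof
    fix x
    have "(\<Sum>j\<in>nodes. fscale (v j) (f j)) x
        = (\<Sum>j\<in>nodes. fscale (v j) (?e j)) x - (\<Sum>j\<in>nodes. of_int (cartan i j) * v j) / 2 * ?e i x"
      unfolding fun_sum_apply
      by (simp add: f_def algebra_simps sum_subtractf sum_distrib_left sum_distrib_right sum_divide_distrib)
    then show "(\<Sum>j\<in>nodes. fscale (v j) (f j)) x = v x"
      using v(2) refl_space_expand[OF v(1)] bform_simple_left[OF i, of v] by simp
  qed
  ultimately show ?thesis by simp
qed

section \<open>Nondegeneracy in non-affine type\<close>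

lemma B_leg:
  assumes "v \<in> refl_space a b c" "d < len l"
  shows "B (simple_root (Leg l d)) v
    = 2 * v (Leg l d) - v (if d = 0 then Branch else Leg l (d - 1)) - v (Leg l (Suc d))"
proof -
  let ?h = "if d = 0 then Branch else Leg l (d - 1)"
  have "B (simple_root (Leg l d)) v = (\<Sum>j\<in>nodes. of_int (cartan (Leg l d) j) * v j)"
    using assms by (intro bform_simple_left) simp
  also have "\<dots> = (\<Sum>j\<in>{Leg l d, ?h, Leg l (Suc d)}. of_int (cartan (Leg l d) j) * v j)"
  proof (rule sum.mono_neutral_cong)
    show "of_int (cartan (Leg l d) j) * v j = 0" if "j \<in> nodes - {Leg l d, ?h, Leg l (Suc d)}" for j
      using that by (cases j) (auto simp: cartan_eval split: if_splits)
    show "of_int (cartan (Leg l d) j) * v j = 0" if "j \<in> {Leg l d, ?h, Leg l (Suc d)} - nodes" for j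
      using that assms(1) by (auto simp: refl_space_def)
  qed simp_all
  also have "\<dots> = 2 * v (Leg l d) - v ?h - v (Leg l (Suc d))"
    by (auto simp: cartan_eval)
  finally show ?thesis .
qed

lemma B_branch:
  "B (simple_root Branch) v = 2 * v Branch - v (Leg LegA 0) - v (Leg LegB 0) - v (Leg LegC 0)"
proof -
  let ?N = "{Branch, Leg LegA 0, Leg LegB 0, Leg LegC 0}"
  have "B (simple_root Branch) v = (\<Sum>j\<in>nodes. of_int (cartan Branch j) * v j)"
    by (intro bform_simple_left) simp
  also have "\<dots> = (\<Sum>j\<in>?N. of_int (cartan Branch j) * v j)"
  proof (rule sum.mono_neutral_cong)
    show "of_int (cartan Branch j) * v j = 0" if "j \<in> nodes - ?N" for j
    proof (cases j)
      case (Leg l d)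
      then show ?thesis using that by (cases l) (auto simp: cartan_eval)
    qed (use that in simp)
  qed auto
  also have "\<dots> = 2 * v Branch - v (Leg LegA 0) - v (Leg LegB 0) - v (Leg LegC 0)"
    by (simp add: cartan_eval)
  finally show ?thesis .
qed

text \<open>
  Along a leg a vector in the radical is an arithmetic progression that reaches 0 one step beyond
  the end.
\<close>

lemma radical_leg:
  fixes v :: "vertex \<Rightarrow> 'F::field_char_0"
  assumes v: "v \<in> refl_space a b c" and rad: "\<And>k. k \<in> nodes \<Longrightarrow> B (simple_root k) v = 0"
  shows "d \<le> len l \<Longrightarrow> v (Leg l d) = v Branch + of_nat (d + 1) * (v (Leg l 0) - v Branch)"
    and "of_nat (len l + 1) * v (Leg l 0) = of_nat (len l) * v Branch"
proof -
  have step: "v (Leg l (Suc d)) = 2 * v (Leg l d) - v (if d = 0 then Branch else Leg l (d - 1))"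
    if "d < len l" for d
    using B_leg[OF v that] rad[of "Leg l d"] that by (simp add: algebra_simps)
  have prog: "v (Leg l d) = v Branch + of_nat (d + 1) * (v (Leg l 0) - v Branch)" if "d \<le> len l" for d
    using that
  proof (induction d rule: less_induct)
    case (less d)
    consider "d = 0" | "d = 1" | d' where "d = Suc (Suc d')"
      by (metis One_nat_def not0_implies_Suc)
    then show ?case
    proof cases
      case 2
      then show ?thesis using step[of 0] less.prems by (simp add: algebra_simps)
    next
      case 3
      then show ?thesis
        using step[of "Suc d'"] less.IH[of "Suc d'"] less.IH[of d'] less.prems
        by (simp add: algebra_simps)
    qed simp
  qed
  show "v (Leg l d) = v Branch + of_nat (d + 1) * (v (Leg l 0) - v Branch)" if "d \<le> len l"
    by (rule prog[OF that])
  have "v (Leg l (len l)) = 0" using v by (simp add: refl_space_def)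
  then show "of_nat (len l + 1) * v (Leg l 0) = of_nat (len l) * v Branch"
    using prog[of "len l"] by (simp add: algebra_simps)
qed

end

locale nonaffine_diagram = y_diagram +
  assumes nonaffine: "\<not> affine_type a b c"
begin

text \<open>
  By \<open>radical_leg\<close> the equation at the branch vertex says \<open>1/(a+1) + 1/(b+1) + 1/(c+1) = 1\<close>
  unless the vector vanishes there, and the solutions of that equation are the affine types.
\<close>

lemma B_nondegenerate:
  fixes v :: "vertex \<Rightarrow> 'F::field_char_0"
  assumes v: "v \<in> refl_space a b c" and rad: "\<And>k. k \<in> nodes \<Longrightarrow> B (simple_root k) v = 0"
  shows "v = 0"
proof -
  have v0: "v Branch = 0"
  proof (rule ccontr)
    assume nz: "v Branch \<noteq> 0"
    define x :: "leg \<Rightarrow> 'F" where "x l = of_nat (len l + 1)" for l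
    have xnz: "x l \<noteq> 0" for l unfolding x_def by (metis Suc_eq_plus1 of_nat_neq_0)
    have leg: "v (Leg l 0) = v Branch * ((x l - 1) / x l)" for l
      using radical_leg(2)[OF v rad, of l] xnz[of l] by (simp add: x_def field_simps)
    have "2 * v Branch - v (Leg LegA 0) - v (Leg LegB 0) - v (Leg LegC 0) = 0"
      using rad[of Branch] B_branch[of v] by simp
    then have "v Branch * (2 - (x LegA - 1) / x LegA - (x LegB - 1) / x LegB - (x LegC - 1) / x LegC) = 0"
      unfolding leg by (simp add: algebra_simps)
    then have "2 - (x LegA - 1) / x LegA - (x LegB - 1) / x LegB - (x LegC - 1) / x LegC = 0"
      using nz by simp
    then have "x LegA * x LegB + x LegB * x LegC + x LegA * x LegC = x LegA * x LegB * x LegC"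
      using xnz[of LegA] xnz[of LegB] xnz[of LegC] by (simp add: field_simps)
    then have "of_nat ((a + 1) * (b + 1) + (b + 1) * (c + 1) + (a + 1) * (c + 1))
        = (of_nat ((a + 1) * (b + 1) * (c + 1)) :: 'F)"
      unfolding x_def leg_length.simps of_nat_mult of_nat_add by simp
    then have "(a + 1) * (b + 1) + (b + 1) * (c + 1) + (a + 1) * (c + 1) = (a + 1) * (b + 1) * (c + 1)"
      by (simp only: of_nat_eq_iff)
    then show False using unit_fractions_affine legs_pos nonaffine by blast
  qed
  have "v (Leg l d) = 0" for l d
  proof (cases "d < len l")
    case True
    have "v (Leg l 0) = 0"
      using radical_leg(2)[OF v rad, of l] v0 by (metis Suc_eq_plus1 mult_eq_0_iff mult_zero_right of_nat_neq_0)
    then show ?thesis using radical_leg(1)[OF v rad, of d l] v0 True by simp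
  next
    case False
    then show ?thesis using v by (simp add: refl_space_def)
  qed
  then have "v j = 0" for j using v0 by (cases j) auto
  then show ?thesis by (simp add: fun_eq_iff)
qed

text \<open>By nondegeneracy, pairing with the simple roots maps a basis of \<open>V\<close> to an independent set of
  the same cardinality, which therefore spans \<open>V\<close>.\<close>

lemma dual_root_exists:
  assumes i: "i \<in> nodes"
  shows "\<exists>v :: vertex \<Rightarrow> 'F::field_char_0. v \<in> refl_space a b c \<and>
    (\<forall>j\<in>nodes. B v (simple_root j) = (if i = j then 1 else 0))"
proof -
  define f :: "(vertex \<Rightarrow> 'F) \<Rightarrow> vertex \<Rightarrow> 'F"
    where "f v = (\<lambda>k. if k \<in> nodes then B (simple_root k) v else 0)" for v
  define E :: "(vertex \<Rightarrow> 'F) set" where "E = simple_root ` nodes"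
  interpret f: Vector_Spaces.linear fscale fscale f
    by unfold_locales (auto simp: f_def B_right fun_eq_iff)
  have finE: "finite E" by (simp add: E_def)
  have inj: "inj_on f (fs.span E)"
  proof (rule inj_onI)
    fix x y assume xy: "x \<in> fs.span E" "y \<in> fs.span E" "f x = f y"
    have mem: "x - y \<in> refl_space a b c"
      using fs.span_diff[OF xy(1,2)] unfolding refl_space_span E_def .
    have "B (simple_root k) (x - y) = 0" if "k \<in> nodes" for k
      using fun_cong[OF xy(3), of k] that by (simp add: f_def B_right)
    then have "x - y = 0" using B_nondegenerate[OF mem] by blast
    then show "x = y" by (simp only: right_minus_eq)
  qed
  have indE: "fs.independent E"
  proof (rule fs.independent_if_scalars_zero)
    show "finite E" by (rule finE)
    fix g x assume z: "(\<Sum>x\<in>E. fscale (g x) x) = 0" and x: "x \<in> E"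
    obtain k where k: "k \<in> nodes" "x = simple_root k" using x by (auto simp: E_def)
    have "(\<Sum>y\<in>E. fscale (g y) y) k = (\<Sum>y\<in>E. if y = x then g x else 0)"
      unfolding fun_sum_apply
    proof (rule sum.cong)
      fix y assume "y \<in> E"
      then obtain j where j: "y = simple_root j" by (auto simp: E_def)
      have yk: "y k = (if j = k then 1 else 0)" "x k = 1" by (simp_all add: j k simple_root_def)
      show "fscale (g y) y k = (if y = x then g x else 0)"
      proof (cases "j = k")
        case True
        then have "y = x" using j k(2) by simp
        then show ?thesis using yk(2) by simp
      next
        case False
        then have "y k = 0" using yk(1) by simp
        moreover have "y \<noteq> x" using calculation yk(2) by auto
        ultimately show ?thesis by simp
      qed
    qed simp
    then show "g x = 0" using z x by (simp add: E_def)
  qed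
  have ind: "fs.independent (f ` E)" by (rule f.independent_inj_on_image[OF indE inj])
  have cardE: "card (f ` E) = card E"
    by (intro card_image inj_on_subset[OF inj] fs.span_superset)
  have fR: "f ` E \<subseteq> fs.span E"
  proof -
    have "f v \<in> refl_space a b c" for v by (simp add: f_def refl_space_def)
    then show ?thesis unfolding E_def refl_space_span by blast
  qed
  have "simple_root i \<in> fs.span (f ` E)"
  proof (rule ccontr)
    assume n: "simple_root i \<notin> fs.span (f ` E)"
    then have "fs.independent (insert (simple_root i) (f ` E))"
      using ind unfolding fs.independent_insert by simp
    moreover have "insert (simple_root i) (f ` E) \<subseteq> fs.span E"
      using fR i fs.span_base[of "simple_root i" E] unfolding E_def by blast
    ultimately have "card (insert (simple_root i) (f ` E)) \<le> card E"
      using fs.independent_span_bound[OF finE] by blast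
    moreover have "simple_root i \<notin> f ` E" using n fs.span_base[of "simple_root i" "f ` E"] by blast
    ultimately show False using cardE finE by simp
  qed
  then have "simple_root i \<in> f ` fs.span E" by (simp only: f.span_image)
  then obtain v where v: "simple_root i = f v" "v \<in> fs.span E" by (rule imageE)
  have "B v (simple_root j) = (if i = j then 1 else 0)" if "j \<in> nodes" for j
  proof -
    have "B v (simple_root j) = f v j" unfolding f_def using that by (subst B_sym) simp
    then show ?thesis unfolding v(1)[symmetric] by (simp add: simple_root_def)
  qed
  then show ?thesis using v(2) unfolding refl_space_span E_def by blast
qed

lemma dual_root:
  assumes i: "i \<in> nodes"
  shows "(dual_root a b c i :: vertex \<Rightarrow> 'F::field_char_0) \<in> refl_space a b c"
    and "v \<in> refl_space a b c \<Longrightarrow> B (dual_root a b c i) v = (v i :: 'F)"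
proof -
  let ?P = "\<lambda>v :: vertex \<Rightarrow> 'F. v \<in> refl_space a b c \<and>
    (\<forall>j\<in>nodes. B v (simple_root j) = (if i = j then 1 else 0))"
  have "\<exists>!v. ?P v"
  proof (rule ex_ex1I)
    show "\<exists>v. ?P v" by (rule dual_root_exists[OF i])
    fix v w assume vw: "?P v" "?P w"
    have "v - w = 0"
    proof (rule B_nondegenerate)
      show "v - w \<in> refl_space a b c" using vw fs.subspace_diff[OF subspace_refl_space] by blast
      show "B (simple_root k) (v - w) = 0" if "k \<in> nodes" for k
        using vw that B_sym[of v "simple_root k"] B_sym[of w "simple_root k"] by (simp add: B_right)
    qed
    then show "v = w" by (simp only: right_minus_eq)
  qed
  then have P: "?P (dual_root a b c i)" unfolding dual_root_def by (rule theI')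
  then show "(dual_root a b c i :: vertex \<Rightarrow> 'F) \<in> refl_space a b c" by blast
  show "B (dual_root a b c i) v = v i" if v: "v \<in> refl_space a b c"
  proof -
    have "B (dual_root a b c i) v = (\<Sum>j\<in>nodes. v j * B (dual_root a b c i) (simple_root j))"
      using arg_cong[OF refl_space_expand[OF v], of "B (dual_root a b c i)"] by (simp add: B_sum_right B_right)
    also have "\<dots> = (\<Sum>j\<in>nodes. if j = i then v j else 0)"
      using P by (intro sum.cong) auto
    finally show ?thesis using i by simp
  qed
qed

section \<open>The Virasoro element\<close>

lemma ev_nondegenerate:
  fixes T :: "vertex \<times> vertex \<Rightarrow> 'F::field_char_0"
  assumes supp: "\<And>i j. i \<notin> nodes \<or> j \<notin> nodes \<Longrightarrow> T (i, j) = 0"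
    and ev0: "\<And>i j. i \<in> nodes \<Longrightarrow> j \<in> nodes \<Longrightarrow> ev T (simple_root i) (simple_root j) = 0"
  shows "T = 0"
proof -
  have con: "contract T (simple_root j) = 0" if "j \<in> nodes" for j
  proof (rule B_nondegenerate)
    show "contract T (simple_root j) \<in> refl_space a b c"
      using supp by (simp add: refl_space_def contract_def)
    show "B (simple_root k) (contract T (simple_root j)) = 0" if "k \<in> nodes" for k
      using ev0[OF that \<open>j \<in> nodes\<close>] by (subst B_sym) (simp add: B_contract)
  qed
  have "(\<lambda>j. T (i, j)) = 0" for i
  proof (rule B_nondegenerate)
    show "(\<lambda>j. T (i, j)) \<in> refl_space a b c" using supp by (simp add: refl_space_def)
    fix k assume k: "k \<in> nodes"
    have "B (\<lambda>j. T (i, j)) (simple_root k) = contract T (simple_root k) i"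
      by (subst B_expand) (simp add: contract_def)
    then show "B (simple_root k) (\<lambda>j. T (i, j)) = 0"
      using con[OF k] B_sym[of "\<lambda>j. T (i, j)" "simple_root k"] by simp
  qed
  then have "T (i, j) = 0" for i j by (metis zero_fun_apply)
  then show ?thesis by (simp add: fun_eq_iff)
qed

lemma S2_eqI:
  fixes S T :: "vertex \<times> vertex \<Rightarrow> 'F::field_char_0"
  assumes "S \<in> S2" "T \<in> S2"
    and "\<And>i j. i \<in> nodes \<Longrightarrow> j \<in> nodes \<Longrightarrow>
      ev S (simple_root i) (simple_root j) = ev T (simple_root i) (simple_root j)"
  shows "S = T"
proof -
  have "S - T = 0"
    using assms S2_props(2)[OF assms(1)] S2_props(2)[OF assms(2)]
    by (intro ev_nondegenerate) (auto simp: ev_linear)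
  then show ?thesis by (simp only: right_minus_eq)
qed

abbreviation vir :: "vertex \<times> vertex \<Rightarrow> 'F::field_char_0" where
  "vir \<equiv> virasoro a b c"

lemma ev_virasoro:
  fixes u v :: "vertex \<Rightarrow> 'F::field_char_0"
  assumes "u \<in> refl_space a b c"
  shows "ev vir u v = B u v"
proof -
  have "ev vir u v = (\<Sum>i\<in>nodes. B (dual_root a b c i) u * B (simple_root i) v)"
    by (simp only: virasoro_def ev_sum ev_tensor)
  also have "\<dots> = (\<Sum>i\<in>nodes. u i * B (simple_root i) v)"
    by (intro sum.cong) (simp_all add: dual_root(2) assms)
  finally show ?thesis by (simp only: B_expand[of u v])
qed

lemma virasoro_in_S2: "(vir :: vertex \<times> vertex \<Rightarrow> 'F::field_char_0) \<in> S2"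
proof -
  have supp: "vir (i, j) = (0 :: 'F)" if "i \<notin> nodes \<or> j \<notin> nodes" for i j
    unfolding virasoro_def fun_sum_apply
    using that dual_root(1) by (intro sum.neutral) (auto simp: tensor_apply refl_space_def simple_root_def)
  define T :: "vertex \<times> vertex \<Rightarrow> 'F" where "T = (\<lambda>(i, j). vir (i, j) - vir (j, i))"
  have "ev T u v = ev vir u v - ev vir v u" for u v
  proof -
    have "ev vir v u = (\<Sum>i\<in>nodes. \<Sum>j\<in>nodes. vir (j, i) * B (simple_root i) u * B (simple_root j) v)"
      unfolding ev_def by (subst sum.swap) (simp add: mult.commute mult.left_commute)
    then show ?thesis by (simp add: ev_def T_def sum_subtractf algebra_simps)
  qed
  then have T0: "T = 0"
    using supp
    by (intro ev_nondegenerate) (auto simp: T_def ev_virasoro bform_simple cartan_sym)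
  have "vir (i, j) = (vir (j, i) :: 'F)" for i j
  proof -
    have "T (i, j) = 0" by (simp only: T0 zero_fun_apply)
    then show ?thesis by (simp add: T_def)
  qed
  then show ?thesis using supp by (intro S2I)
qed

lemma tact_virasoro:
  assumes u: "u \<in> lists nodes"
  shows "tact u vir = (vir :: vertex \<times> vertex \<Rightarrow> 'F::field_char_0)"
proof (rule S2_eqI)
  show "tact u vir \<in> (S2 :: (vertex \<times> vertex \<Rightarrow> 'F) set)" by (rule tact_in_S2[OF virasoro_in_S2 u])
  fix i j assume ij: "i \<in> nodes" "j \<in> nodes"
  let ?i = "simple_root i :: vertex \<Rightarrow> 'F" and ?j = "simple_root j :: vertex \<Rightarrow> 'F"
  have ru: "rev u \<in> lists nodes" using u by auto
  have "ev (tact u vir) ?i ?j = ev (tact u vir) (act u (act (rev u) ?i)) (act u (act (rev u) ?j))"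
    by (simp only: act_rev[OF u])
  also have "\<dots> = ev vir (act (rev u) ?i) (act (rev u) ?j)" by (rule ev_tact[OF virasoro_in_S2 u])
  also have "\<dots> = ev vir ?i ?j"
    using ij by (simp only: ev_virasoro act_in_refl_space[OF ru] act_form[OF ru] simple_root_in_refl_space)
  finally show "ev (tact u vir) ?i ?j = ev vir ?i ?j" .
qed (rule virasoro_in_S2)

lemma trace_virasoro: "trace vir = (of_nat (card nodes) :: 'F::field_char_0)"
proof -
  have "trace vir = (\<Sum>i\<in>nodes. B (dual_root a b c i) (simple_root i :: vertex \<Rightarrow> 'F))"
    by (simp only: virasoro_def trace_sum trace_tensor)
  also have "\<dots> = (\<Sum>i\<in>nodes. 1)"
    by (intro sum.cong) (simp_all add: dual_root(2), simp add: simple_root_def)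
  finally show ?thesis by simp
qed

lemma trace_virasoro_nonzero: "trace vir \<noteq> (0 :: 'F::field_char_0)"
proof -
  have "card nodes \<noteq> 0" using Branch_in_nodes by (auto simp del: Branch_in_nodes)
  then show ?thesis by (simp add: trace_virasoro)
qed

text \<open>
  As an endomorphism, such a tensor maps each simple root to a multiple of itself. By symmetry the
  factors at adjacent vertices agree, hence all agree, the diagram being connected.
\<close>

lemma scalar_tensor:
  fixes T :: "vertex \<times> vertex \<Rightarrow> 'F::field_char_0"
  assumes T: "T \<in> S2"
    and orth: "\<And>k u. k \<in> nodes \<Longrightarrow> u \<in> refl_space a b c \<Longrightarrow> B (simple_root k) u = 0
      \<Longrightarrow> ev T (simple_root k) u = 0"
  shows "\<exists>t. T = fscale t vir"
proof -
  let ?e = "simple_root :: vertex \<Rightarrow> vertex \<Rightarrow> 'F"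
  define t where "t k = ev T (?e k) (?e k) / 2" for k
  have ev: "ev T (?e k) (?e j) = t k * of_int (cartan k j)" if kj: "k \<in> nodes" "j \<in> nodes" for k j
  proof -
    define s :: 'F where "s = - of_int (cartan k j) / 2"
    have "ev T (?e k) (?e j + fscale s (?e k)) = 0"
      using kj
      by (intro orth fs.subspace_add[OF subspace_refl_space] fs.subspace_scale[OF subspace_refl_space])
        (simp_all only: B_right, simp_all add: bform_simple s_def)
    then show ?thesis unfolding ev_right by (simp add: s_def t_def algebra_simps)
  qed
  have adj: "t k = t j" if kj: "k \<in> nodes" "j \<in> nodes" "adj k j" for k j
  proof -
    have "cartan k j = - 1" "cartan j k = - 1" using kj cartan_adj adj_commute by blast+
    then show ?thesis using ev[OF kj(1,2)] ev[OF kj(2,1)] ev_commute[OF T, of "?e k" "?e j"] by simp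
  qed
  have leg: "t (Leg l d) = t Branch" if "d < len l" for l d
    using that
  proof (induction d)
    case 0
    then show ?case by (intro adj) simp_all
  next
    case (Suc d)
    have "t (Leg l (Suc d)) = t (Leg l d)" using Suc.prems by (intro adj) simp_all
    then show ?case using Suc by simp
  qed
  have all: "t k = t Branch" if "k \<in> nodes" for k
    using that leg by (cases k) auto
  have "T = fscale (t Branch) vir"
  proof (rule S2_eqI[OF T])
    show "fscale (t Branch) vir \<in> (S2 :: (vertex \<times> vertex \<Rightarrow> 'F) set)"
      by (rule fs.subspace_scale[OF subspace_S2 virasoro_in_S2])
    show "ev T (?e i) (?e j) = ev (fscale (t Branch) vir) (?e i) (?e j)" if "i \<in> nodes" "j \<in> nodes" for i j
      using that ev[OF that] all[of i] by (simp add: ev_linear ev_virasoro bform_simple)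
  qed
  then show ?thesis by blast
qed

section \<open>The span of the canonical basis\<close>

abbreviation can :: "(vertex \<times> vertex \<Rightarrow> 'F::field_char_0) set" where
  "can \<equiv> canonical_basis a b c"

lemma canonical_simple_orthogonal:
  fixes v :: "vertex \<Rightarrow> 'F::field_char_0"
  assumes i: "i \<in> nodes" and v: "v \<in> refl_space a b c" "B (simple_root i) v = 0"
  shows "sym_prod (simple_root i) v \<in> fs.span can"
proof (rule fs.span_induct[OF elem_span_orthogonal[OF i v]])
  show "fs.subspace {x :: vertex \<Rightarrow> 'F. sym_prod (simple_root i) x \<in> fs.span can}"
    unfolding fs.subspace_def mem_Collect_eq sym_prod_right
    using fs.span_add fs.span_scale fs.span_zero by blast
  show "sym_prod (simple_root i) x \<in> fs.span can" if "x \<in> {\<beta>. elementary a b c i \<beta>}"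
    for x :: "vertex \<Rightarrow> 'F"
    using that i by (intro fs.span_base) (auto simp: canonical_basis_def)
qed

text \<open>
  Modulo the span of the canonical basis, the squares of two adjacent simple roots are both \<open>-2\<close>
  times the product of these roots. As the diagram is connected, the quotient of the symmetric
  square by that span is generated by the square of one simple root.
\<close>

lemma canonical_square_difference:
  assumes i: "i \<in> nodes" and j: "j \<in> nodes" and ij: "adj i j"
  shows "sym_prod (simple_root i) (simple_root i) - sym_prod (simple_root j) (simple_root j)
    \<in> fs.span (can :: (vertex \<times> vertex \<Rightarrow> 'F::field_char_0) set)"
proof -
  let ?e = "simple_root :: vertex \<Rightarrow> vertex \<Rightarrow> 'F"
  have c: "cartan i j = - 1" "cartan j i = - 1" using ij cartan_adj adj_commute by blast+
  have half: "sym_prod (?e k) (?e l + fscale (1 / 2) (?e k)) \<in> fs.span can"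
    if "k \<in> nodes" "l \<in> nodes" "cartan k l = - 1" for k l
    using that
    by (intro canonical_simple_orthogonal fs.subspace_add[OF subspace_refl_space]
        fs.subspace_scale[OF subspace_refl_space])
      (simp_all only: B_right, simp_all add: bform_simple)
  have "fscale 2 (sym_prod (?e i) (?e j + fscale (1 / 2) (?e i))
      - sym_prod (?e j) (?e i + fscale (1 / 2) (?e j))) \<in> fs.span can"
    using half[OF i j c(1)] half[OF j i c(2)] by (intro fs.span_scale fs.span_diff)
  also have "fscale 2 (sym_prod (?e i) (?e j + fscale (1 / 2) (?e i))
      - sym_prod (?e j) (?e i + fscale (1 / 2) (?e j)))
      = sym_prod (?e i) (?e i) - sym_prod (?e j) (?e j)"
    by (auto simp: fun_eq_iff sym_prod_apply algebra_simps)
  finally show ?thesis .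
qed

lemma S2_span_canonical:
  fixes T :: "vertex \<times> vertex \<Rightarrow> 'F::field_char_0"
  assumes T: "T \<in> S2"
  shows "T \<in> fs.span (insert (sym_prod (simple_root Branch) (simple_root Branch)) can)"
proof -
  let ?e = "simple_root :: vertex \<Rightarrow> vertex \<Rightarrow> 'F"
  define q where "q = sym_prod (?e Branch) (?e Branch)"
  define M where "M = fs.span (insert q can)"
  have canM: "fs.span can \<subseteq> M" unfolding M_def by (intro fs.span_mono) blast
  have qM: "q \<in> M" unfolding M_def by (intro fs.span_base) simp
  have step: "sym_prod (?e i) (?e i) \<in> M"
    if "i \<in> nodes" "j \<in> nodes" "adj i j" "sym_prod (?e j) (?e j) \<in> M" for i j
  proof -
    have "(sym_prod (?e i) (?e i) - sym_prod (?e j) (?e j)) + sym_prod (?e j) (?e j) \<in> M"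
      using canonical_square_difference[OF that(1-3)] canM that(4)
      unfolding M_def by (intro fs.span_add) auto
    then show ?thesis by (simp only: diff_add_cancel)
  qed
  have leg: "sym_prod (?e (Leg l d)) (?e (Leg l d)) \<in> M" if "d < len l" for l d
    using that
  proof (induction d)
    case 0
    show ?case by (rule step[of _ Branch]) (use 0 qM in \<open>simp_all add: q_def\<close>)
  next
    case (Suc d)
    show ?case by (rule step[of _ "Leg l d"]) (use Suc in simp_all)
  qed
  have square: "sym_prod (?e i) (?e i) \<in> M" if "i \<in> nodes" for i
    using that leg qM by (cases i) (auto simp: q_def)
  have simple: "sym_prod v (?e i) \<in> M" if i: "i \<in> nodes" and v: "v \<in> refl_space a b c" for i v
  proof -
    define t where "t = B (?e i) v / 2"
    have "sym_prod (?e i) (v - fscale t (?e i)) \<in> M"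
      using canM i v
      by (intro subsetD[OF canM] canonical_simple_orthogonal fs.subspace_diff[OF subspace_refl_space]
          fs.subspace_scale[OF subspace_refl_space])
        (simp_all only: B_right, simp_all add: bform_simple t_def)
    moreover have "fscale t (sym_prod (?e i) (?e i)) \<in> M"
      using square[OF i] unfolding M_def by (rule fs.span_scale)
    ultimately have "sym_prod (?e i) (v - fscale t (?e i)) + fscale t (sym_prod (?e i) (?e i)) \<in> M"
      unfolding M_def by (rule fs.span_add)
    then show ?thesis unfolding sym_prod_right diff_add_cancel by (simp only: sym_prod_commute)
  qed
  have prod: "sym_prod v u \<in> M" if u: "u \<in> refl_space a b c" and v: "v \<in> refl_space a b c" for u v
  proof (rule fs.span_induct[OF u[unfolded refl_space_span]])
    show "fs.subspace {x. sym_prod v x \<in> M}"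
      unfolding fs.subspace_def mem_Collect_eq sym_prod_right M_def
      using fs.span_add fs.span_scale fs.span_zero by blast
    show "sym_prod v x \<in> M" if "x \<in> simple_root ` nodes" for x
      using that simple v by blast
  qed
  have "S2 \<subseteq> M"
    unfolding sym_square_def M_def
    by (rule fs.span_minimal[OF _ fs.subspace_span]) (use prod M_def in auto)
  then show ?thesis using T by (auto simp: M_def q_def)
qed

section \<open>Real 2-roots and their orbits\<close>

abbreviation two_roots :: "(vertex \<times> vertex \<Rightarrow> 'F::field_char_0) set" where
  "two_roots \<equiv> real_2roots a b c"

abbreviation orb :: "(vertex \<times> vertex \<Rightarrow> 'F::field_char_0) \<Rightarrow> (vertex \<times> vertex \<Rightarrow> 'F) set" where
  "orb \<equiv> orbit (weyl_group a b c) (diag_act a b c)"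

abbreviation Orb :: "(vertex \<times> vertex \<Rightarrow> 'F::field_char_0) set set" where
  "Orb \<equiv> orbits (weyl_group a b c) two_roots (diag_act a b c)"

lemma orb_words: "orb x = {tact u x | u. u \<in> lists nodes}"
  unfolding orbit_def by (blast intro: weyl_carrierI elim: weyl_carrierE)

lemma submodule_iff:
  "submodule a b c U \<longleftrightarrow> fs.subspace U \<and> U \<subseteq> S2 \<and> (\<forall>u\<in>lists nodes. \<forall>T\<in>U. tact u T \<in> U)"
proof -
  have "(\<forall>w\<in>carrier (weyl_group a b c). P w) \<longleftrightarrow> (\<forall>u\<in>lists nodes. P (word_rel a b c `` {u}))" for P
  proof
    assume "\<forall>w\<in>carrier (weyl_group a b c). P w"
    then show "\<forall>u\<in>lists nodes. P (word_rel a b c `` {u})" using weyl_carrierI by blast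
  next
    assume P: "\<forall>u\<in>lists nodes. P (word_rel a b c `` {u})"
    show "\<forall>w\<in>carrier (weyl_group a b c). P w"
    proof
      fix w assume "w \<in> carrier (weyl_group a b c)"
      then obtain u where "u \<in> lists nodes" "w = word_rel a b c `` {u}" by (rule weyl_carrierE)
      then show "P w" using P by simp
    qed
  qed
  then show ?thesis by (simp only: submodule_def)
qed

lemma two_root_in_S2: "x \<in> two_roots \<Longrightarrow> x \<in> S2"
  by (auto simp: real_2roots_def intro!: sym_prod_in_S2 real_root_in_refl_space)

lemma two_root_trace: "x \<in> two_roots \<Longrightarrow> trace x = 0"
  by (auto simp: real_2roots_def trace_sym_prod)

lemma two_root_nonzero:
  fixes x :: "vertex \<times> vertex \<Rightarrow> 'F::field_char_0"
  assumes "x \<in> two_roots"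
  shows "x \<noteq> 0"
proof
  assume "x = 0"
  obtain \<alpha> \<beta> where ab: "x = sym_prod \<alpha> \<beta>" "\<alpha> \<in> real_roots a b c" "\<beta> \<in> real_roots a b c" "B \<alpha> \<beta> = 0"
    using assms by (auto simp: real_2roots_def)
  have "ev x \<alpha> \<beta> = 4"
    using ab by (simp add: ev_sym_prod real_root_norm B_sym[of \<beta> \<alpha>])
  then show False using \<open>x = 0\<close> by (simp add: ev_linear)
qed

lemma two_root_tact:
  assumes "u \<in> lists nodes" "x \<in> two_roots"
  shows "tact u x \<in> two_roots"
proof -
  obtain \<alpha> \<beta> where ab: "x = sym_prod \<alpha> \<beta>" "\<alpha> \<in> real_roots a b c" "\<beta> \<in> real_roots a b c" "B \<alpha> \<beta> = 0"
    using assms(2) by (auto simp: real_2roots_def)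
  have "tact u x = sym_prod (act u \<alpha>) (act u \<beta>)"
    unfolding ab(1) using ab(2,3) by (intro tact_sym_prod assms(1) real_root_in_refl_space)
  moreover have "act u \<alpha> \<in> real_roots a b c" "act u \<beta> \<in> real_roots a b c" "B (act u \<alpha>) (act u \<beta>) = 0"
    using real_root_act[OF assms(1) ab(2)] real_root_act[OF assms(1) ab(3)]
      act_form[OF assms(1), of \<alpha> \<beta>] ab(4) by simp_all
  ultimately show ?thesis unfolding real_2roots_def by blast
qed

lemma two_root_simple:
  fixes x :: "vertex \<times> vertex \<Rightarrow> 'F::field_char_0"
  assumes "x \<in> two_roots"
  shows "\<exists>u\<in>lists nodes. \<exists>i\<in>nodes. \<exists>j\<in>nodes.
    cartan i j = 0 \<and> x = tact u (sym_prod (simple_root i) (simple_root j))"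
proof -
  obtain \<alpha> \<beta> where ab: "x = sym_prod \<alpha> \<beta>" "\<alpha> \<in> real_roots a b c" "\<beta> \<in> real_roots a b c" "B \<alpha> \<beta> = 0"
    using assms by (auto simp: real_2roots_def)
  obtain u i j where u: "u \<in> lists nodes" "i \<in> nodes" "j \<in> nodes" "cartan i j = 0"
    "\<alpha> = act u (simple_root i)" "\<beta> = act u (simple_root j)"
    using orthogonal_real_roots_simple[OF ab(2,3,4)] by blast
  have "x = tact u (sym_prod (simple_root i) (simple_root j))"
    using ab(1) u by (simp add: tact_sym_prod)
  then show ?thesis using u by blast
qed

lemma orb_self: "x \<in> S2 \<Longrightarrow> x \<in> orb x"
  unfolding orb_words by (intro CollectI exI[of _ "[]"]) (simp add: tact_Nil)

lemma orb_tact: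
  assumes "x \<in> S2" "u \<in> lists nodes"
  shows "orb (tact u x) = orb x"
proof -
  have sub: "orb (tact u x) \<subseteq> orb x" if "x \<in> S2" "u \<in> lists nodes" for x :: "vertex \<times> vertex \<Rightarrow> 'a" and u
  proof
    fix y assume "y \<in> orb (tact u x)"
    then obtain v where v: "v \<in> lists nodes" "y = tact v (tact u x)" unfolding orb_words by blast
    have "v @ u \<in> lists nodes" using that v by auto
    moreover have "y = tact (v @ u) x" unfolding v(2) by (rule tact_append[OF that(1) v(1) that(2)])
    ultimately show "y \<in> orb x" unfolding orb_words by blast
  qed
  have "rev u \<in> lists nodes" using assms by auto
  then have "orb x \<subseteq> orb (tact u x)"
    using sub[of "tact u x" "rev u"] tact_in_S2[OF assms] tact_rev[OF assms] by simp
  then show ?thesis using sub[OF assms] by blast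
qed

lemma OrbE:
  assumes "X \<in> Orb" "x \<in> X"
  shows "x \<in> two_roots" "X = orb x"
proof -
  obtain y where y: "y \<in> two_roots" "X = orb y" using assms(1) by (auto simp: orbits_def)
  then obtain u where u: "u \<in> lists nodes" "x = tact u y" using assms(2) unfolding orb_words by blast
  show "x \<in> two_roots" using two_root_tact u y by blast
  show "X = orb x" using orb_tact[OF two_root_in_S2[OF y(1)] u(1)] u y by simp
qed

lemma orb_in_Orb: "x \<in> two_roots \<Longrightarrow> orb x \<in> Orb"
  by (auto simp: orbits_def)

lemma canonical_two_root: "can \<subseteq> two_roots"
  using elementary_orthogonal simple_root_real unfolding canonical_basis_def real_2roots_def by blast

lemma canonical_span_S2: "fs.span can \<subseteq> (S2 :: (vertex \<times> vertex \<Rightarrow> 'F::field_char_0) set)"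
  using canonical_two_root two_root_in_S2 by (intro fs.span_minimal[OF _ subspace_S2]) blast

lemma trace_span:
  assumes "T \<in> fs.span A" "\<And>x. x \<in> A \<Longrightarrow> trace x = 0"
  shows "trace T = 0"
  by (rule fs.span_induct[OF assms(1)]) (simp_all add: fs.subspace_def trace_linear assms(2))

text \<open>The remaining generator of the symmetric square, the square at the branch vertex, has nonzero
  trace.\<close>

lemma trace_zero_canonical:
  fixes T :: "vertex \<times> vertex \<Rightarrow> 'F::field_char_0"
  assumes "T \<in> S2" "trace T = 0"
  shows "T \<in> fs.span can"
proof -
  let ?q = "sym_prod (simple_root Branch) (simple_root Branch) :: vertex \<times> vertex \<Rightarrow> 'F"
  obtain k where k: "T - fscale k ?q \<in> fs.span can"
    using S2_span_canonical[OF assms(1)] unfolding fs.span_breakdown_eq by blast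
  have "trace (T - fscale k ?q) = 0"
    using k by (rule trace_span) (use canonical_two_root two_root_trace in blast)
  then have "k = 0" using assms(2) by (simp add: trace_linear trace_sym_prod bform_simple)
  then have "T - fscale k ?q = T" by (simp add: fun_eq_iff)
  then show ?thesis using k by (simp only:)
qed

lemma linked_same_orb:
  assumes "linked i j k l" "i \<in> nodes" "j \<in> nodes"
  shows "orb (sym_prod (simple_root i) (simple_root j)) =
    (orb (sym_prod (simple_root k) (simple_root l)) :: (vertex \<times> vertex \<Rightarrow> 'F::field_char_0) set)"
proof -
  let ?e = "simple_root :: vertex \<Rightarrow> vertex \<Rightarrow> 'F"
  obtain u where u: "u \<in> lists nodes"
    "(word_int u (unit_int i) = unit_int k \<and> word_int u (unit_int j) = unit_int l) \<or>
     (word_int u (unit_int i) = unit_int l \<and> word_int u (unit_int j) = unit_int k)"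
    using assms(1) unfolding linked_def by blast
  from u(2) have "(act u (?e i) = ?e k \<and> act u (?e j) = ?e l) \<or> (act u (?e i) = ?e l \<and> act u (?e j) = ?e k)"
    unfolding emb_unit[symmetric] act_emb[OF u(1)] emb_eq_iff .
  then have "tact u (sym_prod (?e i) (?e j)) = sym_prod (?e k) (?e l)"
    using tact_sym_prod[OF u(1), of "?e i" "?e j"] assms(2,3) sym_prod_commute[of "?e l" "?e k"] by auto
  then show ?thesis
    using orb_tact[OF sym_prod_in_S2 u(1), of "?e i" "?e j"] assms(2,3) by simp
qed

lemma ev_simple_pair_swap:
  assumes "u \<in> lists nodes" "i \<in> nodes" "j \<in> nodes" "k \<in> nodes" "l \<in> nodes"
  shows "ev (tact u (sym_prod (simple_root i) (simple_root j))) (simple_root k) (simple_root l)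
    = (ev (tact (rev u) (sym_prod (simple_root k) (simple_root l))) (simple_root i) (simple_root j)
      :: 'F::field_char_0)"
proof -
  have ru: "rev u \<in> lists nodes" using assms by auto
  have "B (act u p) q = B (act (rev u) q) p" for p q :: "vertex \<Rightarrow> 'F"
    using act_form[OF assms(1), of p "act (rev u) q"] act_rev(2)[OF assms(1), of q]
      B_sym[of p "act (rev u) q"] by simp
  then show ?thesis
    using assms ru by (simp add: tact_sym_prod ev_sym_prod mult.commute)
qed

text \<open>
  After conjugation both 2-roots come from pairs of simple roots. Pairs that are not twin leaves
  all belong to one orbit, so at least one of two distinct orbits comes from twin leaves.
\<close>

lemma distinct_orbits_orthogonal:
  fixes x :: "vertex \<times> vertex \<Rightarrow> 'F::field_char_0"
  assumes X: "X \<in> Orb" "x \<in> X" and X': "X' \<in> Orb" "sym_prod \<gamma> \<delta> \<in> X'" and ne: "X \<noteq> X'"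
    and roots: "\<gamma> \<in> real_roots a b c" "\<delta> \<in> real_roots a b c" "B \<gamma> \<delta> = 0"
  shows "ev x \<gamma> \<delta> = 0"
proof -
  let ?e = "simple_root :: vertex \<Rightarrow> vertex \<Rightarrow> 'F"
  obtain u i j where u: "u \<in> lists nodes" "i \<in> nodes" "j \<in> nodes" "cartan i j = 0"
    "x = tact u (sym_prod (?e i) (?e j))"
    using two_root_simple[OF OrbE(1)[OF X]] by blast
  obtain w k l where w: "w \<in> lists nodes" "k \<in> nodes" "l \<in> nodes" "cartan k l = 0"
    "\<gamma> = act w (?e k)" "\<delta> = act w (?e l)"
    using orthogonal_real_roots_simple[OF roots] by blast
  define p where "p = rev w @ u"
  have rw: "rev w \<in> lists nodes" and p: "p \<in> lists nodes" and rp: "rev p \<in> lists nodes"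
    using u w by (auto simp: p_def)
  have inS: "sym_prod (?e i) (?e j) \<in> S2" "sym_prod (?e k) (?e l) \<in> S2"
    using u w by (auto intro: sym_prod_in_S2)
  have Xi: "X = orb (sym_prod (?e i) (?e j))"
    using OrbE(2)[OF X] orb_tact[OF inS(1) u(1)] u by simp
  have "sym_prod \<gamma> \<delta> = tact w (sym_prod (?e k) (?e l))" using w by (simp add: tact_sym_prod)
  then have Xk: "X' = orb (sym_prod (?e k) (?e l))"
    using OrbE(2)[OF X'] orb_tact[OF inS(2) w(1)] by simp
  have "ev x \<gamma> \<delta> = ev (tact (rev w) x) (act (rev w) \<gamma>) (act (rev w) \<delta>)"
    using ev_tact[OF _ rw, of x] two_root_in_S2[OF OrbE(1)[OF X]] by simp
  also have "\<dots> = ev (tact p (sym_prod (?e i) (?e j))) (?e k) (?e l)"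
    unfolding w(5,6) act_rev(1)[OF w(1)] u(5) p_def tact_append[OF inS(1) rw u(1)] ..
  finally have ev: "ev x \<gamma> \<delta> = ev (tact p (sym_prod (?e i) (?e j))) (?e k) (?e l)" .
  have sets: "{k, l} \<noteq> {i, j}"
  proof
    assume "{k, l} = {i, j}"
    then have "sym_prod (?e k) (?e l) = sym_prod (?e i) (?e j)"
      using sym_prod_commute by (auto simp: doubleton_eq_iff)
    then show False using Xi Xk ne by simp
  qed
  consider "twin i j" | "twin k l" | "\<not> twin i j" "\<not> twin k l" by blast
  then show ?thesis
  proof cases
    case 1
    then show ?thesis unfolding ev by (rule twin_orthogonal[OF _ w(2-4) sets p])
  next
    case 2
    then show ?thesis
      unfolding ev ev_simple_pair_swap[OF p u(2,3) w(2,3)]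
      by (rule twin_orthogonal[OF _ u(2-4) sets[symmetric] rp])
  next
    case 3
    then have "linked i j k l" using not_twin_linked u w by blast
    then show ?thesis using linked_same_orb[of i j k l] u Xi Xk ne by blast
  qed
qed

text \<open>
  A tensor in both spans is orthogonal to all products \<open>\<alpha>\<^sub>k \<or> \<gamma>\<close> with \<open>\<gamma>\<close> elementary, whichever
  orbit such a product belongs to. As the elementary roots span \<open>\<alpha>\<^sub>k\<^sup>\<bottom>\<close>, it is a multiple of the
  Virasoro element, and its trace is zero.
\<close>

lemma orbit_spans_independent:
  fixes T :: "vertex \<times> vertex \<Rightarrow> 'F::field_char_0"
  assumes X: "X \<in> Orb" and T: "T \<in> fs.span X" "T \<in> fs.span (\<Union>(Orb - {X}))"
  shows "T = 0"
proof -
  have XS: "fs.span X \<subseteq> S2"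
    using OrbE(1)[OF X] two_root_in_S2 by (intro fs.span_minimal[OF _ subspace_S2]) blast
  have TS: "T \<in> S2" using XS T by blast
  have tr: "trace T = 0"
    using T(1) by (rule trace_span) (use OrbE(1)[OF X] two_root_trace in blast)
  have ev_span: "ev T p q = 0" if "T \<in> fs.span A" "\<And>x. x \<in> A \<Longrightarrow> ev x p q = 0" for A p q
    by (rule fs.span_induct[OF that(1)]) (simp_all add: fs.subspace_def ev_linear that(2))
  have elem: "ev T (simple_root k) \<gamma> = 0" if k: "k \<in> nodes" and \<gamma>: "elementary a b c k \<gamma>" for k \<gamma>
  proof -
    note g = elementary_orthogonal[OF k \<gamma>]
    have s: "simple_root k \<in> (real_roots a b c :: (vertex \<Rightarrow> 'F) set)" by (rule simple_root_real[OF k])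
    define r where "r = sym_prod (simple_root k) \<gamma>"
    have r2: "r \<in> two_roots" using g s by (auto simp: real_2roots_def r_def)
    then have r: "orb r \<in> Orb" "r \<in> orb r" using orb_in_Orb orb_self two_root_in_S2 by blast+
    show ?thesis
    proof (cases "orb r = X")
      case False
      show ?thesis
        by (rule ev_span[OF T(1)])
          (rule distinct_orbits_orthogonal[OF X _ r[unfolded r_def] _ s g], use False r_def in auto)
    next
      case True
      show ?thesis
      proof (rule ev_span[OF T(2)])
        fix x assume "x \<in> \<Union>(Orb - {X})"
        then obtain X' where "X' \<in> Orb" "x \<in> X'" "X' \<noteq> X" by blast
        then show "ev x (simple_root k) \<gamma> = 0"
          using distinct_orbits_orthogonal[OF _ _ r[unfolded r_def] _ s g] True r_def by blast
      qed
    qed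
  qed
  have "\<exists>t. T = fscale t vir"
  proof (rule scalar_tensor[OF TS])
    fix k and u :: "vertex \<Rightarrow> 'F"
    assume k: "k \<in> nodes" and u: "u \<in> refl_space a b c" "B (simple_root k) u = 0"
    show "ev T (simple_root k) u = 0"
      by (rule fs.span_induct[OF elem_span_orthogonal[OF k u]])
        (use elem[OF k] in \<open>simp_all add: fs.subspace_def ev_right\<close>)
  qed
  then obtain t where t: "T = fscale t vir" by blast
  then have "t = 0" using tr trace_virasoro_nonzero[where 'F = 'F] by (simp add: trace_linear)
  then show ?thesis using t by (simp add: fun_eq_iff)
qed

text \<open>
  Expand an element of \<open>X\<close> in the canonical basis. The part outside \<open>X\<close> lies in the span of the
  other orbits; being a difference of elements of the span of \<open>X\<close>, it is zero.
\<close>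

lemma canonical_span_orbit:
  assumes X: "X \<in> (Orb :: (vertex \<times> vertex \<Rightarrow> 'F::field_char_0) set set)"
  shows "fs.span (can \<inter> X) = fs.span X"
proof
  show "fs.span (can \<inter> X) \<subseteq> fs.span X" by (intro fs.span_mono) blast
  have "x \<in> fs.span (can \<inter> X)" if x: "x \<in> X" for x
  proof -
    have x2: "x \<in> two_roots" by (rule OrbE(1)[OF X x])
    have "x \<in> fs.span can" using x2 two_root_in_S2 two_root_trace by (intro trace_zero_canonical) auto
    also have "can = (can \<inter> X) \<union> (can - X)" by blast
    finally obtain m r where mr: "m \<in> fs.span (can \<inter> X)" "r \<in> fs.span (can - X)" "x = m + r"
      unfolding fs.span_Un by blast
    have "can - X \<subseteq> \<Union>(Orb - {X})"
    proof
      fix y assume y: "y \<in> can - X"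
      then have "y \<in> two_roots" using canonical_two_root by blast
      then have "orb y \<in> Orb" "y \<in> orb y" using orb_in_Orb orb_self two_root_in_S2 by blast+
      then show "y \<in> \<Union>(Orb - {X})" using y by blast
    qed
    then have "r \<in> fs.span (\<Union>(Orb - {X}))" using mr(2) fs.span_mono by blast
    moreover have "r \<in> fs.span X"
    proof -
      have "m \<in> fs.span X" using mr(1) fs.span_mono[of "can \<inter> X" X] by blast
      then have "x - m \<in> fs.span X" using fs.span_diff fs.span_base[OF x] by blast
      then show ?thesis using mr(3) by (simp only: add_diff_cancel_left')
    qed
    ultimately have "r = 0" using orbit_spans_independent[OF X] by blast
    then show ?thesis using mr by (simp only: add_0_right)
  qed
  then show "fs.span X \<subseteq> fs.span (can \<inter> X)"
    by (intro fs.span_minimal[OF _ fs.subspace_span]) blast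
qed

section \<open>Irreducibility\<close>

text \<open>
  Since \<open>T\<close> is not a multiple of the Virasoro element, some difference \<open>T - s\<^sub>k T\<close> is a product
  \<open>\<alpha>\<^sub>k \<or> v\<close> with \<open>v\<close> a nonzero vector orthogonal to \<open>\<alpha>\<^sub>k\<close>. Some elementary root \<open>\<gamma>\<close> is not
  orthogonal to \<open>v\<close>, and its reflection, which fixes \<open>\<alpha>\<^sub>k\<close>, changes the product by a multiple of
  \<open>\<alpha>\<^sub>k \<or> \<gamma>\<close>.
\<close>

lemma submodule_contains_two_root:
  fixes T :: "vertex \<times> vertex \<Rightarrow> 'F::field_char_0"
  assumes U: "submodule a b c U" and T: "T \<in> U" "trace T = 0" "T \<noteq> 0"
  shows "\<exists>r\<in>U. r \<in> two_roots"
proof -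
  have sub: "fs.subspace U" "U \<subseteq> S2" "\<And>u T. u \<in> lists nodes \<Longrightarrow> T \<in> U \<Longrightarrow> tact u T \<in> U"
    using U unfolding submodule_iff by blast+
  have TS: "T \<in> S2" using sub T by blast
  have "\<not> (\<exists>t. T = fscale t vir)"
  proof
    assume "\<exists>t. T = fscale t vir"
    then obtain t where t: "T = fscale t vir" by blast
    then have "t = 0" using T(2) trace_virasoro_nonzero[where 'F = 'F] by (simp add: trace_linear)
    then show False using t T(3) by (simp add: fun_eq_iff)
  qed
  then obtain k u where k: "k \<in> nodes" and u: "u \<in> refl_space a b c" "B (simple_root k) u = 0"
    "ev T (simple_root k) u \<noteq> 0"
    using scalar_tensor[OF TS] by blast
  obtain v where v: "v \<in> refl_space a b c" "B (simple_root k) v = 0"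
    "T - tact [k] T = sym_prod (simple_root k) v"
    "\<And>u. B (simple_root k) u = 0 \<Longrightarrow> B v u = ev T (simple_root k) u"
    using reflection_difference[OF TS k] by blast
  have kl: "[k] \<in> lists nodes" using k by simp
  have kvU: "sym_prod (simple_root k) v \<in> U"
    using fs.subspace_diff[OF sub(1) T(1) sub(3)[OF kl T(1)]] v(3) by simp
  have "\<exists>\<gamma>. elementary a b c k \<gamma> \<and> B v \<gamma> \<noteq> 0"
  proof (rule ccontr)
    assume none: "\<not> ?thesis"
    have "B v u = 0"
      by (rule fs.span_induct[OF elem_span_orthogonal[OF k u(1,2)]])
        (use none in \<open>auto simp: fs.subspace_def B_right\<close>)
    then show False using v(4)[OF u(2)] u(3) by simp
  qed
  then obtain \<gamma> where \<gamma>: "elementary a b c k \<gamma>" "B v \<gamma> \<noteq> 0" by blast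
  note g = elementary_orthogonal[OF k \<gamma>(1)]
  have s: "simple_root k \<in> (real_roots a b c :: (vertex \<Rightarrow> 'F) set)" by (rule simple_root_real[OF k])
  define r where "r = sym_prod (simple_root k) \<gamma>"
  have r2: "r \<in> two_roots" using g s by (auto simp: real_2roots_def r_def)
  obtain h where h: "h \<in> lists nodes" "\<And>x. act h x = x - fscale (B \<gamma> x) \<gamma>"
    using real_root_reflection[OF g(1)] by blast
  have "B \<gamma> (simple_root k) = 0" using g(2) B_sym[of \<gamma> "simple_root k"] by simp
  then have "act h (simple_root k) = (simple_root k :: vertex \<Rightarrow> 'F)" unfolding h(2) by (simp add: fun_eq_iff)
  then have "tact h (sym_prod (simple_root k) v) = sym_prod (simple_root k) v - fscale (B \<gamma> v) r"
    using tact_sym_prod[OF h(1) simple_root_in_refl_space[OF k] v(1)] unfolding h(2)[of v] r_def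
    by (simp only: sym_prod_right)
  then have "fscale (B \<gamma> v) r = sym_prod (simple_root k) v - tact h (sym_prod (simple_root k) v)"
    by (simp add: fun_eq_iff)
  also have "\<dots> \<in> U" using fs.subspace_diff[OF sub(1) kvU sub(3)[OF h(1) kvU]] .
  finally have "fscale (1 / B \<gamma> v) (fscale (B \<gamma> v) r) \<in> U" by (rule fs.subspace_scale[OF sub(1)])
  moreover have "fscale (1 / B \<gamma> v) (fscale (B \<gamma> v) r) = r"
    using \<gamma>(2) B_sym[of \<gamma> v] by (simp add: fun_eq_iff)
  ultimately show ?thesis using r2 by auto
qed

lemma orbit_span_submodule:
  assumes X: "X \<in> (Orb :: (vertex \<times> vertex \<Rightarrow> 'F::field_char_0) set set)"
  shows "submodule a b c (fs.span X)"
  unfolding submodule_iff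
proof (intro conjI ballI)
  show "fs.subspace (fs.span X)" by (rule fs.subspace_span)
  show "fs.span X \<subseteq> S2"
    using OrbE(1)[OF X] two_root_in_S2 by (intro fs.span_minimal[OF _ subspace_S2]) blast
  fix u T assume u: "u \<in> lists nodes" and T: "T \<in> fs.span X"
  have tX: "tact u x \<in> X" if "x \<in> X" for x
    using OrbE(2)[OF X that] u unfolding orb_words by blast
  show "tact u T \<in> fs.span X"
  proof (rule fs.span_induct[OF T])
    show "fs.subspace {x. tact u x \<in> fs.span X}"
      unfolding fs.subspace_def mem_Collect_eq tact_linear
      using fs.span_add fs.span_scale fs.span_zero by blast
  qed (use tX fs.span_base in blast)
qed

lemma orbit_span_irreducible:
  assumes X: "X \<in> (Orb :: (vertex \<times> vertex \<Rightarrow> 'F::field_char_0) set set)"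
  shows "irreducible_submodule a b c (fs.span X)"
  unfolding irreducible_submodule_def
proof (intro conjI allI impI)
  show "submodule a b c (fs.span X)" by (rule orbit_span_submodule[OF X])
  obtain x where x: "x \<in> X"
  proof -
    obtain y where "y \<in> two_roots" "X = orb y" using X by (auto simp: orbits_def)
    then show thesis using that[of y] orb_self[OF two_root_in_S2[of y]] by simp
  qed
  show "fs.span X \<noteq> {0}"
    using two_root_nonzero[OF OrbE(1)[OF X x]] fs.span_base[OF x] by blast
  fix U assume U: "submodule a b c U \<and> U \<subseteq> fs.span X"
  have sub: "fs.subspace U" "\<And>u T. u \<in> lists nodes \<Longrightarrow> T \<in> U \<Longrightarrow> tact u T \<in> U"
    using U unfolding submodule_iff by blast+
  show "U = {0} \<or> U = fs.span X"
  proof (cases "U = {0}")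
    case False
    then obtain T where T: "T \<in> U" "T \<noteq> 0" using fs.subspace_0[OF sub(1)] by blast
    have "trace T = 0"
    proof (rule trace_span)
      show "T \<in> fs.span X" using T U by blast
    qed (use OrbE(1)[OF X] two_root_trace in blast)
    then obtain r where r: "r \<in> U" "r \<in> two_roots"
      using submodule_contains_two_root[of U T] T U by blast
    have "orb r = X"
    proof (rule ccontr)
      assume "orb r \<noteq> X"
      then have "r \<in> \<Union>(Orb - {X})" using orb_in_Orb[OF r(2)] orb_self[OF two_root_in_S2[OF r(2)]] by blast
      then have "r \<in> fs.span (\<Union>(Orb - {X}))" by (rule fs.span_base)
      moreover have "r \<in> fs.span X" using r(1) U by blast
      ultimately have "r = 0" using orbit_spans_independent[OF X] by blast
      then show False using two_root_nonzero[OF r(2)] by blast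
    qed
    then have "X \<subseteq> U" using sub(2) r(1) unfolding orb_words by blast
    then have "fs.span X \<subseteq> U" using sub(1) by (rule fs.span_minimal)
    then show ?thesis using U by blast
  qed simp
qed

lemma virasoro_span:
  "fs.span {vir :: vertex \<times> vertex \<Rightarrow> 'F::field_char_0} = range (\<lambda>t. fscale t vir)"
  by (rule fs.span_singleton)

lemma virasoro_nonzero: "vir \<noteq> (0 :: vertex \<times> vertex \<Rightarrow> 'F::field_char_0)"
  using trace_virasoro_nonzero[where 'F = 'F] trace_linear(4) by metis

lemma virasoro_irreducible:
  "irreducible_submodule a b c (fs.span {vir :: vertex \<times> vertex \<Rightarrow> 'F::field_char_0})"
  unfolding irreducible_submodule_def
proof (intro conjI allI impI)
  show "submodule a b c (fs.span {vir :: vertex \<times> vertex \<Rightarrow> 'F})"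
    unfolding submodule_iff
  proof (intro conjI ballI)
    show "fs.subspace (fs.span {vir :: vertex \<times> vertex \<Rightarrow> 'F})" by (rule fs.subspace_span)
    show "fs.span {vir :: vertex \<times> vertex \<Rightarrow> 'F} \<subseteq> S2"
      using virasoro_in_S2 by (intro fs.span_minimal[OF _ subspace_S2]) blast
    fix u and T :: "vertex \<times> vertex \<Rightarrow> 'F" assume u: "u \<in> lists nodes" and "T \<in> fs.span {vir}"
    then obtain t where "T = fscale t vir" unfolding virasoro_span by blast
    then have "tact u T = fscale t vir" by (simp only: tact_linear(2) tact_virasoro[OF u])
    then show "tact u T \<in> fs.span {vir}" unfolding virasoro_span by blast
  qed
  show "fs.span {vir :: vertex \<times> vertex \<Rightarrow> 'F} \<noteq> {0}"
    using virasoro_nonzero[where 'F = 'F] fs.span_base[of vir "{vir}"] by blast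
  fix U :: "(vertex \<times> vertex \<Rightarrow> 'F) set" assume U: "submodule a b c U \<and> U \<subseteq> fs.span {vir}"
  have sub: "fs.subspace U" using U unfolding submodule_iff by blast
  show "U = {0} \<or> U = fs.span {vir}"
  proof (cases "U = {0}")
    case False
    then obtain T where T: "T \<in> U" "T \<noteq> 0" using fs.subspace_0[OF sub] by blast
    then obtain t where t: "T = fscale t vir" using U unfolding virasoro_span by blast
    then have "t \<noteq> 0" using T(2) by (auto simp: fun_eq_iff)
    then have "fscale (1 / t) T = vir" using t by (simp add: fun_eq_iff)
    then have "vir \<in> U" using fs.subspace_scale[OF sub T(1), of "1 / t"] by simp
    then have "fs.span {vir} \<subseteq> U" using sub by (intro fs.span_minimal) blast
    then show ?thesis using U by blast
  qed simp
qed

lemma virasoro_dim: "fs.dim (fs.span {vir :: vertex \<times> vertex \<Rightarrow> 'F::field_char_0}) = 1"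
proof -
  have "fs.independent {vir :: vertex \<times> vertex \<Rightarrow> 'F}"
    using virasoro_nonzero by (simp add: fs.independent_insert)
  then have "fs.dim (fs.span {vir :: vertex \<times> vertex \<Rightarrow> 'F}) = card {vir :: vertex \<times> vertex \<Rightarrow> 'F}"
    by (rule fs.dim_span_eq_card_independent)
  then show ?thesis by simp
qed

section \<open>The decomposition\<close>

definition summand :: "(vertex \<times> vertex \<Rightarrow> 'F::field_char_0) set option \<Rightarrow> (vertex \<times> vertex \<Rightarrow> 'F) set" where
  "summand k = (case k of None \<Rightarrow> fs.span {vir} | Some X \<Rightarrow> fs.span (can \<inter> X))"

text \<open>The trace separates the Virasoro element from the orbit spans, which fill its kernel and are
  independent of each other.\<close>

lemma decomposition:
  "internal_direct_sum (S2 :: (vertex \<times> vertex \<Rightarrow> 'F::field_char_0) set) (insert None (Some ` Orb)) summand"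
proof -
  let ?K = "insert None (Some ` (Orb :: (vertex \<times> vertex \<Rightarrow> 'F) set set))"
  have subsp: "fs.subspace (summand k)" for k :: "(vertex \<times> vertex \<Rightarrow> 'F) set option"
    by (cases k) (simp_all only: summand_def option.case fs.subspace_span)
  have inS2: "summand k \<subseteq> S2" if "k \<in> ?K" for k
  proof (cases k)
    case None
    have "{vir} \<subseteq> (S2 :: (vertex \<times> vertex \<Rightarrow> 'F) set)" using virasoro_in_S2[where 'F = 'F] by simp
    then show ?thesis
      unfolding None summand_def option.case by (rule fs.span_minimal[OF _ subspace_S2])
  next
    case (Some X)
    have "fs.span (can \<inter> X) \<subseteq> fs.span can" by (intro fs.span_mono) blast
    then show ?thesis unfolding Some summand_def option.case using canonical_span_S2 by (rule subset_trans)
  qed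
  have span: "fs.span (\<Union>k\<in>?K. summand k) = S2"
  proof
    show "fs.span (\<Union>k\<in>?K. summand k) \<subseteq> S2"
      using inS2 by (intro fs.span_minimal[OF _ subspace_S2]) blast
    show "S2 \<subseteq> fs.span (\<Union>k\<in>?K. summand k)"
    proof
      fix T :: "vertex \<times> vertex \<Rightarrow> 'F" assume T: "T \<in> S2"
      define t where "t = trace T / trace (vir :: vertex \<times> vertex \<Rightarrow> 'F)"
      have "T - fscale t vir \<in> fs.span can"
      proof (rule trace_zero_canonical)
        show "T - fscale t vir \<in> S2"
          using T virasoro_in_S2 by (intro fs.subspace_diff[OF subspace_S2] fs.subspace_scale[OF subspace_S2])
        show "trace (T - fscale t vir) = 0"
          using trace_virasoro_nonzero[where 'F = 'F] by (simp add: trace_linear t_def)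
      qed
      moreover have "can \<subseteq> (\<Union>k\<in>?K. summand k)"
      proof
        fix y :: "vertex \<times> vertex \<Rightarrow> 'F" assume y: "y \<in> can"
        then have y2: "y \<in> two_roots" using canonical_two_root by blast
        have "y \<in> summand (Some (orb y))"
          using y orb_self[OF two_root_in_S2[OF y2]] by (simp add: summand_def fs.span_base)
        then show "y \<in> (\<Union>k\<in>?K. summand k)" using orb_in_Orb[OF y2] by blast
      qed
      ultimately have 1: "T - fscale t vir \<in> fs.span (\<Union>k\<in>?K. summand k)" using fs.span_mono by blast
      have "vir \<in> summand None" by (simp add: summand_def fs.span_base)
      then have "fscale t vir \<in> fs.span (\<Union>k\<in>?K. summand k)"
        by (intro fs.span_scale fs.span_base) blast
      then have "(T - fscale t vir) + fscale t vir \<in> fs.span (\<Union>k\<in>?K. summand k)"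
        using 1 by (intro fs.span_add)
      then show "T \<in> fs.span (\<Union>k\<in>?K. summand k)" by (simp only: diff_add_cancel)
    qed
  qed
  have tr0: "trace x = 0" if "x \<in> summand (Some X)" for x and X :: "(vertex \<times> vertex \<Rightarrow> 'F) set"
    using that unfolding summand_def option.case
    by (rule trace_span) (use canonical_two_root two_root_trace in blast)
  have indep: "T = 0" if k: "k \<in> ?K" and T: "T \<in> summand k" "T \<in> fs.span (\<Union>l\<in>?K - {k}. summand l)" for k T
  proof (cases k)
    case None
    obtain t where t: "T = fscale t vir" using T(1) None virasoro_span by (auto simp: summand_def)
    have "trace T = 0" by (rule trace_span[OF T(2)]) (use None tr0 in auto)
    then have "t = 0" using t trace_virasoro_nonzero[where 'F = 'F] by (simp add: trace_linear)
    then show ?thesis using t by (simp add: fun_eq_iff)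
  next
    case (Some X)
    then have X: "X \<in> Orb" using k by auto
    have "(\<Union>l\<in>?K - {k}. summand l) \<subseteq> fs.span (\<Union>(Orb - {X})) \<union> fs.span {vir}"
    proof
      fix y assume "y \<in> (\<Union>l\<in>?K - {k}. summand l)"
      then obtain l where l: "l \<in> ?K" "l \<noteq> k" "y \<in> summand l" by blast
      show "y \<in> fs.span (\<Union>(Orb - {X})) \<union> fs.span {vir}"
      proof (cases l)
        case None
        then show ?thesis using l by (simp add: summand_def)
      next
        case s: (Some X')
        have "fs.span (can \<inter> X') \<subseteq> fs.span (\<Union>(Orb - {X}))"
          using l s Some by (intro fs.span_mono) auto
        then show ?thesis using l s by (auto simp: summand_def)
      qed
    qed
    also have "\<dots> \<subseteq> fs.span ({vir} \<union> \<Union>(Orb - {X}))"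
      using fs.span_superset[of "{vir} \<union> \<Union>(Orb - {X})"]
        fs.span_mono[of "\<Union>(Orb - {X})" "{vir} \<union> \<Union>(Orb - {X})"]
        fs.span_mono[of "{vir}" "{vir} \<union> \<Union>(Orb - {X})"] by auto
    finally have "T \<in> fs.span ({vir} \<union> \<Union>(Orb - {X}))"
      using T(2) fs.span_minimal[OF _ fs.subspace_span] by blast
    then obtain v r where vr: "v \<in> fs.span {vir}" "r \<in> fs.span (\<Union>(Orb - {X}))" "T = v + r"
      unfolding fs.span_Un by blast
    have "trace r = 0"
      using vr(2) by (rule trace_span) (use OrbE(1) two_root_trace in blast)
    moreover have "trace T = 0" using T(1) Some tr0 by simp
    moreover obtain t where t: "v = fscale t vir" using vr(1) virasoro_span by auto
    ultimately have "t = 0"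
      using vr(3) trace_virasoro_nonzero[where 'F = 'F] by (simp add: trace_linear)
    then have "T = r" using vr(3) t by (simp add: fun_eq_iff)
    moreover have "T \<in> fs.span X" using T(1) Some canonical_span_orbit[OF X] by (simp add: summand_def)
    ultimately show ?thesis using orbit_spans_independent[OF X] vr(2) by blast
  qed
  have "summand k \<inter> fs.span (\<Union>l\<in>?K - {k}. summand l) = {0}" if "k \<in> ?K" for k
    using indep[OF that] fs.subspace_0[OF subsp] fs.span_zero by blast
  then show ?thesis unfolding internal_direct_sum_def using subsp span by blast
qed

end

theorem theorem7p8:
  fixes a b c :: nat
  assumes "a \<ge> 1" "b \<ge> 1" "c \<ge> 1"
    and "\<not> affine_type a b c"
  shows "internal_direct_sum
           (sym_square a b c :: (vertex \<times> vertex \<Rightarrow> 'F::field_char_0) set)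
           (insert None (Some ` orbits (weyl_group a b c) (real_2roots a b c) (diag_act a b c)))
           (\<lambda>k. case k of None \<Rightarrow> fs.span {virasoro a b c}
                        | Some X \<Rightarrow> fs.span (canonical_basis a b c \<inter> X))
       \<and> fs.dim (fs.span {virasoro a b c :: vertex \<times> vertex \<Rightarrow> 'F}) = 1
       \<and> irreducible_submodule a b c (fs.span {virasoro a b c :: vertex \<times> vertex \<Rightarrow> 'F})
       \<and> (\<forall>X \<in> orbits (weyl_group a b c)
                  (real_2roots a b c :: (vertex \<times> vertex \<Rightarrow> 'F) set) (diag_act a b c).
            irreducible_submodule a b c (fs.span (canonical_basis a b c \<inter> X)))"
proof -
  interpret nonaffine_diagram a b c
    using assms by unfold_locales
  show ?thesis
    using decomposition[where 'F = 'F] virasoro_dim[where 'F = 'F] virasoro_irreducible[where 'F = 'F]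
    unfolding summand_def[abs_def]
    by (intro conjI ballI) (simp_all only: canonical_span_orbit orbit_span_irreducible)
qed

end
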